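(* There exist constants $c_1,c_2>0$ and an absolute constant $\varepsilon>0$ such that for every sufficiently large $n$ there is a family of $\Gamma\ge n^{c_1\log n}$ games $G_i=(R_i,C_i)$, $i=1,\dots,\Gamma$, each with $n$ pure strategies for both players and all payoffs in $[-1,1]$, such that: (1) (Completeness) there is a single pseudo-distribution of degree at least $c_2\log n$ which is a pseudo-equilibrium of every $G_i$ simultaneously; (2) (Soundness) for any $i\neq j$, if $(x,y)$ is an $\varepsilon$-NE of $G_i$ and $(x',y')$ is an $\varepsilon$-NE of $G_j$, then $x\neq x'$ and $y\neq y'$.
   Context: A two-player game with $n$ strategies is a pair $(R,C)$ of matrices in $\mathbb{R}^{n\times n}$. Mixed strategies are elements of $\Delta_n=\{x\in[0,1]^n:\sum_ix_i=1\}$; $e_i$ is the $i$-th pure strategy. $(x,y)$ is an $\varepsilon$-NE if $x^\top Ry\ge e_i^\top Ry-\varepsilon$ and $x^\top Cy\ge x^\top Ce_j-\varepsilon$ for all $i,j$. A degree-$d$ pseudo-distribution on $\mathbb{R}^m$ is a finitely supported signed measure $\tilde\mu$ whose functional $\tilde{\mathbb E}[f]=\sum_z\tilde\mu(z)f(z)$ satisfies $\tilde{\mathbb E}[1]=1$ and $\tilde{\mathbb E}[q^2]\ge0$ for all polynomials $q$ of degree $\le d/2$; it satisfies $h\ge0$ if $\tilde{\mathbb E}[p^2h]\ge0$ for all polynomials $p$ with $\deg(p^2h)\le d$ ($h=0$ means $h\ge0$ and $-h\ge0$). A degree-$d$ pseudo-equilibrium of $(R,C)$ is a degree-$d$ pseudo-distribution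 over $(x,y)\in\mathbb{R}^{2n}$ satisfying $x_i,y_i\ge0$, $\sum_ix_i=\sum_iy_i=1$, $x^\top Ry-e_i^\top Ry\ge0$ and $x^\top Cy-x^\top Ce_j\ge0$ for all $i,j$. *)

theory Defs
  imports Complex_Main "Jordan_Normal_Form.Matrix"
begin

type_synonym game = "real mat \<times> real mat"

definition is_game :: "nat \<Rightarrow> game \<Rightarrow> bool" where
  "is_game n G \<longleftrightarrow> fst G \<in> carrier_mat n n \<and> snd G \<in> carrier_mat n n"

definition mixed_strategies :: "nat \<Rightarrow> real vec set" where
  "mixed_strategies n =
     {x \<in> carrier_vec n. (\<forall>i<n. 0 \<le> x $ i \<and> x $ i \<le> 1) \<and> (\<Sum>i<n. x $ i) = 1}"

definition row_advantage :: "nat \<Rightarrow> game \<Rightarrow> nat \<Rightarrow> real vec \<Rightarrow> real vec \<Rightarrow> real" where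
  "row_advantage n G i x y =
     x \<bullet> (fst G *\<^sub>v y) - unit_vec n i \<bullet> (fst G *\<^sub>v y)"

definition col_advantage :: "nat \<Rightarrow> game \<Rightarrow> nat \<Rightarrow> real vec \<Rightarrow> real vec \<Rightarrow> real" where
  "col_advantage n G j x y =
     x \<bullet> (snd G *\<^sub>v y) - x \<bullet> (snd G *\<^sub>v unit_vec n j)"

definition approx_NE :: "real \<Rightarrow> nat \<Rightarrow> game \<Rightarrow> real vec \<Rightarrow> real vec \<Rightarrow> bool" where
  "approx_NE \<epsilon> n G x y \<longleftrightarrow>
     x \<in> mixed_strategies n \<and> y \<in> mixed_strategies n \<and>
     (\<forall>i<n. row_advantage n G i x y \<ge> - \<epsilon>) \<and>
     (\<forall>j<n. col_advantage n G j x y \<ge> - \<epsilon>)"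

(* A real polynomial in m variables is identified with the function it induces on R^m. As the
   reals are an infinite field, this loses nothing: the function determines the polynomial, hence
   also its total degree. An exponent a stands for the monomial z_0^(a 0) * ... * z_(m-1)^(a (m-1)).
   Values outside carrier_vec m are irrelevant. *)
definition poly_deg_le :: "nat \<Rightarrow> nat \<Rightarrow> (real vec \<Rightarrow> real) \<Rightarrow> bool" where
  "poly_deg_le m k f \<longleftrightarrow>
     (\<exists>(A :: (nat \<Rightarrow> nat) set) c. finite A \<and> (\<forall>a\<in>A. (\<Sum>i<m. a i) \<le> k) \<and>
        (\<forall>z \<in> carrier_vec m. f z = (\<Sum>a\<in>A. c a * (\<Prod>i<m. (z $ i) ^ a i))))"

definition pseudo_expectation :: "(real vec \<Rightarrow> real) \<Rightarrow> (real vec \<Rightarrow> real) \<Rightarrow> real" where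
  "pseudo_expectation \<mu> f = (\<Sum>z | \<mu> z \<noteq> 0. \<mu> z * f z)"

(* The signed measure is given by its point masses. *)
definition pseudo_distribution :: "nat \<Rightarrow> nat \<Rightarrow> (real vec \<Rightarrow> real) \<Rightarrow> bool" where
  "pseudo_distribution d m \<mu> \<longleftrightarrow>
     finite {z. \<mu> z \<noteq> 0} \<and> {z. \<mu> z \<noteq> 0} \<subseteq> carrier_vec m \<and>
     pseudo_expectation \<mu> (\<lambda>z. 1) = 1 \<and>
     (\<forall>q k. poly_deg_le m k q \<and> real k \<le> real d / 2 \<longrightarrow> pseudo_expectation \<mu> (\<lambda>z. (q z)\<^sup>2) \<ge> 0)"

definition satisfies_ge0 ::
    "nat \<Rightarrow> nat \<Rightarrow> (real vec \<Rightarrow> real) \<Rightarrow> (real vec \<Rightarrow> real) \<Rightarrow> bool" where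
  "satisfies_ge0 d m \<mu> h \<longleftrightarrow>
     (\<forall>p k. poly_deg_le m k p \<and> poly_deg_le m d (\<lambda>z. (p z)\<^sup>2 * h z) \<longrightarrow>
        pseudo_expectation \<mu> (\<lambda>z. (p z)\<^sup>2 * h z) \<ge> 0)"

definition satisfies_eq0 ::
    "nat \<Rightarrow> nat \<Rightarrow> (real vec \<Rightarrow> real) \<Rightarrow> (real vec \<Rightarrow> real) \<Rightarrow> bool" where
  "satisfies_eq0 d m \<mu> h \<longleftrightarrow>
     satisfies_ge0 d m \<mu> h \<and> satisfies_ge0 d m \<mu> (\<lambda>z. - h z)"

(* A point of R^(2n) is the concatenation of x = vec_first z n and y = vec_last z n. *)
definition pseudo_equilibrium :: "nat \<Rightarrow> nat \<Rightarrow> game \<Rightarrow> (real vec \<Rightarrow> real) \<Rightarrow> bool" where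
  "pseudo_equilibrium d n G \<mu> \<longleftrightarrow>
     pseudo_distribution d (2 * n) \<mu> \<and>
     (\<forall>i<n. satisfies_ge0 d (2 * n) \<mu> (\<lambda>z. vec_first z n $ i)) \<and>
     (\<forall>i<n. satisfies_ge0 d (2 * n) \<mu> (\<lambda>z. vec_last z n $ i)) \<and>
     satisfies_eq0 d (2 * n) \<mu> (\<lambda>z. (\<Sum>i<n. vec_first z n $ i) - 1) \<and>
     satisfies_eq0 d (2 * n) \<mu> (\<lambda>z. (\<Sum>i<n. vec_last z n $ i) - 1) \<and>
     (\<forall>i<n. satisfies_ge0 d (2 * n) \<mu>
        (\<lambda>z. row_advantage n G i (vec_first z n) (vec_last z n))) \<and>
     (\<forall>j<n. satisfies_ge0 d (2 * n) \<mu>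
        (\<lambda>z. col_advantage n G j (vec_first z n) (vec_last z n)))"

end

(* The payoffs combine two blocks of strategies. In the first block a strategy is a question a < k
   with an answer in F_2^K, and the payoff of both players is the sign by which a pair of strategies
   satisfies a linear constraint over F_2. The constraints are chosen so that those among few
   questions are linearly independent, whereas every assignment violates a constant fraction of all
   of them. Independence makes the moments "value of a character = its sign if it is a product of
   constraints on few questions, 0 otherwise" a pseudo-distribution of degree Omega(k) that satisfies
   every constraint; it plays uniform questions in the first block and earns the maximal payoff there.
   A player may instead deviate to the second block, whose test sets T punish opponents with
   non-uniform questions; since true strategies cannot satisfy the constraints, every approximate
   equilibrium lives in the second block. There the players play a zero-sum game in which each has to
   be nearly uniform on the graph of a function g from questions to F_2^K. Taking for g the words of a
   code of distance 1/2 gives 2^(Omega(k^2)) games that differ only in the second block, and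
   n = 2^(O(k)). *)
theory Submission
  imports Defs "HOL-Library.FuncSet" "HOL-Computational_Algebra.Polynomial"
begin

section \<open>Characters and pseudo-moments\<close>

text \<open>With O(log n) questions and O(log n) answer bits each, only a dense system can be
  unsatisfiable, and in a dense system sums of constraints could cancel. Hence the constraint of a
  pair (a, b) tests the answer to a on \<open>p b\<close> and the answer to b on \<open>p a\<close>.
  In a sum of constraints the part at a is the sum of \<open>p b\<close> over the partners b of a;
  when few questions are touched, this is a nonempty sum of few independent vectors and so is
  nonzero. No touched question drops out, and a small set of constraints is recovered from its sum;
  this is what makes the moments consistent. Taking k = 4K balances the counts: the 2kK = 8K^2
  answer bits are few enough for k^2 = 16K^2 signs to defeat every assignment. The offset 1/2 in the
  payoffs creates a tie: the pseudo-distribution earns 1/2, and a deviation to the second block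
  earns exactly 1/2 against uniform questions, while true play of the first block with near-uniform
  questions earns at most about 7/16. The function g matters only when both players are in the
  second block, which the pseudo-distribution never plays.\<close>

definition chi :: "'a set \<Rightarrow> 'a set \<Rightarrow> real" where
  "chi A W = (-1) ^ card (A \<inter> W)"

lemma chi_commute: "chi A W = chi W A"
  by (simp add: chi_def Int_commute)

lemma chi_empty [simp]: "chi {} W = 1"
  by (simp add: chi_def)

lemma chi_cases: "chi A W = 1 \<or> chi A W = -1"
  using neg_one_even_power neg_one_odd_power unfolding chi_def by metis

lemma abs_chi [simp]: "\<bar>chi A W\<bar> = 1"
  using chi_cases[of A W] by auto

lemma card_sym_diff_parity:
  assumes "finite A" "finite B"
  shows "(-1) ^ card (sym_diff A B) = (-1 :: real) ^ card A * (-1) ^ card B"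
proof -
  have "card (sym_diff A B) = card (A - B) + card (B - A)"
    using assms by (intro card_Un_disjoint) auto
  moreover have "card A = card (A - B) + card (A \<inter> B)"
    using assms by (metis Int_Diff_Un Int_Diff_disjoint Int_commute add.commute card_Un_disjoint finite_Diff finite_Int)
  moreover have "card B = card (B - A) + card (A \<inter> B)"
    using assms by (metis Int_Diff_Un Int_Diff_disjoint Int_commute add.commute card_Un_disjoint finite_Diff finite_Int)
  ultimately have "(-1 :: real) ^ card A * (-1) ^ card B
      = (-1) ^ card (sym_diff A B) * ((-1) ^ card (A \<inter> B) * (-1) ^ card (A \<inter> B))"
    by (simp add: power_add mult_ac)
  also have "(-1 :: real) ^ card (A \<inter> B) * (-1) ^ card (A \<inter> B) = 1"
    by (simp flip: power_mult_distrib)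
  finally show ?thesis by simp
qed

lemma chi_sym_diff:
  assumes "finite A" "finite B"
  shows "chi (sym_diff A B) W = chi A W * chi B W"
proof -
  have "sym_diff A B \<inter> W = sym_diff (A \<inter> W) (B \<inter> W)" by auto
  then show ?thesis
    using card_sym_diff_parity[of "A \<inter> W" "B \<inter> W"] assms by (simp add: chi_def)
qed

lemma sum_chi:
  assumes "finite X" "A \<subseteq> X"
  shows "(\<Sum>W\<in>Pow X. chi A W) = (if A = {} then 2 ^ card X else 0)"
proof (cases "A = {}")
  case True
  then show ?thesis using assms by (simp add: card_Pow)
next
  case False
  then obtain a where a: "a \<in> A" by auto
  \<comment> \<open>Toggling one element a of A is an involution of \<open>Pow X\<close> that flips
    the sign of the character.\<close>
  let ?t = "\<lambda>W. sym_diff W {a}"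
  have "(\<Sum>W\<in>Pow X. chi A W) = (\<Sum>W\<in>Pow X. chi A (?t W))"
    by (rule sum.reindex_bij_witness[of _ ?t ?t]) (use a assms in \<open>auto intro!: arg_cong[of _ _ "chi A"]\<close>)
  also have "\<dots> = (\<Sum>W\<in>Pow X. - chi A W)"
  proof (intro sum.cong refl)
    fix W assume "W \<in> Pow X"
    then have "finite W" using assms finite_subset by auto
    then have "chi A (?t W) = chi A W * chi A {a}"
      using chi_sym_diff[of W "{a}" A] by (simp add: chi_commute)
    also have "chi A {a} = -1" using a by (simp add: chi_def)
    finally show "chi A (?t W) = - chi A W" by simp
  qed
  finally show ?thesis using False by (simp add: sum_negf)
qed

lemma indicator_eq_sum_chi:
  assumes "finite S" "U \<subseteq> S" "W \<subseteq> S"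
  shows "(if W = U then 1 else 0) = (\<Sum>A\<in>Pow S. chi A U * chi A W) / 2 ^ card S"
proof -
  have "finite U" "finite W" using assms finite_subset by auto
  then have "(\<Sum>A\<in>Pow S. chi A U * chi A W) = (\<Sum>A\<in>Pow S. chi (sym_diff U W) A)"
    by (intro sum.cong refl) (simp add: chi_sym_diff chi_commute[of _ U] chi_commute[of _ W])
  also have "\<dots> = (if sym_diff U W = {} then 2 ^ card S else 0)"
    using assms by (intro sum_chi) auto
  also have "sym_diff U W = {} \<longleftrightarrow> W = U" by auto
  finally show ?thesis by simp
qed

(* The relation M x y \<noteq> 0 is an equivalence whose classes carry rank-one blocks of M; averaging the
   squares of the row sums over a class gives the quadratic form. *)
lemma quadratic_form_nonneg:
  fixes M :: "'a \<Rightarrow> 'a \<Rightarrow> real"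
  assumes fin: "finite I"
    and diag: "\<And>x. x \<in> I \<Longrightarrow> M x x = 1"
    and sym: "\<And>x y. x \<in> I \<Longrightarrow> y \<in> I \<Longrightarrow> M x y = M y x"
    and trans: "\<And>x y z. x \<in> I \<Longrightarrow> y \<in> I \<Longrightarrow> z \<in> I \<Longrightarrow> M x y \<noteq> 0 \<Longrightarrow> M y z \<noteq> 0
        \<Longrightarrow> M x z = M x y * M y z"
  shows "(\<Sum>x\<in>I. \<Sum>y\<in>I. f x * f y * M x y) \<ge> 0"
proof -
  define N where "N z = (\<Sum>y\<in>I. (M z y)\<^sup>2)" for z
  have sq: "(M x y)\<^sup>2 = 1" if "x \<in> I" "y \<in> I" "M x y \<noteq> 0" for x y
    using trans[of x y x] sym[of x y] diag[of x] that by (simp add: power2_eq_square)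
  have N_pos: "N z > 0" if "z \<in> I" for z
    unfolding N_def using that fin diag
    by (intro sum_pos2[of _ z]) auto
  have inner: "(\<Sum>z\<in>I. M x z * M y z / N z) = M x y" if x: "x \<in> I" and y: "y \<in> I" for x y
  proof (cases "M x y = 0")
    case True
    have "M x z * M y z = 0" if "z \<in> I" for z
      using trans[of x z y] sym[of y z] True that x y by auto
    then show ?thesis using True by (simp add: sum.neutral)
  next
    case False
    have eq: "M x z * M y z / N z = M x y * ((M x z)\<^sup>2 / N x)" if z: "z \<in> I" for z
    proof (cases "M x z = 0")
      case True
      then show ?thesis by simp
    next
      case nz: False
      have "M y z = M y x * M x z" using trans[of y x z] sym[of x y] False nz x y z by auto
      moreover have "N z = N x"
        unfolding N_def
      proof (intro sum.cong refl)
        fix w assume w: "w \<in> I"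
        show "(M z w)\<^sup>2 = (M x w)\<^sup>2"
        proof (cases "M x w = 0")
          case True
          then have "M z w = 0" using trans[of x z w] nz x z w by auto
          then show ?thesis using True by simp
        next
          case False
          then have "M z w \<noteq> 0" using trans[of z x w] sym[of x z] nz x z w by auto
          then show ?thesis using sq False x z w by simp
        qed
      qed
      ultimately show ?thesis using sym[of x y] x y by (simp add: power2_eq_square)
    qed
    have "(\<Sum>z\<in>I. M x z * M y z / N z) = (\<Sum>z\<in>I. M x y * ((M x z)\<^sup>2 / N x))"
      by (intro sum.cong refl eq)
    also have "\<dots> = M x y * (N x / N x)"
      by (simp only: N_def[symmetric] flip: sum_distrib_left sum_divide_distrib)
    finally show ?thesis using N_pos[OF x] by simp
  qed
  have "(\<Sum>x\<in>I. \<Sum>y\<in>I. f x * f y * M x y)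
      = (\<Sum>x\<in>I. \<Sum>y\<in>I. \<Sum>z\<in>I. f x * f y * (M x z * M y z / N z))"
    by (intro sum.cong refl, subst sum_distrib_left[symmetric]) (simp only: inner)
  also have "\<dots> = (\<Sum>x\<in>I. \<Sum>z\<in>I. \<Sum>y\<in>I. f x * f y * (M x z * M y z / N z))"
    by (intro sum.cong refl sum.swap)
  also have "\<dots> = (\<Sum>z\<in>I. \<Sum>x\<in>I. \<Sum>y\<in>I. f x * f y * (M x z * M y z / N z))"
    by (rule sum.swap)
  also have "\<dots> = (\<Sum>z\<in>I. (\<Sum>x\<in>I. f x * M x z)\<^sup>2 / N z)"
    by (intro sum.cong refl)
      (simp add: power2_eq_square sum_product sum_divide_distrib mult_ac)
  also have "\<dots> \<ge> 0"
    by (intro sum_nonneg divide_nonneg_nonneg) (auto simp: N_def sum_nonneg)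
  finally show ?thesis .
qed

text \<open>Fourier degree counted in questions: \<open>t\<close> bounds the number of first
  components that a character meets, however many bits of one answer it reads. The rule
  \<open>cong\<close> asks for equality on subsets of X only, as nothing else carries
  weight.\<close>

inductive junta :: "('i \<times> 'j) set \<Rightarrow> nat \<Rightarrow> (('i \<times> 'j) set \<Rightarrow> real) \<Rightarrow> bool"
  for X t where
  zero: "junta X t (\<lambda>W. 0)"
| add: "junta X t F \<Longrightarrow> A \<subseteq> X \<Longrightarrow> card (fst ` A) \<le> t \<Longrightarrow> junta X t (\<lambda>W. F W + r * chi A W)"
| cong: "junta X t F \<Longrightarrow> (\<And>W. W \<subseteq> X \<Longrightarrow> F W = G W) \<Longrightarrow> junta X t G"

lemma junta_chi: "A \<subseteq> X \<Longrightarrow> card (fst ` A) \<le> t \<Longrightarrow> junta X t (chi A)"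
  using junta.add[OF junta.zero, of A X t 1] by simp

lemma junta_const: "junta X t (\<lambda>W. r)"
  using junta.add[OF junta.zero, of "{}" X t r] by simp

lemma junta_add: "junta X t F \<Longrightarrow> junta X t G \<Longrightarrow> junta X t (\<lambda>W. F W + G W)"
proof (rotate_tac 1, induction rule: junta.induct)
  case zero
  then show ?case by simp
next
  case (add G A r)
  from junta.add[OF add.IH[OF add.prems] add.hyps(2,3), of r] show ?case by (simp add: add.assoc)
next
  case (cong G H)
  then show ?case by (auto intro: junta.cong)
qed

lemma junta_scale: "junta X t F \<Longrightarrow> junta X t (\<lambda>W. r * F W)"
proof (induction rule: junta.induct)
  case zero
  then show ?case by (simp add: junta.zero)
next
  case (add F A s)
  from junta.add[OF add.IH add.hyps(2,3), of "r * s"] show ?case by (simp add: algebra_simps)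
next
  case (cong G H)
  then show ?case by (auto intro: junta.cong)
qed

lemma junta_diff: "junta X t F \<Longrightarrow> junta X t G \<Longrightarrow> junta X t (\<lambda>W. F W - G W)"
  using junta_add[of X t F "\<lambda>W. -1 * G W"] junta_scale[of X t G "-1"] by simp

lemma junta_sum:
  "(\<And>i. i \<in> I \<Longrightarrow> junta X t (F i)) \<Longrightarrow> junta X t (\<lambda>W. \<Sum>i\<in>I. F i W)"
  by (induction I rule: infinite_finite_induct) (auto intro: junta.zero junta_add)

lemma junta_mono: "junta X s F \<Longrightarrow> s \<le> t \<Longrightarrow> junta X t F"
proof (induction rule: junta.induct)
  case (add F A r)
  then show ?case by (intro junta.add) auto
next
  case (cong F G)
  then show ?case by (auto intro: junta.cong)
qed (rule junta.zero)

lemma junta_mult_chi: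
  assumes "finite X" "junta X s F" "A \<subseteq> X" "card (fst ` A) \<le> t"
  shows "junta X (s + t) (\<lambda>W. F W * chi A W)"
  using assms(2)
proof (induction rule: junta.induct)
  case zero
  then show ?case by (simp add: junta.zero)
next
  case (add F B r)
  have fin: "finite A" "finite B" using assms add finite_subset by auto
  have "card (fst ` sym_diff B A) \<le> card (fst ` B \<union> fst ` A)"
    using fin by (intro card_mono) auto
  also have "\<dots> \<le> s + t" using card_Un_le[of "fst ` B" "fst ` A"] add assms by linarith
  finally have "junta X (s + t) (\<lambda>W. F W * chi A W + r * chi (sym_diff B A) W)"
    using add assms by (intro junta.add) auto
  then show ?case using fin by (simp add: chi_sym_diff algebra_simps)
next
  case (cong G H)
  then show ?case by (auto intro: junta.cong)
qed

lemma junta_mult: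
  assumes "finite X" "junta X s F" "junta X t G"
  shows "junta X (s + t) (\<lambda>W. F W * G W)"
  using assms(3)
proof (induction rule: junta.induct)
  case zero
  then show ?case by (simp add: junta.zero)
next
  case (add G A r)
  from junta_add[OF add.IH junta_scale[OF junta_mult_chi[OF assms(1,2) add.hyps(2,3)], of r]]
  show ?case by (simp add: algebra_simps)
next
  case (cong G H)
  then show ?case by (auto intro: junta.cong)
qed

lemma junta_power: "finite X \<Longrightarrow> junta X s F \<Longrightarrow> junta X (s * m) (\<lambda>W. F W ^ m)"
  by (induction m) (auto intro: junta_const junta_mult)

lemma junta_prod:
  assumes "finite X" "finite I" "\<And>i. i \<in> I \<Longrightarrow> junta X (s i) (F i)"
  shows "junta X (\<Sum>i\<in>I. s i) (\<lambda>W. \<Prod>i\<in>I. F i W)"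
  using assms(2,3) by (induction I) (auto intro: junta_const junta_mult assms(1))

lemma junta_expansion:
  assumes "finite X" "junta X t F"
  obtains f where "\<And>W. W \<subseteq> X \<Longrightarrow> F W = (\<Sum>A | A \<subseteq> X \<and> card (fst ` A) \<le> t. f A * chi A W)"
proof -
  have fin: "finite {A. A \<subseteq> X \<and> card (fst ` A) \<le> t}"
    using assms(1) by simp
  from assms(2)
  have "\<exists>f. \<forall>W\<subseteq>X. F W = (\<Sum>A | A \<subseteq> X \<and> card (fst ` A) \<le> t. f A * chi A W)"
  proof (induction rule: junta.induct)
    case zero
    show ?case by (rule exI[of _ "\<lambda>_. 0"]) simp
  next
    case (add F A r)
    then obtain f where
      f: "\<forall>W\<subseteq>X. F W = (\<Sum>A | A \<subseteq> X \<and> card (fst ` A) \<le> t. f A * chi A W)" by blast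
    show ?case
    proof (rule exI[of _ "\<lambda>B. f B + (if B = A then r else 0)"], intro allI impI)
      fix W assume "W \<subseteq> X"
      have "(\<Sum>B | B \<subseteq> X \<and> card (fst ` B) \<le> t. (if B = A then r else 0) * chi B W)
          = (\<Sum>B | B \<subseteq> X \<and> card (fst ` B) \<le> t. if B = A then r * chi A W else 0)"
        by (intro sum.cong) auto
      also have "\<dots> = r * chi A W" using fin add by simp
      finally show "F W + r * chi A W = (\<Sum>B | B \<subseteq> X \<and> card (fst ` B) \<le> t.
          (f B + (if B = A then r else 0)) * chi B W)"
        using f \<open>W \<subseteq> X\<close> by (simp add: distrib_right sum.distrib)
    qed
  next
    case (cong F G)
    then show ?case by auto
  qed
  then show ?thesis using that by blast
qed

lemma chi_section: "chi ({i} \<times> A) W = chi A {j. (i, j) \<in> W}"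
proof -
  have "bij_betw (Pair i) (A \<inter> {j. (i, j) \<in> W}) ({i} \<times> A \<inter> W)"
    by (auto simp: bij_betw_def inj_on_def)
  then show ?thesis by (simp add: chi_def bij_betw_same_card)
qed

text \<open>Fourier inversion on the bits of a single question: only characters of sets
  \<open>{i} \<times> A\<close> occur, and each meets just the question i. This is why an answer of
  many bits costs degree 1.\<close>

lemma junta_coordinate:
  assumes "finite S" "{i} \<times> S \<subseteq> X" "U \<subseteq> S"
    and slice: "\<And>W. W \<subseteq> X \<Longrightarrow> {j. (i, j) \<in> W} \<subseteq> S"
  shows "junta X 1 (\<lambda>W. if {j. (i, j) \<in> W} = U then 1 else 0)"
proof -
  have sing: "card (fst ` ({i} \<times> A)) \<le> 1" for A :: "'b set"
    using card_mono[of "{i}" "fst ` ({i} \<times> A)"] by auto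
  have "junta X 1 (\<lambda>W. \<Sum>A\<in>Pow S. (chi A U / 2 ^ card S) * chi ({i} \<times> A) W)"
    using assms(1,2) by (intro junta_sum junta_scale junta_chi sing) auto
  then show ?thesis
  proof (rule junta.cong)
    fix W assume W: "W \<subseteq> X"
    have "(\<Sum>A\<in>Pow S. (chi A U / 2 ^ card S) * chi ({i} \<times> A) W)
        = (\<Sum>A\<in>Pow S. chi A U * chi A {j. (i, j) \<in> W}) / 2 ^ card S"
      by (simp add: chi_section sum_divide_distrib)
    then show "(\<Sum>A\<in>Pow S. (chi A U / 2 ^ card S) * chi ({i} \<times> A) W)
        = (if {j. (i, j) \<in> W} = U then 1 else 0)"
      using indicator_eq_sum_chi[OF assms(1,3) slice[OF W]] by simp
  qed
qed

section \<open>Signed measures with prescribed character moments\<close>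

locale pseudo_moments =
  fixes X :: "('i \<times> 'j) set" and \<sigma> :: "('i \<times> 'j) set \<Rightarrow> real" and D :: nat
  assumes finite_X: "finite X"
    and moment_empty: "\<sigma> {} = 1"
    and moment_mult: "\<And>A B. A \<subseteq> X \<Longrightarrow> B \<subseteq> X \<Longrightarrow> \<sigma> A \<noteq> 0 \<Longrightarrow> \<sigma> B \<noteq> 0
        \<Longrightarrow> card (fst ` sym_diff A B) \<le> D \<Longrightarrow> \<sigma> (sym_diff A B) = \<sigma> A * \<sigma> B"
begin

text \<open>Fourier inversion: the signed measure on \<open>Pow X\<close> under which each character
  has the prescribed moment. Its values may be negative.\<close>

definition weight :: "('i \<times> 'j) set \<Rightarrow> real" where
  "weight W = (\<Sum>A\<in>Pow X. \<sigma> A * chi A W) / 2 ^ card X"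

definition expect :: "(('i \<times> 'j) set \<Rightarrow> real) \<Rightarrow> real" where
  "expect F = (\<Sum>W\<in>Pow X. weight W * F W)"

lemma finite_sub: "A \<subseteq> X \<Longrightarrow> finite A"
  using finite_X finite_subset by blast

lemma expect_cong: "(\<And>W. W \<subseteq> X \<Longrightarrow> F W = G W) \<Longrightarrow> expect F = expect G"
  by (simp add: expect_def)

lemma expect_add: "expect (\<lambda>W. F W + G W) = expect F + expect G"
  by (simp add: expect_def algebra_simps sum.distrib)

lemma expect_diff: "expect (\<lambda>W. F W - G W) = expect F - expect G"
  by (simp add: expect_def algebra_simps sum_subtractf)

lemma expect_scale: "expect (\<lambda>W. r * F W) = r * expect F"
  by (simp add: expect_def algebra_simps sum_distrib_left)

lemma expect_sum: "expect (\<lambda>W. \<Sum>i\<in>I. F i W) = (\<Sum>i\<in>I. expect (F i))"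
  unfolding expect_def sum_distrib_left by (rule sum.swap)

lemma expect_chi:
  assumes "A \<subseteq> X"
  shows "expect (chi A) = \<sigma> A"
proof -
  have "expect (chi A) = (\<Sum>W\<in>Pow X. \<Sum>B\<in>Pow X. \<sigma> B * chi (sym_diff B A) W) / 2 ^ card X"
    unfolding expect_def weight_def sum_divide_distrib
    by (intro sum.cong refl)
      (use assms finite_sub in \<open>simp add: chi_sym_diff sum_distrib_left mult_ac sum_divide_distrib\<close>)
  also have "\<dots> = (\<Sum>B\<in>Pow X. \<sigma> B * (\<Sum>W\<in>Pow X. chi (sym_diff B A) W)) / 2 ^ card X"
    by (subst sum.swap) (simp add: sum_distrib_left)
  also have "\<dots> = (\<Sum>B\<in>Pow X. if B = A then \<sigma> A * 2 ^ card X else 0) / 2 ^ card X"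
  proof (intro arg_cong2[of _ _ _ _ "(/)"] sum.cong refl)
    fix B assume "B \<in> Pow X"
    then have "(\<Sum>W\<in>Pow X. chi (sym_diff B A) W) = (if sym_diff B A = {} then 2 ^ card X else 0)"
      using assms finite_X by (intro sum_chi) auto
    also have "sym_diff B A = {} \<longleftrightarrow> B = A" by auto
    finally show "\<sigma> B * (\<Sum>W\<in>Pow X. chi (sym_diff B A) W)
        = (if B = A then \<sigma> A * 2 ^ card X else 0)" by simp
  qed
  also have "\<dots> = \<sigma> A" using assms finite_X by simp
  finally show ?thesis .
qed

lemma expect_one: "expect (\<lambda>W. 1) = 1"
  using expect_chi[of "{}"] expect_cong[of "\<lambda>W. 1" "chi {}"] moment_empty by simp

lemma moment_square:
  assumes "A \<subseteq> X" "\<sigma> A \<noteq> 0"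
  shows "\<sigma> A * \<sigma> A = 1"
  using moment_mult[of A A] assms moment_empty by simp

text \<open>Expanding the square gives the quadratic form with entries
  \<open>\<sigma> (sym_diff A B)\<close>, over sets A, B that meet at most t questions. For three
  such sets \<open>sym_diff A C\<close> meets at most 2t \<le> D questions, so the moments multiply
  along A, B, C, which is the transitivity that \<open>quadratic_form_nonneg\<close> asks
  for.\<close>

lemma expect_square_nonneg:
  assumes "junta X t F" "2 * t \<le> D"
  shows "expect (\<lambda>W. (F W)\<^sup>2) \<ge> 0"
proof -
  let ?I = "{A. A \<subseteq> X \<and> card (fst ` A) \<le> t}"
  have fin: "finite ?I" using finite_X by simp
  obtain f where f: "\<And>W. W \<subseteq> X \<Longrightarrow> F W = (\<Sum>A\<in>?I. f A * chi A W)"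
    using junta_expansion[OF finite_X assms(1)] by blast
  have "expect (\<lambda>W. (F W)\<^sup>2) = expect (\<lambda>W. \<Sum>A\<in>?I. \<Sum>B\<in>?I. f A * f B * chi (sym_diff A B) W)"
  proof (rule expect_cong)
    fix W assume "W \<subseteq> X"
    then have "(F W)\<^sup>2 = (\<Sum>A\<in>?I. \<Sum>B\<in>?I. (f A * chi A W) * (f B * chi B W))"
      by (simp add: f power2_eq_square sum_product)
    also have "\<dots> = (\<Sum>A\<in>?I. \<Sum>B\<in>?I. f A * f B * chi (sym_diff A B) W)"
      by (intro sum.cong refl) (simp add: chi_sym_diff finite_sub mult_ac)
    finally show "(F W)\<^sup>2 = (\<Sum>A\<in>?I. \<Sum>B\<in>?I. f A * f B * chi (sym_diff A B) W)" .
  qed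
  also have "\<dots> = (\<Sum>A\<in>?I. \<Sum>B\<in>?I. f A * f B * \<sigma> (sym_diff A B))"
    unfolding expect_sum expect_scale
    by (intro sum.cong refl arg_cong2[of _ _ _ _ times] expect_chi) auto
  also have "\<dots> \<ge> 0"
  proof (rule quadratic_form_nonneg[OF fin])
    fix A B C assume A: "A \<in> ?I" and B: "B \<in> ?I" and C: "C \<in> ?I"
      and nz: "\<sigma> (sym_diff A B) \<noteq> 0" "\<sigma> (sym_diff B C) \<noteq> 0"
    have eq: "sym_diff (sym_diff A B) (sym_diff B C) = sym_diff A C" by auto
    have "card (fst ` sym_diff A C) \<le> card (fst ` A \<union> fst ` C)"
      using A C finite_sub by (intro card_mono) auto
    also have "\<dots> \<le> D" using A C assms(2) card_Un_le[of "fst ` A" "fst ` C"] by simp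
    finally have "card (fst ` sym_diff A C) \<le> D" .
    then show "\<sigma> (sym_diff A C) = \<sigma> (sym_diff A B) * \<sigma> (sym_diff B C)"
      using moment_mult[of "sym_diff A B" "sym_diff B C"] nz A B C unfolding eq by blast
  next
    fix A B
    show "\<sigma> (sym_diff A B) = \<sigma> (sym_diff B A)" by (simp add: Un_commute)
  qed (simp add: moment_empty)
  finally show ?thesis .
qed

text \<open>A set A with nonzero moment acts as the constraint \<open>chi A = \<sigma> A\<close>,
  satisfied with certainty against every F of suitable degree. Character by character this is
  \<open>\<sigma> A * \<sigma> (sym_diff B A) = \<sigma> B\<close>; it also holds if the right side
  is 0, since a nonzero moment of \<open>sym_diff B A\<close> would force one of B.\<close>

lemma expect_mult_moment:
  assumes "junta X t F" "A \<subseteq> X" "\<sigma> A \<noteq> 0" "t + card (fst ` A) \<le> D"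
  shows "expect (\<lambda>W. F W * (\<sigma> A * chi A W)) = expect F"
  using assms(1)
proof (induction rule: junta.induct)
  case zero
  show ?case by simp
next
  case (add F B r)
  have "\<sigma> A * \<sigma> (sym_diff B A) = \<sigma> B"
  proof -
    have "card (fst ` sym_diff B A) \<le> card (fst ` B \<union> fst ` A)"
      using add assms(2) finite_sub by (intro card_mono) auto
    then have small: "card (fst ` sym_diff B A) \<le> D"
      using card_Un_le[of "fst ` B" "fst ` A"] add assms(4) by linarith
    have eq: "sym_diff (sym_diff B A) A = B" by auto
    show ?thesis
    proof (cases "\<sigma> B = 0")
      case False
      then show ?thesis using moment_mult[of B A] small add assms moment_square[of A]
        by (metis mult.left_commute mult.right_neutral)
    next
      case True
      have "\<sigma> (sym_diff B A) = 0"
      proof (rule ccontr)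
        assume "\<sigma> (sym_diff B A) \<noteq> 0"
        moreover have "sym_diff B A \<subseteq> X" using add assms(2) by auto
        moreover have "card (fst ` B) \<le> D" using add assms(4) by linarith
        ultimately have "\<sigma> B = \<sigma> (sym_diff B A) * \<sigma> A"
          using moment_mult[of "sym_diff B A" A] assms(2,3) unfolding eq by blast
        then show False using True \<open>\<sigma> (sym_diff B A) \<noteq> 0\<close> assms(3) by simp
      qed
      then show ?thesis using True by simp
    qed
  qed
  moreover have "expect (\<lambda>W. (F W + r * chi B W) * (\<sigma> A * chi A W))
      = expect F + r * (\<sigma> A * expect (chi (sym_diff B A)))"
  proof -
    have "expect (\<lambda>W. (F W + r * chi B W) * (\<sigma> A * chi A W))
      = expect (\<lambda>W. F W * (\<sigma> A * chi A W) + r * (\<sigma> A * chi (sym_diff B A) W))"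
      using add assms(2) finite_sub by (intro expect_cong) (simp add: chi_sym_diff algebra_simps)
    then show ?thesis using add.IH by (simp add: expect_add expect_scale)
  qed
  moreover have "sym_diff B A \<subseteq> X" using add assms(2) by auto
  ultimately show ?case
    using add by (simp add: expect_chi expect_add expect_scale)
next
  case (cong F G)
  then show ?case
    using expect_cong[of F G] expect_cong[of "\<lambda>W. F W * (\<sigma> A * chi A W)" "\<lambda>W. G W * (\<sigma> A * chi A W)"]
    by simp
qed

end

section \<open>Independent constraints, unsatisfiable signs and codes\<close>

text \<open>Give J the weight (1/16)^|J|. All subsets together weigh (17/16)^|X|, and each small one
  weighs at least (1/16)^s.\<close>

lemma card_small_subsets:
  assumes "finite X"
  shows "real (card {J. J \<subseteq> X \<and> card J \<le> s}) \<le> (17/16) ^ card X * 16 ^ s"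
proof -
  have "real (card {J. J \<subseteq> X \<and> card J \<le> s}) * (1/16) ^ s
      = (\<Sum>J | J \<subseteq> X \<and> card J \<le> s. (1/16) ^ s)"
    by simp
  also have "\<dots> \<le> (\<Sum>J | J \<subseteq> X \<and> card J \<le> s. (1/16) ^ card J)"
    by (intro sum_mono power_decreasing) auto
  also have "\<dots> \<le> (\<Sum>J\<in>Pow X. (1/16) ^ card J)"
    using assms by (intro sum_mono2) auto
  also have "\<dots> = (17/16) ^ card X"
    using prod_add[OF assms, of "\<lambda>_. 1/16" "\<lambda>_. 1 :: real"] by simp
  finally show ?thesis by (simp add: field_simps power_divide)
qed

section \<open>Sums and independence over F_2\<close>

definition xor_sum :: "('i \<Rightarrow> 'a set) \<Rightarrow> 'i set \<Rightarrow> 'a set" where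
  "xor_sum f S = {x. odd (card {s \<in> S. x \<in> f s})}"

lemma xor_sum_empty [simp]: "xor_sum f {} = {}"
  by (simp add: xor_sum_def)

lemma xor_sum_subset: "(\<And>s. s \<in> S \<Longrightarrow> f s \<subseteq> X) \<Longrightarrow> xor_sum f S \<subseteq> X"
  unfolding xor_sum_def by (fastforce dest!: odd_pos simp: card_gt_0_iff)

lemma xor_sum_cong: "(\<And>s. s \<in> S \<Longrightarrow> f s = g s) \<Longrightarrow> xor_sum f S = xor_sum g S"
  unfolding xor_sum_def by (metis (mono_tags, lifting) Collect_cong)

lemma xor_sum_sym_diff:
  assumes "finite S" "finite T"
  shows "xor_sum f (sym_diff S T) = sym_diff (xor_sum f S) (xor_sum f T)"
proof (rule Set.set_eqI)
  fix x
  have eq: "{s \<in> sym_diff S T. x \<in> f s} = sym_diff {s \<in> S. x \<in> f s} {s \<in> T. x \<in> f s}" by auto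
  have "(-1 :: real) ^ card {s \<in> sym_diff S T. x \<in> f s}
      = (-1) ^ card {s \<in> S. x \<in> f s} * (-1) ^ card {s \<in> T. x \<in> f s}"
    unfolding eq using assms by (intro card_sym_diff_parity) auto
  then show "x \<in> xor_sum f (sym_diff S T) \<longleftrightarrow> x \<in> sym_diff (xor_sum f S) (xor_sum f T)"
    by (auto simp: xor_sum_def minus_one_power_iff split: if_splits)
qed

lemma xor_sum_insert:
  assumes "finite S" "s \<notin> S"
  shows "xor_sum f (insert s S) = sym_diff (f s) (xor_sum f S)"
proof -
  have "xor_sum f {s} = f s"
  proof -
    have "{t \<in> {s}. x \<in> f t} = (if x \<in> f s then {s} else {})" for x by auto
    then show ?thesis by (auto simp: xor_sum_def)
  qed
  moreover have "insert s S = sym_diff {s} S" using assms by auto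
  ultimately show ?thesis using xor_sum_sym_diff[of "{s}" S f] assms by simp
qed

text \<open>The greedy Gilbert-Varshamov choice of columns of a parity-check matrix: each new vector
  avoids all sums of at most s earlier ones, of which there are fewer than 2^K. A vanishing sum over
  J would express the vector of the largest index in J by earlier ones.\<close>

lemma independent_sets_exist:
  assumes "(17/16 :: real) ^ m * 16 ^ s < 2 ^ K"
  obtains p :: "nat \<Rightarrow> nat set" where "\<And>i. i < m \<Longrightarrow> p i \<subseteq> {..<K}"
    "\<And>J. J \<subseteq> {..<m} \<Longrightarrow> J \<noteq> {} \<Longrightarrow> card J \<le> s \<Longrightarrow> xor_sum p J \<noteq> {}"
proof -
  have "\<exists>p :: nat \<Rightarrow> nat set. \<forall>i<m. p i \<subseteq> {..<K} \<and>
      p i \<notin> xor_sum p ` {J. J \<subseteq> {..<i} \<and> card J \<le> s}"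
    using assms
  proof (induction m)
    case 0
    show ?case by simp
  next
    case (Suc m)
    have less: "(17/16 :: real) ^ m * 16 ^ s < 2 ^ K"
    proof -
      have "(17/16 :: real) ^ m * 16 ^ s \<le> (17/16) ^ Suc m * 16 ^ s"
        by (intro mult_right_mono power_increasing) auto
      then show ?thesis using Suc.prems by linarith
    qed
    from Suc.IH[OF this] obtain p :: "nat \<Rightarrow> nat set" where
      p: "\<forall>i<m. p i \<subseteq> {..<K} \<and> p i \<notin> xor_sum p ` {J. J \<subseteq> {..<i} \<and> card J \<le> s}" by blast
    let ?B = "xor_sum p ` {J. J \<subseteq> {..<m} \<and> card J \<le> s}"
    have fin: "finite ?B" by simp
    have "card ?B \<le> card {J. J \<subseteq> {..<m} \<and> card J \<le> s}" by (intro card_image_le) simp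
    then have "real (card ?B) \<le> real (card {J. J \<subseteq> {..<m} \<and> card J \<le> s})" by (rule of_nat_mono)
    then have "real (card ?B) < 2 ^ K"
      using card_small_subsets[OF finite_lessThan, of m s, unfolded card_lessThan] less by linarith
    then have "real (card ?B) < real (card (Pow {..<K}))" by (simp add: card_Pow)
    then have "card ?B < card (Pow {..<K})" by (simp only: of_nat_less_iff)
    then have "\<not> Pow {..<K} \<subseteq> ?B" using card_mono[OF fin, of "Pow {..<K}"] by linarith
    then obtain P where P: "P \<subseteq> {..<K}" "P \<notin> ?B" by blast
    have same: "xor_sum (p(m := P)) J = xor_sum p J" if "J \<subseteq> {..<i}" "i \<le> m" for J i
      using that by (intro xor_sum_cong) auto
    have "(p(m := P)) i \<subseteq> {..<K} \<and>
        (p(m := P)) i \<notin> xor_sum (p(m := P)) ` {J. J \<subseteq> {..<i} \<and> card J \<le> s}" if "i < Suc m" for i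
    proof (cases "i = m")
      case True
      then show ?thesis using P same[of _ m] by auto
    next
      case False
      then have "i < m" using that by simp
      then show ?thesis using p same[of _ i] by auto
    qed
    then show ?case by blast
  qed
  then obtain p :: "nat \<Rightarrow> nat set" where
    p: "\<forall>i<m. p i \<subseteq> {..<K} \<and> p i \<notin> xor_sum p ` {J. J \<subseteq> {..<i} \<and> card J \<le> s}" ..
  show ?thesis
  proof (rule that[of p])
    fix J assume J: "J \<subseteq> {..<m}" "J \<noteq> {}" "card J \<le> s"
    have finJ: "finite J" using J(1) finite_subset by blast
    define i where "i = Max J"
    have i: "i \<in> J" using J finJ i_def by simp
    have sub: "J - {i} \<subseteq> {..<i}" using finJ i_def by (auto intro: le_neq_trans Max_ge)
    have "card (J - {i}) \<le> s" using J(3) by (meson card_Diff1_le le_trans)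
    with sub have "xor_sum p (J - {i}) \<in> xor_sum p ` {J. J \<subseteq> {..<i} \<and> card J \<le> s}" by simp
    moreover have "i < m" using i J(1) by auto
    ultimately have "p i \<noteq> xor_sum p (J - {i})" using p by metis
    moreover have "xor_sum p J = sym_diff (p i) (xor_sum p (J - {i}))"
      using xor_sum_insert[of "J - {i}" i p] finJ i by (simp add: insert_absorb)
    ultimately show "xor_sum p J \<noteq> {}" by auto
  qed (use p in auto)
qed

section \<open>Averaging arguments for signs and codes\<close>

lemma sum_PiE_prod:
  fixes f :: "'i \<Rightarrow> 'a \<Rightarrow> real"
  assumes "finite I" "finite V"
  shows "(\<Sum>h\<in>(I \<rightarrow>\<^sub>E V). \<Prod>i\<in>I. f i (h i)) = (\<Prod>i\<in>I. \<Sum>v\<in>V. f i v)"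
  using prod_sum_PiE[of I "\<lambda>_. V" f] assms by simp

(* Average (1/16)^(number of violated entries) over all sign matrices; 1/16 = q^(-16) for q = 2^(1/4). *)
lemma far_sign_matrix_exists:
  fixes S :: "('i \<Rightarrow> real) set"
  assumes "finite I" "finite S" "I \<noteq> {}"
    and signs: "\<And>s i. s \<in> S \<Longrightarrow> i \<in> I \<Longrightarrow> s i = 1 \<or> s i = -1"
    and small: "real (card S) \<le> sqrt 2 ^ card I"
  obtains c where "\<And>i. c i = 1 \<or> c i = -1"
    "\<And>s. s \<in> S \<Longrightarrow> (\<Sum>i\<in>I. c i * s i) \<le> 7/8 * card I"
proof -
  let ?C = "I \<rightarrow>\<^sub>E {1, -1 :: real}"
  let ?q = "sqrt (sqrt 2) :: real"
  have q4: "?q ^ 4 = 2" using power_mult[of ?q 2 2] by simp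
  have q_pos: "?q > 0" by simp
  have finC: "finite ?C" using assms by (intro finite_PiE) auto
  have total: "(\<Sum>c\<in>?C. \<Sum>s\<in>S. \<Prod>i\<in>I. if c i = s i then 1 else 1/16) = real (card S) * (17/16) ^ card I"
  proof -
    have "(\<Sum>c\<in>?C. \<Sum>s\<in>S. \<Prod>i\<in>I. if c i = s i then 1 else 1/16 :: real)
       = (\<Sum>s\<in>S. \<Sum>c\<in>?C. \<Prod>i\<in>I. if c i = s i then 1 else 1/16)"
      by (rule sum.swap)
    also have "\<dots> = (\<Sum>s\<in>S. \<Prod>i\<in>I. \<Sum>v\<in>{1,-1}. if v = s i then 1 else 1/16)"
      using assms by (intro sum.cong refl sum_PiE_prod) auto
    also have "\<dots> = (\<Sum>s\<in>S. \<Prod>i\<in>I. 17/16)"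
    proof (intro sum.cong refl prod.cong)
      fix s i assume "s \<in> S" "i \<in> I"
      then show "(\<Sum>v\<in>{1,-1}. if v = s i then 1 else 1/16 :: real) = 17/16" using signs by fastforce
    qed
    finally show ?thesis by simp
  qed
  have "\<exists>c\<in>?C. (\<Sum>s\<in>S. \<Prod>i\<in>I. if c i = s i then 1 else 1/16 :: real) < (1 / ?q) ^ card I"
  proof (rule ccontr)
    assume "\<not> ?thesis"
    then have "(\<Sum>c\<in>?C. (1 / ?q) ^ card I) \<le> (\<Sum>c\<in>?C. \<Sum>s\<in>S. \<Prod>i\<in>I. if c i = s i then 1 else 1/16)"
      by (intro sum_mono) (auto simp: not_less)
    moreover have "card {1, -1 :: real} = 2" by simp
    then have "card ?C = 2 ^ card I" using assms(1) by (simp only: card_PiE prod_constant)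
    ultimately have "2 ^ card I * (1 / ?q) ^ card I \<le> real (card S) * (17/16) ^ card I"
      using total by simp
    also have "\<dots> \<le> sqrt 2 ^ card I * (17/16) ^ card I"
      using small by (intro mult_right_mono) auto
    finally have "(2 * (1 / ?q)) ^ card I \<le> (sqrt 2 * (17/16)) ^ card I"
      by (simp only: power_mult_distrib)
    then have "2 * (1 / ?q) \<le> sqrt 2 * (17/16)"
      using assms by (subst (asm) power_mono_iff) (auto simp: card_gt_0_iff)
    then have "2 \<le> sqrt 2 * ?q * (17/16)" using q_pos by (simp add: field_simps)
    \<comment> \<open>Fourth powers clear the roots and leave 16 \<le> 8 * (17/16)^4, which is
      false.\<close>
    then have "2 ^ 4 \<le> (sqrt 2 * ?q * (17/16)) ^ 4" by (intro power_mono) auto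
    also have "\<dots> = 4 * 2 * (17/16)^4"
      using power_mult[of "sqrt 2" 2 2] unfolding power_mult_distrib q4 by simp
    finally show False by (simp add: power_divide)
  qed
  then obtain c where c: "c \<in> ?C"
    and c_small: "(\<Sum>s\<in>S. \<Prod>i\<in>I. if c i = s i then 1 else 1/16 :: real) < (1 / ?q) ^ card I" by blast
  show ?thesis
  proof (rule that[of "\<lambda>i. if i \<in> I then c i else 1"])
    show "(if i \<in> I then c i else 1) = 1 \<or> (if i \<in> I then c i else 1) = -1" for i
      using c by auto
    fix s assume s: "s \<in> S"
    let ?V = "{i \<in> I. c i \<noteq> s i}"
    define w :: "('i \<Rightarrow> real) \<Rightarrow> real" where
      "w s = (\<Prod>i\<in>I. if c i = s i then 1 else 1/16)" for s
    have "w s = (1/16) ^ card ?V" unfolding w_def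
      using assms by (subst prod.If_cases) (auto simp: Collect_neg_eq[symmetric] Int_def)
    also have "(1/16 :: real) = (1 / ?q) ^ 16"
    proof -
      have "?q ^ 16 = (?q ^ 4) ^ 4" by (simp only: flip: power_mult) simp
      then show ?thesis unfolding q4 by (simp add: power_divide)
    qed
    finally have "w s = (1 / ?q) ^ (16 * card ?V)" by (simp only: power_mult)
    moreover have "w s \<le> sum w S"
      using s assms by (intro member_le_sum) (auto simp: w_def intro: prod_nonneg)
    ultimately have "(1 / ?q) ^ (16 * card ?V) < (1 / ?q) ^ card I"
      using c_small unfolding w_def by linarith
    \<comment> \<open>More than a 1/16 fraction of the entries is violated, and each violation
      lowers the correlation by 2; hence 1 - 2/16 = 7/8.\<close>
    then have V: "card I < 16 * card ?V"
      by (subst (asm) power_strict_decreasing_iff) auto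
    have "(\<Sum>i\<in>I. (if i \<in> I then c i else 1) * s i) = (\<Sum>i\<in>I. 1 - 2 * of_bool (c i \<noteq> s i))"
    proof (intro sum.cong refl)
      fix i assume i: "i \<in> I"
      then have "c i = 1 \<or> c i = -1" using c by auto
      then show "(if i \<in> I then c i else 1) * s i = 1 - 2 * of_bool (c i \<noteq> s i)"
        using signs[OF s i] i by auto
    qed
    also have "\<dots> = real (card I) - 2 * real (card ?V)"
      using assms by (simp add: sum_subtractf Int_def flip: sum_distrib_left)
    also have "\<dots> \<le> 7/8 * card I" using V by simp
    finally show "(\<Sum>i\<in>I. (if i \<in> I then c i else 1) * s i) \<le> 7/8 * card I" .
  qed
qed

text \<open>Markov's inequality for the weight q^(number of agreements with c), where q = |V|.
  Summed over all h the weight factors over I, with factor 2q - 1 < 2q at each point, while more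
  than |I|/2 agreements force a weight of at least (sqrt q)^|I|.\<close>

lemma card_agreeing_functions:
  assumes "finite I" "finite V" "c \<in> I \<rightarrow>\<^sub>E V"
  shows "real (card {h \<in> I \<rightarrow>\<^sub>E V. card I < 2 * card {i \<in> I. h i = c i}}) \<le> (2 * sqrt (card V)) ^ card I"
proof (cases "V = {}")
  case True
  then show ?thesis using assms by (cases "I = {}") auto
next
  case False
  let ?q = "real (card V)"
  let ?B = "{h \<in> I \<rightarrow>\<^sub>E V. card I < 2 * card {i \<in> I. h i = c i}}"
  have finF: "finite (I \<rightarrow>\<^sub>E V)" using assms by (intro finite_PiE) auto
  have q: "?q \<ge> 1" using False assms by (simp add: Suc_le_eq card_gt_0_iff)
  have prod_eq: "(\<Prod>i\<in>I. if h i = c i then ?q else 1) = ?q ^ card {i \<in> I. h i = c i}" for h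
    using assms by (simp add: prod.If_cases Int_def)
  have "real (card ?B) * sqrt ?q ^ card I = (\<Sum>h\<in>?B. sqrt ?q ^ card I)" by simp
  also have "\<dots> \<le> (\<Sum>h\<in>?B. \<Prod>i\<in>I. if h i = c i then ?q else 1)"
  proof (rule sum_mono)
    fix h assume "h \<in> ?B"
    then have "sqrt ?q ^ card I \<le> sqrt ?q ^ (2 * card {i \<in> I. h i = c i})"
      using q by (intro power_increasing) auto
    then show "sqrt ?q ^ card I \<le> (\<Prod>i\<in>I. if h i = c i then ?q else 1)"
      using prod_eq by (simp add: power_mult)
  qed
  also have "\<dots> \<le> (\<Sum>h\<in>I \<rightarrow>\<^sub>E V. \<Prod>i\<in>I. if h i = c i then ?q else 1)"
    using finF by (intro sum_mono2) (auto intro: prod_nonneg)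
  also have "\<dots> = (\<Prod>i\<in>I. \<Sum>v\<in>V. if v = c i then ?q else 1)"
    using assms by (intro sum_PiE_prod)
  also have "\<dots> \<le> (\<Prod>i\<in>I. 2 * ?q)"
  proof (intro prod_mono conjI)
    fix i assume "i \<in> I"
    then have "c i \<in> V" using assms by auto
    then have "(\<Sum>v\<in>V. if v = c i then ?q else 1) = ?q + (\<Sum>v\<in>V - {c i}. if v = c i then ?q else 1)"
      using assms by (subst sum.remove[of V "c i"]) auto
    also have "(\<Sum>v\<in>V - {c i}. if v = c i then ?q else 1) = (\<Sum>v\<in>V - {c i}. 1)"
      by (intro sum.cong) auto
    also have "\<dots> \<le> ?q" using assms by (simp add: card_mono)
    finally show "(\<Sum>v\<in>V. if v = c i then ?q else 1) \<le> 2 * ?q" by simp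
  qed (auto intro: sum_nonneg)
  also have "\<dots> = (2 * sqrt ?q) ^ card I * sqrt ?q ^ card I"
  proof -
    have "2 * ?q = (2 * sqrt ?q) * sqrt ?q" by simp
    then show ?thesis by (simp only: prod_constant power_mult_distrib)
  qed
  finally show ?thesis using q by simp
qed

text \<open>Greedy choice: the balls of functions agreeing with an earlier choice on more than half
  of I do not cover the space. The first function is free, so a budget for m balls yields the m + 1
  functions with indices 0 to m.\<close>

lemma far_functions_exist:
  assumes "finite I" "finite V"
    and "real m * (2 * sqrt (card V)) ^ card I < real (card V) ^ card I"
  obtains g where "\<And>j. j \<le> m \<Longrightarrow> g j \<in> I \<rightarrow>\<^sub>E V"
    "\<And>i j. i \<le> m \<Longrightarrow> j \<le> m \<Longrightarrow> i \<noteq> j \<Longrightarrow> 2 * card {a \<in> I. g i a = g j a} \<le> card I"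
proof -
  have finF: "finite (I \<rightarrow>\<^sub>E V)" using assms by (intro finite_PiE) auto
  have "\<exists>g. (\<forall>j<Suc m. g j \<in> I \<rightarrow>\<^sub>E V) \<and>
      (\<forall>i<Suc m. \<forall>j<i. 2 * card {a \<in> I. g i a = g j a} \<le> card I)"
    using assms(3)
  proof (induction m)
    case 0
    then have "card (I \<rightarrow>\<^sub>E V) \<noteq> 0" using assms(1) by (simp add: card_PiE)
    then obtain h where "h \<in> I \<rightarrow>\<^sub>E V" by fastforce
    then show ?case by (intro exI[of _ "\<lambda>_. h"]) auto
  next
    case (Suc m)
    let ?r = "(2 * sqrt (card V)) ^ card I"
    have "real m * ?r \<le> real (Suc m) * ?r" by (intro mult_right_mono) auto
    then have "real m * ?r < real (card V) ^ card I" using Suc.prems by linarith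
    from Suc.IH[OF this] obtain g where g: "\<forall>j<Suc m. g j \<in> I \<rightarrow>\<^sub>E V"
      "\<forall>i<Suc m. \<forall>j<i. 2 * card {a \<in> I. g i a = g j a} \<le> card I" by blast
    let ?B = "\<lambda>j. {h \<in> I \<rightarrow>\<^sub>E V. card I < 2 * card {a \<in> I. h a = g j a}}"
    have "card (\<Union>j<Suc m. ?B j) \<le> (\<Sum>j<Suc m. card (?B j))"
      by (rule card_UN_le) simp
    then have "real (card (\<Union>j<Suc m. ?B j)) \<le> real (\<Sum>j<Suc m. card (?B j))"
      by (rule of_nat_mono)
    also have "\<dots> = (\<Sum>j<Suc m. real (card (?B j)))" by (rule of_nat_sum)
    also have "\<dots> \<le> (\<Sum>j<Suc m. ?r)"
    proof (rule sum_mono)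
      fix j assume "j \<in> {..<Suc m}"
      then have "g j \<in> I \<rightarrow>\<^sub>E V" using g(1) by blast
      then show "real (card (?B j)) \<le> ?r" by (rule card_agreeing_functions[OF assms(1,2)])
    qed
    also have "\<dots> = real (Suc m) * ?r" by simp
    also have "\<dots> < real (card (I \<rightarrow>\<^sub>E V))" using Suc.prems assms by (simp add: card_PiE)
    finally have "card (\<Union>j<Suc m. ?B j) < card (I \<rightarrow>\<^sub>E V)" by simp
    moreover have "finite (\<Union>j<Suc m. ?B j)" using finF by auto
    ultimately have "\<not> (I \<rightarrow>\<^sub>E V) \<subseteq> (\<Union>j<Suc m. ?B j)"
      using card_mono[of "\<Union>j<Suc m. ?B j" "I \<rightarrow>\<^sub>E V"] by linarith
    then obtain h where h: "h \<in> I \<rightarrow>\<^sub>E V" "h \<notin> (\<Union>j<Suc m. ?B j)" by blast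
    then have far: "2 * card {a \<in> I. h a = g j a} \<le> card I" if "j < Suc m" for j
      using that by (force simp: not_less)
    show ?case
    proof (rule exI[of _ "g(Suc m := h)"], intro conjI allI impI)
      fix j assume "j < Suc (Suc m)"
      then show "(g(Suc m := h)) j \<in> I \<rightarrow>\<^sub>E V" using g(1) h(1) by (auto simp: less_Suc_eq)
    next
      fix i j assume "i < Suc (Suc m)" "j < i"
      then show "2 * card {a \<in> I. (g(Suc m := h)) i a = (g(Suc m := h)) j a} \<le> card I"
        using g(2) far[of j] by (cases "i = Suc m") auto
    qed
  qed
  then obtain g where g: "\<And>j. j < Suc m \<Longrightarrow> g j \<in> I \<rightarrow>\<^sub>E V"
    "\<And>i j. i < Suc m \<Longrightarrow> j < i \<Longrightarrow> 2 * card {a \<in> I. g i a = g j a} \<le> card I" by blast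
  show ?thesis
  proof (rule that[of g])
    fix i j assume "i \<le> m" "j \<le> m" "i \<noteq> j"
    then show "2 * card {a \<in> I. g i a = g j a} \<le> card I"
      using g(2)[of i j] g(2)[of j i] by (cases "j < i") (auto simp: eq_commute[of "g i _"])
  qed (use g in auto)
qed

section \<open>Approximate equilibria\<close>

lemma finite_argmax:
  fixes f :: "'a \<Rightarrow> real"
  assumes "finite S" "S \<noteq> {}"
  obtains m where "m \<in> S" "\<And>x. x \<in> S \<Longrightarrow> f x \<le> f m"
proof -
  have "Max (f ` S) \<in> f ` S" using assms by simp
  then obtain m where "m \<in> S" "f m = Max (f ` S)" by (metis imageE)
  then show ?thesis using that assms by auto
qed

text \<open>The differences to \<open>i0\<close> may be negative, so the sum over S need not be
  below the sum over I. Passing first to a best strategy m makes all terms nonnegative, and only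
  then is S enlarged to I.\<close>

lemma regret_bound:
  fixes x \<rho> :: "'a \<Rightarrow> real"
  assumes "finite I" "S \<subseteq> I" "i0 \<in> I"
    and x: "\<And>i. i \<in> I \<Longrightarrow> x i \<ge> 0" "(\<Sum>i\<in>I. x i) = 1"
    and best: "\<And>i. i \<in> I \<Longrightarrow> \<rho> i - \<epsilon> \<le> (\<Sum>i\<in>I. x i * \<rho> i)"
  shows "(\<Sum>i\<in>S. x i * (\<rho> i0 - \<rho> i)) \<le> \<epsilon>"
proof -
  obtain m where m: "m \<in> I" "\<And>i. i \<in> I \<Longrightarrow> \<rho> i \<le> \<rho> m"
    using finite_argmax[of I \<rho>] assms by blast
  have "(\<Sum>i\<in>S. x i * (\<rho> i0 - \<rho> i)) \<le> (\<Sum>i\<in>S. x i * (\<rho> m - \<rho> i))"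
    using assms m by (intro sum_mono mult_left_mono) auto
  also have "\<dots> \<le> (\<Sum>i\<in>I. x i * (\<rho> m - \<rho> i))"
    using assms m by (intro sum_mono2) auto
  also have "\<dots> = \<rho> m - (\<Sum>i\<in>I. x i * \<rho> i)"
    using x(2) by (simp add: right_diff_distrib sum_subtractf flip: sum_distrib_right)
  also have "\<dots> \<le> \<epsilon>" using best[OF m(1)] by simp
  finally show ?thesis .
qed

lemma mult_le_abs:
  fixes s z :: real
  assumes "\<bar>s\<bar> \<le> 1"
  shows "z * s \<le> \<bar>z\<bar>"
proof -
  have "z * s \<le> \<bar>z\<bar> * \<bar>s\<bar>" by (metis abs_ge_self abs_mult)
  also have "\<dots> \<le> \<bar>z\<bar> * 1" using assms by (intro mult_left_mono) auto
  finally show ?thesis by simp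
qed

lemma of_bool_diff_bounds:
  assumes "0 \<le> t" "t \<le> 1"
  shows "-1 \<le> of_bool P - (t :: real)" "of_bool P - (t :: real) \<le> 1"
  using assms by auto

text \<open>X and then Y are replaced by the uniform distribution: X_a Y_b = (X_a - 1/k) Y_b + (Y_b
  - 1/k)/k + 1/k^2. As |s| \<le> 1, each replacement costs at most its l1 distance.\<close>

lemma near_uniform_bilinear_bound:
  fixes X Y :: "nat \<Rightarrow> real"
  assumes "k > 0"
    and s: "\<And>a b. \<bar>s a b\<bar> \<le> 1" "(\<Sum>a<k. \<Sum>b<k. s a b) \<le> r * (real k)\<^sup>2"
    and Y: "\<And>b. Y b \<ge> 0" "(\<Sum>b<k. Y b) \<le> 1"
  shows "(\<Sum>a<k. \<Sum>b<k. X a * Y b * s a b)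
    \<le> r + (\<Sum>a<k. \<bar>X a - 1 / k\<bar>) + (\<Sum>b<k. \<bar>Y b - 1 / k\<bar>)"
proof -
  have "(\<Sum>a<k. \<Sum>b<k. X a * Y b * s a b)
     \<le> (\<Sum>a<k. \<Sum>b<k. \<bar>X a - 1 / k\<bar> * Y b + 1 / k * \<bar>Y b - 1 / k\<bar> + s a b / (real k)\<^sup>2)"
  proof (intro sum_mono)
    fix a b
    have "(X a - 1 / k) * s a b \<le> \<bar>X a - 1 / k\<bar>"
      using s(1) by (rule mult_le_abs)
    then have "(X a - 1 / k) * s a b * Y b \<le> \<bar>X a - 1 / k\<bar> * Y b"
      using Y(1)[of b] by (simp add: mult_right_mono)
    moreover have "(Y b - 1 / k) * s a b \<le> \<bar>Y b - 1 / k\<bar>"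
      using s(1) by (rule mult_le_abs)
    then have "1 / k * ((Y b - 1 / k) * s a b) \<le> 1 / k * \<bar>Y b - 1 / k\<bar>"
      by (intro mult_left_mono) auto
    moreover have "X a * Y b * s a b
        = (X a - 1 / k) * s a b * Y b + 1 / k * ((Y b - 1 / k) * s a b) + s a b / (real k)\<^sup>2"
      using assms(1) by (simp add: field_simps power2_eq_square)
    ultimately show "X a * Y b * s a b
        \<le> \<bar>X a - 1 / k\<bar> * Y b + 1 / k * \<bar>Y b - 1 / k\<bar> + s a b / (real k)\<^sup>2" by linarith
  qed
  also have "\<dots> = (\<Sum>a<k. \<bar>X a - 1 / k\<bar>) * (\<Sum>b<k. Y b) + (\<Sum>b<k. \<bar>Y b - 1 / k\<bar>)
      + (\<Sum>a<k. \<Sum>b<k. s a b) / (real k)\<^sup>2"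
    using assms(1)
    by (simp add: sum.distrib sum_product flip: sum_divide_distrib)
  also have "\<dots> \<le> (\<Sum>a<k. \<bar>X a - 1 / k\<bar>) * 1 + (\<Sum>b<k. \<bar>Y b - 1 / k\<bar>) + r"
    using assms by (intro add_mono mult_left_mono) (auto simp: divide_le_eq sum_nonneg)
  finally show ?thesis by simp
qed

(* Strategies are indexed by i < n. Those with own i are pairs (blk i, lbl i): a question together
   with an answer. The others are triples (blk i, lbl i, tst i); repetitions pad their number. *)
locale labelled_strategies =
  fixes n k K :: nat and own :: "nat \<Rightarrow> bool" and blk :: "nat \<Rightarrow> nat"
    and lbl tst :: "nat \<Rightarrow> nat set" and p :: "nat \<Rightarrow> nat set"
  assumes k_pos: "0 < k"
    and blk_less: "\<And>i. i < n \<Longrightarrow> blk i < k"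
    and lbl_sub: "\<And>i. i < n \<Longrightarrow> lbl i \<subseteq> {..<K}"
    and tst_sub: "\<And>i. i < n \<Longrightarrow> tst i \<subseteq> {..<k}"
    and own_inj: "\<And>i j. i < n \<Longrightarrow> j < n \<Longrightarrow> own i \<Longrightarrow> own j \<Longrightarrow> blk i = blk j \<Longrightarrow> lbl i = lbl j
        \<Longrightarrow> i = j"
    and own_surj: "\<And>a U. a < k \<Longrightarrow> U \<subseteq> {..<K} \<Longrightarrow> \<exists>i<n. own i \<and> blk i = a \<and> lbl i = U"
    and dev_surj: "\<And>a U T. a < k \<Longrightarrow> U \<subseteq> {..<K} \<Longrightarrow> T \<subseteq> {..<k}
        \<Longrightarrow> \<exists>i<n. \<not> own i \<and> blk i = a \<and> lbl i = U \<and> tst i = T"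
begin

section \<open>The two blocks and their payoffs\<close>

definition Own :: "nat set" where "Own = {i. i < n \<and> own i}"
definition Dev :: "nat set" where "Dev = {i. i < n \<and> \<not> own i}"

text \<open>The score of i under the test T, centred so that uniform play on the graph of g scores 0
  under every test, and the empty test gives 0 to everyone.\<close>

definition code_pay :: "(nat \<Rightarrow> nat set) \<Rightarrow> nat \<Rightarrow> nat set \<Rightarrow> real" where
  "code_pay g i T = of_bool (blk i \<in> T \<and> lbl i = g (blk i)) - card T / k"

definition dev_pay :: "(nat \<Rightarrow> nat set) \<Rightarrow> nat \<Rightarrow> nat \<Rightarrow> real" where
  "dev_pay g i j = (code_pay g i (tst j) - code_pay g j (tst i)) / 4"

text \<open>Meeting a second-block opponent from the first block costs -1, whereas
  \<open>dev_pay\<close> never falls below -1/2; so one player's mass in the first block and the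
  other's mass in the second cannot both be large. The test term rewards finding a set of questions
  that the opponent plays too often.\<close>

definition pay :: "(nat \<Rightarrow> nat set) \<Rightarrow> (nat \<Rightarrow> nat \<Rightarrow> real) \<Rightarrow> nat \<Rightarrow> nat \<Rightarrow> real" where
  "pay g c i j =
     (if own i then
        if own j then c (blk i) (blk j) * chi (p (blk j)) (lbl i) * chi (p (blk i)) (lbl j) / 2
        else -1
      else
        if own j then 1/2 + (of_bool (blk j \<in> tst i) - card (tst i) / k) / 2
        else dev_pay g i j)"

definition best_reply ::
    "(nat \<Rightarrow> nat set) \<Rightarrow> (nat \<Rightarrow> nat \<Rightarrow> real) \<Rightarrow> (nat \<Rightarrow> real) \<Rightarrow> (nat \<Rightarrow> real) \<Rightarrow> real \<Rightarrow> bool" where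
  "best_reply g c x y \<epsilon> \<longleftrightarrow>
     (\<forall>i<n. (\<Sum>j<n. pay g c i j * y j) - \<epsilon> \<le> (\<Sum>i<n. x i * (\<Sum>j<n. pay g c i j * y j)))"

definition mixed :: "(nat \<Rightarrow> real) \<Rightarrow> bool" where
  "mixed x \<longleftrightarrow> (\<forall>i<n. x i \<ge> 0) \<and> (\<Sum>i<n. x i) = 1"

definition own_mass :: "(nat \<Rightarrow> real) \<Rightarrow> real" where
  "own_mass x = (\<Sum>i\<in>Own. x i)"

lemma finite_Own [simp]: "finite Own" and finite_Dev [simp]: "finite Dev"
  by (auto simp: Own_def Dev_def)

lemma sum_split: "(\<Sum>i<n. f i) = (\<Sum>i\<in>Own. f i) + (\<Sum>i\<in>Dev. f i :: real)"
  by (subst sum.union_disjoint[symmetric]) (auto simp: Own_def Dev_def intro!: sum.cong)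

lemma OwnD: "i \<in> Own \<Longrightarrow> i < n" "i \<in> Own \<Longrightarrow> own i"
  and DevD: "i \<in> Dev \<Longrightarrow> i < n" "i \<in> Dev \<Longrightarrow> \<not> own i"
  by (auto simp: Own_def Dev_def)

lemma mixedD: "mixed x \<Longrightarrow> i < n \<Longrightarrow> x i \<ge> 0"
  by (simp add: mixed_def)

lemma own_mass_nonneg: "mixed x \<Longrightarrow> own_mass x \<ge> 0"
  unfolding own_mass_def by (intro sum_nonneg) (auto dest: mixedD OwnD)

lemma dev_mass: "mixed x \<Longrightarrow> (\<Sum>i\<in>Dev. x i) = 1 - own_mass x"
  unfolding own_mass_def mixed_def by (simp add: sum_split)

lemma own_mass_le_1: "mixed x \<Longrightarrow> own_mass x \<le> 1"
  using dev_mass[of x] sum_nonneg[of Dev x] by (auto dest: mixedD DevD)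

lemma card_test_frac:
  assumes "T \<subseteq> {..<k}"
  shows "0 \<le> card T / k" "card T / k \<le> 1"
  using card_mono[OF _ assms] k_pos by auto

lemma code_pay_bounds:
  assumes "T \<subseteq> {..<k}"
  shows "-1 \<le> code_pay g i T" "code_pay g i T \<le> 1"
  unfolding code_pay_def by (intro of_bool_diff_bounds card_test_frac[OF assms])+

lemma dev_pay_bounds:
  assumes "i < n" "j < n"
  shows "-1/2 \<le> dev_pay g i j" "dev_pay g i j \<le> 1/2"
  using code_pay_bounds[OF tst_sub[OF assms(1)], of g j] code_pay_bounds[OF tst_sub[OF assms(2)], of g i]
  by (auto simp: dev_pay_def)

lemma test_pay_bounds:
  assumes "i < n"
  shows "0 \<le> 1/2 + (of_bool (blk j \<in> tst i) - card (tst i) / k) / 2"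
    "1/2 + (of_bool (blk j \<in> tst i) - card (tst i) / k) / 2 \<le> 1"
proof -
  note * = of_bool_diff_bounds[OF card_test_frac[OF tst_sub[OF assms]], of "blk j \<in> tst i"]
  from *(1) show "0 \<le> 1/2 + (of_bool (blk j \<in> tst i) - card (tst i) / k) / 2" by argo
  from *(2) show "1/2 + (of_bool (blk j \<in> tst i) - card (tst i) / k) / 2 \<le> 1" by argo
qed

lemma pay_own_le:
  assumes "\<And>a b. \<bar>c a b\<bar> \<le> 1"
  shows "\<bar>c a b * chi A U * chi B V / 2\<bar> \<le> 1/2"
  using assms[of a b] by (simp add: abs_mult)

lemma pay_bounds:
  assumes "i < n" "j < n" "\<And>a b. \<bar>c a b\<bar> \<le> 1"
  shows "\<bar>pay g c i j\<bar> \<le> 1"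
proof -
  have "\<bar>c (blk i) (blk j) * chi (p (blk j)) (lbl i) * chi (p (blk i)) (lbl j) / 2\<bar> \<le> 1/2"
    using assms(3) by (rule pay_own_le)
  moreover have "\<bar>dev_pay g i j\<bar> \<le> 1/2" using dev_pay_bounds[OF assms(1,2), of g] by auto
  moreover have "\<bar>1/2 + (of_bool (blk j \<in> tst i) - card (tst i) / k) / 2\<bar> \<le> 1"
    using test_pay_bounds[OF assms(1), of j] by linarith
  moreover have "\<bar>if P then if Q then A else -1 else if Q then B else C\<bar> \<le> 1"
    if "\<bar>A\<bar> \<le> 1/2" "\<bar>C\<bar> \<le> 1/2" "\<bar>B\<bar> \<le> 1" for P Q and A B C :: real
    using that by auto
  ultimately show ?thesis unfolding pay_def by blast
qed

text \<open>The comparison is with a second-block strategy testing T. Against the first block of y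
  it earns 1/2 plus half the surplus of T, against the second at least -1/2; a first-block strategy
  earns at most 1/2 and exactly -1. The bracket is thus at most twice the regret of every
  first-block strategy. For empty T only the mass of y in the second block remains.\<close>

lemma own_regret:
  assumes "mixed x" "mixed y" "best_reply g c x y \<epsilon>" "\<And>a b. \<bar>c a b\<bar> \<le> 1" "T \<subseteq> {..<k}"
  shows "own_mass x * ((1 - own_mass y)
      + ((\<Sum>j\<in>Own. y j * of_bool (blk j \<in> T)) - own_mass y * (card T / k))) \<le> 2 * \<epsilon>"
proof -
  define \<rho> where "\<rho> i = (\<Sum>j<n. pay g c i j * y j)" for i
  define Y where "Y = (\<Sum>j\<in>Own. y j * of_bool (blk j \<in> T))"
  have "\<exists>i0<n. \<not> own i0 \<and> tst i0 = T"
    using dev_surj[of 0 "{}" T] k_pos assms(5) by blast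
  then obtain i0 where i0: "i0 < n" "\<not> own i0" "tst i0 = T" by blast
  have upper: "\<rho> i \<le> own_mass y / 2 - (1 - own_mass y)" if i: "i \<in> Own" for i
  proof -
    have "(\<Sum>j\<in>Own. pay g c i j * y j) \<le> (\<Sum>j\<in>Own. 1/2 * y j)"
    proof (intro sum_mono mult_right_mono)
      fix j assume "j \<in> Own"
      then have "pay g c i j = c (blk i) (blk j) * chi (p (blk j)) (lbl i) * chi (p (blk i)) (lbl j) / 2"
        using i by (simp add: pay_def OwnD)
      then show "pay g c i j \<le> 1/2"
        using pay_own_le[where c = c, OF assms(4)] by (metis abs_le_iff)
    qed (use assms in \<open>auto dest: mixedD OwnD\<close>)
    moreover have "(\<Sum>j\<in>Dev. pay g c i j * y j) = (\<Sum>j\<in>Dev. - y j)"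
      using i by (intro sum.cong) (auto simp: pay_def OwnD DevD)
    ultimately show ?thesis
      unfolding \<rho>_def sum_split using dev_mass[OF assms(2)]
      by (simp add: own_mass_def sum_negf flip: sum_distrib_left sum_divide_distrib)
  qed
  have lower: "\<rho> i0 \<ge> own_mass y / 2 + (Y - own_mass y * (card T / k)) / 2 - (1 - own_mass y) / 2"
  proof -
    have "(\<Sum>j\<in>Own. pay g c i0 j * y j)
        = (\<Sum>j\<in>Own. y j / 2 + (y j * of_bool (blk j \<in> T) - y j * (card T / k)) / 2)"
      using i0 by (intro sum.cong refl) (auto simp: pay_def OwnD field_simps)
    also have "\<dots> = own_mass y / 2 + (Y - own_mass y * (card T / k)) / 2"
      unfolding Y_def own_mass_def
      by (simp only: sum.distrib sum_subtractf sum_distrib_right flip: sum_divide_distrib)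
    finally have own_part: "(\<Sum>j\<in>Own. pay g c i0 j * y j)
        = own_mass y / 2 + (Y - own_mass y * (card T / k)) / 2" .
    have "(\<Sum>j\<in>Dev. -1/2 * y j) \<le> (\<Sum>j\<in>Dev. pay g c i0 j * y j)"
    proof (intro sum_mono mult_right_mono)
      fix j assume "j \<in> Dev"
      then show "-1/2 \<le> pay g c i0 j"
        using i0 dev_pay_bounds[of i0 j g] by (simp add: pay_def DevD)
    qed (use assms in \<open>auto dest: mixedD DevD\<close>)
    moreover have "(\<Sum>j\<in>Dev. -1/2 * y j) = -1/2 * (1 - own_mass y)"
      unfolding dev_mass[OF assms(2), symmetric] by (rule sum_distrib_left[symmetric])
    ultimately show ?thesis unfolding \<rho>_def sum_split own_part by linarith
  qed
  have "(\<Sum>i\<in>Own. x i * (((1 - own_mass y) + (Y - own_mass y * (card T / k))) / 2))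
      \<le> (\<Sum>i\<in>Own. x i * (\<rho> i0 - \<rho> i))"
  proof (intro sum_mono mult_left_mono)
    fix i assume "i \<in> Own"
    from upper[OF this] lower
    show "((1 - own_mass y) + (Y - own_mass y * (card T / k))) / 2 \<le> \<rho> i0 - \<rho> i" by argo
  qed (use assms in \<open>auto dest: mixedD OwnD\<close>)
  also have "\<dots> \<le> \<epsilon>"
    using assms(1,3) i0(1)
    by (intro regret_bound[of "{..<n}"]) (auto simp: mixed_def best_reply_def \<rho>_def Own_def)
  finally have "own_mass x * (((1 - own_mass y) + (Y - own_mass y * (card T / k))) / 2) \<le> \<epsilon>"
    by (simp only: own_mass_def[of x] sum_distrib_right[symmetric])
  then show ?thesis unfolding Y_def by simp
qed

section \<open>Question marginals in the first block\<close>

definition block_mass :: "(nat \<Rightarrow> real) \<Rightarrow> nat \<Rightarrow> real" where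
  "block_mass x a = (\<Sum>i | i \<in> Own \<and> blk i = a. x i)"

lemma sum_blocks: "(\<Sum>i\<in>Own. x i * h (blk i)) = (\<Sum>a<k. block_mass x a * h a)"
proof -
  have "(\<Sum>i\<in>Own. x i * h (blk i)) = (\<Sum>a<k. \<Sum>i | i \<in> Own \<and> blk i = a. x i * h (blk i))"
    using blk_less by (intro sum.group[symmetric]) (auto simp: Own_def)
  also have "\<dots> = (\<Sum>a<k. block_mass x a * h a)"
    by (intro sum.cong refl) (simp add: block_mass_def sum_distrib_right)
  finally show ?thesis .
qed

lemma block_mass_nonneg: "mixed x \<Longrightarrow> block_mass x a \<ge> 0"
  unfolding block_mass_def by (intro sum_nonneg) (auto dest: mixedD OwnD)

lemma sum_block_mass: "(\<Sum>a<k. block_mass x a) = own_mass x"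
  using sum_blocks[of x "\<lambda>_. 1"] by (simp add: own_mass_def)

text \<open>One test controls the l1 distance: for T the set of questions played at least uniformly,
  the distance is twice the surplus on T minus the sum of all differences, and that sum is
  \<open>own_mass y - 1\<close>.\<close>

lemma block_mass_deviation:
  assumes "\<And>T. T \<subseteq> {..<k} \<Longrightarrow>
      (\<Sum>j\<in>Own. y j * of_bool (blk j \<in> T)) - own_mass y * (card T / k) \<le> \<delta>"
    and "own_mass y \<le> 1"
  shows "(\<Sum>a<k. \<bar>block_mass y a - 1 / k\<bar>) \<le> 2 * \<delta> + (1 - own_mass y)"
proof -
  define T where "T = {a. a < k \<and> block_mass y a \<ge> 1 / k}"
  have T: "T \<subseteq> {..<k}" by (auto simp: T_def)
  have "(\<Sum>a<k. \<bar>block_mass y a - 1 / k\<bar>)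
      = (\<Sum>a<k. 2 * (block_mass y a * of_bool (a \<in> T)) - 2 * (1 / k) * of_bool (a \<in> T) - (block_mass y a - 1 / k))"
    by (intro sum.cong refl) (auto simp: T_def)
  also have "\<dots> = 2 * (\<Sum>a<k. block_mass y a * of_bool (a \<in> T)) - 2 * (1 / k) * (\<Sum>a<k. of_bool (a \<in> T))
      - (own_mass y - 1)"
    using k_pos by (simp only: sum_subtractf sum_block_mass flip: sum_distrib_left) simp
  also have "(\<Sum>a<k. of_bool (a \<in> T)) = real (card T)"
    using T by (simp add: Int_absorb1)
  also have "(\<Sum>a<k. block_mass y a * of_bool (a \<in> T)) = (\<Sum>j\<in>Own. y j * of_bool (blk j \<in> T))"
    by (rule sum_blocks[symmetric])
  also have "2 * \<dots> - 2 * (1 / k) * real (card T) - (own_mass y - 1)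
      \<le> 2 * ((\<Sum>j\<in>Own. y j * of_bool (blk j \<in> T)) - own_mass y * (card T / k)) + (1 - own_mass y)"
  proof -
    have "own_mass y * (card T / k) \<le> 1 * (card T / k)"
      using assms(2) card_test_frac(1)[OF T] by (rule mult_right_mono)
    moreover have "2 * (1 / k) * real (card T) = 2 * (card T / k)" by simp
    ultimately show ?thesis by argo
  qed
  also have "\<dots> \<le> 2 * \<delta> + (1 - own_mass y)"
    using assms(1)[OF T] by (intro add_right_mono mult_left_mono) auto
  finally show ?thesis .
qed

text \<open>Randomized answers do not help. The value is linear in the answer distribution of each
  question, so the answers of x, and then those of y, can be replaced by best ones; only the
  question marginals survive.\<close>

lemma own_value_le:
  assumes "mixed x" "mixed y"
  shows "\<exists>U V. (\<forall>a. U a \<subseteq> {..<K}) \<and> (\<forall>b. V b \<subseteq> {..<K}) \<and>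
    (\<Sum>i\<in>Own. x i * (\<Sum>j\<in>Own. y j * (c (blk i) (blk j) * chi (p (blk j)) (lbl i) * chi (p (blk i)) (lbl j))))
      \<le> (\<Sum>a<k. \<Sum>b<k. block_mass x a * block_mass y b * (c a b * chi (p b) (U a) * chi (p a) (V b)))"
proof -
  define \<Phi> where
    "\<Phi> a W = (\<Sum>j\<in>Own. y j * (c a (blk j) * chi (p (blk j)) W * chi (p a) (lbl j)))" for a W
  have "\<exists>U. U \<subseteq> {..<K} \<and> (\<forall>W\<subseteq>{..<K}. \<Phi> a W \<le> \<Phi> a U)" for a
    by (rule finite_argmax[of "Pow {..<K}" "\<Phi> a"]) auto
  then obtain U where U: "\<And>a. U a \<subseteq> {..<K}" "\<And>a W. W \<subseteq> {..<K} \<Longrightarrow> \<Phi> a W \<le> \<Phi> a (U a)"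
    by metis
  define \<Psi> where "\<Psi> b W = (\<Sum>a<k. block_mass x a * (c a b * chi (p b) (U a) * chi (p a) W))" for b W
  have "\<exists>V. V \<subseteq> {..<K} \<and> (\<forall>W\<subseteq>{..<K}. \<Psi> b W \<le> \<Psi> b V)" for b
    by (rule finite_argmax[of "Pow {..<K}" "\<Psi> b"]) auto
  then obtain V where V: "\<And>b. V b \<subseteq> {..<K}" "\<And>b W. W \<subseteq> {..<K} \<Longrightarrow> \<Psi> b W \<le> \<Psi> b (V b)"
    by metis
  have "(\<Sum>i\<in>Own. x i * \<Phi> (blk i) (lbl i)) \<le> (\<Sum>i\<in>Own. x i * \<Phi> (blk i) (U (blk i)))"
    using assms(1) lbl_sub U(2) by (intro sum_mono mult_left_mono) (auto dest: mixedD OwnD)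
  also have "\<dots> = (\<Sum>a<k. block_mass x a * \<Phi> a (U a))"
    by (rule sum_blocks)
  also have "\<dots> = (\<Sum>a<k. \<Sum>j\<in>Own. y j * (block_mass x a * (c a (blk j) * chi (p (blk j)) (U a) * chi (p a) (lbl j))))"
    unfolding \<Phi>_def sum_distrib_left by (intro sum.cong refl) (simp add: mult_ac)
  also have "\<dots> = (\<Sum>j\<in>Own. y j * \<Psi> (blk j) (lbl j))"
    unfolding \<Psi>_def sum_distrib_left by (rule sum.swap)
  also have "\<dots> \<le> (\<Sum>j\<in>Own. y j * \<Psi> (blk j) (V (blk j)))"
    using assms(2) lbl_sub V(2) by (intro sum_mono mult_left_mono) (auto dest: mixedD OwnD)
  also have "\<dots> = (\<Sum>b<k. block_mass y b * \<Psi> b (V b))"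
    by (rule sum_blocks)
  also have "\<dots> = (\<Sum>b<k. \<Sum>a<k. block_mass x a * block_mass y b * (c a b * chi (p b) (U a) * chi (p a) (V b)))"
    unfolding \<Psi>_def sum_distrib_left by (intro sum.cong refl) (simp add: mult_ac)
  also have "\<dots> = (\<Sum>a<k. \<Sum>b<k. block_mass x a * block_mass y b * (c a b * chi (p b) (U a) * chi (p a) (V b)))"
    by (rule sum.swap)
  finally show ?thesis
    using U(1) V(1) unfolding \<Phi>_def by (intro exI[of _ U] exI[of _ V] conjI allI)
qed

text \<open>If x had half of its mass in the first block, \<open>own_regret\<close> would force both
  players almost entirely into that block with near-uniform questions. Then \<open>gap\<close> caps
  what the first block earns near 7/16, while the deviation with the empty test earns almost 1/2.
  Once \<open>own_mass x\<close> is below 1/2, the bounds on the two mixed products make first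
  \<open>own_mass y\<close> and then \<open>own_mass x\<close> small.\<close>

lemma own_mass_small:
  assumes x: "mixed x" and y: "mixed y"
    and reply: "best_reply g c x y \<epsilon>" "best_reply g (\<lambda>a b. c b a) y x \<epsilon>"
    and \<epsilon>: "0 \<le> \<epsilon>" "\<epsilon> \<le> 1/1000"
    and c: "\<And>a b. \<bar>c a b\<bar> \<le> 1"
    and gap: "\<And>U V. (\<And>a. U a \<subseteq> {..<K}) \<Longrightarrow> (\<And>b. V b \<subseteq> {..<K}) \<Longrightarrow>
      (\<Sum>a<k. \<Sum>b<k. c a b * chi (p b) (U a) * chi (p a) (V b)) \<le> 7/8 * (real k)\<^sup>2"
  shows "own_mass x \<le> 4 * \<epsilon>" "own_mass y \<le> 4 * \<epsilon>"
proof -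
  let ?\<alpha> = "own_mass x" and ?\<beta> = "own_mass y"
  note regret_x = own_regret[OF x y reply(1) c] and regret_y = own_regret[OF y x reply(2) c]
  have a: "?\<alpha> * (1 - ?\<beta>) \<le> 2 * \<epsilon>" using regret_x[of "{}"] by simp
  have b: "?\<beta> * (1 - ?\<alpha>) \<le> 2 * \<epsilon>" using regret_y[of "{}"] by simp
  have half: "s \<le> 4 * \<epsilon>" if "(1/2::real) \<le> r" "r * s \<le> 2 * \<epsilon>" for r s
    using that \<epsilon> mult_right_mono[of "1/2" r s] by (cases "s \<ge> 0") auto
  have "\<not> ?\<alpha> \<ge> 1/2"
  proof
    assume \<alpha>: "?\<alpha> \<ge> 1/2"
    then have \<beta>1: "1 - ?\<beta> \<le> 4 * \<epsilon>" using half a by blast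
    then have \<beta>: "?\<beta> \<ge> 1/2" using \<epsilon> by linarith
    then have \<alpha>1: "1 - ?\<alpha> \<le> 4 * \<epsilon>" using half b by blast
    have "(\<Sum>j\<in>Own. y j * of_bool (blk j \<in> T)) - ?\<beta> * (card T / k) \<le> 4 * \<epsilon>" if "T \<subseteq> {..<k}" for T
      using half[OF \<alpha> regret_x[OF that]] own_mass_le_1[OF y] by linarith
    \<comment> \<open>12 \<epsilon> is twice the surplus bound 4 \<epsilon> plus 4 \<epsilon> for
      the mass missing from the first block.\<close>
    from block_mass_deviation[OF this own_mass_le_1[OF y]]
    have dev_y: "(\<Sum>b<k. \<bar>block_mass y b - 1 / k\<bar>) \<le> 12 * \<epsilon>" using \<beta>1 by simp
    have "(\<Sum>i\<in>Own. x i * of_bool (blk i \<in> T)) - ?\<alpha> * (card T / k) \<le> 4 * \<epsilon>" if "T \<subseteq> {..<k}" for T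
      using half[OF \<beta> regret_y[OF that]] own_mass_le_1[OF x] by linarith
    from block_mass_deviation[OF this own_mass_le_1[OF x]]
    have dev_x: "(\<Sum>a<k. \<bar>block_mass x a - 1 / k\<bar>) \<le> 12 * \<epsilon>" using \<alpha>1 by simp
    define W where "W = (\<Sum>i\<in>Own. x i * (\<Sum>j\<in>Own. y j *
        (c (blk i) (blk j) * chi (p (blk j)) (lbl i) * chi (p (blk i)) (lbl j))))"
    from own_value_le[OF x y, of c] obtain U V where UV: "\<And>a. U a \<subseteq> {..<K}" "\<And>b. V b \<subseteq> {..<K}"
      and W: "W \<le> (\<Sum>a<k. \<Sum>b<k. block_mass x a * block_mass y b * (c a b * chi (p b) (U a) * chi (p a) (V b)))"
      unfolding W_def by blast
    have "(\<Sum>a<k. \<Sum>b<k. block_mass x a * block_mass y b * (c a b * chi (p b) (U a) * chi (p a) (V b)))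
        \<le> 7/8 + (\<Sum>a<k. \<bar>block_mass x a - 1 / k\<bar>) + (\<Sum>b<k. \<bar>block_mass y b - 1 / k\<bar>)"
      using k_pos gap[OF UV] block_mass_nonneg[OF y] own_mass_le_1[OF y] c
      by (intro near_uniform_bilinear_bound) (auto simp: abs_mult sum_block_mass)
    with W dev_x dev_y have W': "W \<le> 7/8 + 24 * \<epsilon>" by linarith
    define \<rho> where "\<rho> i = (\<Sum>j<n. pay g c i j * y j)" for i
    obtain i0 where i0: "i0 < n" "\<not> own i0" "tst i0 = {}"
      using dev_surj[of 0 "{}" "{}"] k_pos by blast
    have "\<rho> i0 \<ge> ?\<beta> / 2 - (1 - ?\<beta>) / 2"
    proof -
      have "(\<Sum>j\<in>Own. pay g c i0 j * y j) = ?\<beta> / 2"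
        using i0 by (simp add: own_mass_def pay_def OwnD sum_divide_distrib)
      moreover have "(\<Sum>j\<in>Dev. -1/2 * y j) \<le> (\<Sum>j\<in>Dev. pay g c i0 j * y j)"
      proof (intro sum_mono mult_right_mono)
        fix j assume "j \<in> Dev"
        then show "-1/2 \<le> pay g c i0 j"
          using i0 dev_pay_bounds[of i0 j g] by (simp add: pay_def DevD)
      qed (use y in \<open>auto dest: mixedD DevD\<close>)
      moreover have "(\<Sum>j\<in>Dev. -1/2 * y j) = -1/2 * (1 - own_mass y)"
        unfolding dev_mass[OF y, symmetric] by (rule sum_distrib_left[symmetric])
      ultimately show ?thesis unfolding \<rho>_def sum_split by linarith
    qed
    then have i0_pay: "\<rho> i0 \<ge> 1/2 - 4 * \<epsilon>" using \<beta>1 by argo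
    have own_pay: "(\<Sum>i\<in>Own. x i * \<rho> i) \<le> W / 2"
    proof -
      have "\<rho> i \<le> (\<Sum>j\<in>Own. y j *
          (c (blk i) (blk j) * chi (p (blk j)) (lbl i) * chi (p (blk i)) (lbl j))) / 2" if "i \<in> Own" for i
      proof -
        have "(\<Sum>j\<in>Dev. pay g c i j * y j) \<le> 0"
          using that y by (intro sum_nonpos) (auto simp: pay_def OwnD DevD intro: mixedD)
        moreover have "(\<Sum>j\<in>Own. pay g c i j * y j) = (\<Sum>j\<in>Own. y j *
          (c (blk i) (blk j) * chi (p (blk j)) (lbl i) * chi (p (blk i)) (lbl j))) / 2"
          unfolding sum_divide_distrib using that
          by (intro sum.cong refl) (auto simp: pay_def OwnD)
        ultimately show ?thesis unfolding \<rho>_def sum_split by linarith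
      qed
      then have "(\<Sum>i\<in>Own. x i * \<rho> i) \<le> (\<Sum>i\<in>Own. x i * ((\<Sum>j\<in>Own. y j *
          (c (blk i) (blk j) * chi (p (blk j)) (lbl i) * chi (p (blk i)) (lbl j))) / 2))"
        using x by (intro sum_mono mult_left_mono) (auto dest: mixedD OwnD)
      then show ?thesis by (simp add: W_def flip: sum_divide_distrib)
    qed
    have "(\<Sum>i\<in>Own. x i * (\<rho> i0 - \<rho> i)) \<le> \<epsilon>"
      using x reply(1) i0(1)
      by (intro regret_bound[of "{..<n}"]) (auto simp: mixed_def best_reply_def \<rho>_def Own_def)
    then have "?\<alpha> * \<rho> i0 \<le> \<epsilon> + (\<Sum>i\<in>Own. x i * \<rho> i)"
      by (simp add: right_diff_distrib sum_subtractf own_mass_def sum_distrib_right)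
    then have "?\<alpha> * \<rho> i0 \<le> 7/16 + 13 * \<epsilon>" using own_pay W' by argo
    moreover have "(1 - 4 * \<epsilon>) * (1/2 - 4 * \<epsilon>) \<le> ?\<alpha> * \<rho> i0"
      using \<alpha>1 i0_pay \<epsilon> by (intro mult_mono) auto
    moreover have "(1 - 4 * \<epsilon>) * (1/2 - 4 * \<epsilon>) = 1/2 - 6 * \<epsilon> + 16 * (\<epsilon> * \<epsilon>)"
      by (simp add: field_simps)
    moreover have "\<epsilon> * \<epsilon> \<ge> 0" by simp
    \<comment> \<open>Together 1/2 - 6 \<epsilon> \<le> 7/16 + 13 \<epsilon>, which would need
      \<epsilon> \<ge> 1/304.\<close>
    ultimately show False using \<epsilon> by linarith
  qed
  then show \<beta>: "?\<beta> \<le> 4 * \<epsilon>" using half[of "1 - ?\<alpha>" ?\<beta>] b by (simp add: mult.commute)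
  then show "?\<alpha> \<le> 4 * \<epsilon>" using half[of "1 - ?\<beta>" ?\<alpha>] a \<epsilon> by (simp add: mult.commute)
qed

section \<open>The zero-sum game of the second block\<close>

definition dev_value :: "(nat \<Rightarrow> nat set) \<Rightarrow> (nat \<Rightarrow> real) \<Rightarrow> (nat \<Rightarrow> real) \<Rightarrow> real" where
  "dev_value g x y = (\<Sum>i\<in>Dev. \<Sum>j\<in>Dev. x i * dev_pay g i j * y j)"

lemma dev_value_antisym: "dev_value g y x = - dev_value g x y"
proof -
  have "dev_value g y x = (\<Sum>i\<in>Dev. \<Sum>j\<in>Dev. y j * dev_pay g j i * x i)"
    unfolding dev_value_def by (rule sum.swap)
  also have "\<dots> = - dev_value g x y"
    unfolding dev_value_def sum_negf[symmetric]
    by (intro sum.cong refl) (simp add: dev_pay_def field_simps)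
  finally show ?thesis .
qed

lemma value_le_dev_value:
  assumes "mixed x" "mixed y" "\<And>a b. \<bar>c a b\<bar> \<le> 1"
  shows "(\<Sum>i<n. x i * (\<Sum>j<n. pay g c i j * y j)) \<le> dev_value g x y + own_mass x + own_mass y"
proof -
  have *: "x i * (pay g c i j * y j) \<le> x i * y j" if "i < n" "j < n" for i j
  proof -
    have "pay g c i j \<le> 1" using pay_bounds[where c = c and g = g, OF that assms(3)] by linarith
    then have "pay g c i j * y j \<le> 1 * y j" using assms that by (intro mult_right_mono mixedD)
    then show ?thesis using mixedD[OF assms(1) that(1)] by (simp add: mult_left_mono)
  qed
  have "(\<Sum>i<n. x i * (\<Sum>j<n. pay g c i j * y j)) = (\<Sum>i<n. \<Sum>j<n. x i * (pay g c i j * y j))"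
    by (simp only: sum_distrib_left)
  also have "\<dots> = (\<Sum>i\<in>Own. \<Sum>j<n. x i * (pay g c i j * y j)) + ((\<Sum>i\<in>Dev. \<Sum>j\<in>Own. x i * (pay g c i j * y j))
        + (\<Sum>i\<in>Dev. \<Sum>j\<in>Dev. x i * (pay g c i j * y j)))"
    unfolding sum_split[of "\<lambda>i. \<Sum>j<n. x i * (pay g c i j * y j)"] sum.distrib[symmetric]
    by (intro arg_cong2[of _ _ _ _ "(+)"] sum.cong refl sum_split)
  also have "\<dots> \<le> own_mass x + (own_mass y + dev_value g x y)"
  proof (intro add_mono)
    have "(\<Sum>i\<in>Own. \<Sum>j<n. x i * (pay g c i j * y j)) \<le> (\<Sum>i\<in>Own. \<Sum>j<n. x i * y j)"
      using * by (intro sum_mono) (auto dest: OwnD)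
    also have "\<dots> = own_mass x"
      using assms(2) by (simp add: mixed_def own_mass_def flip: sum_distrib_left)
    finally show "(\<Sum>i\<in>Own. \<Sum>j<n. x i * (pay g c i j * y j)) \<le> own_mass x" .
  next
    have "(\<Sum>i\<in>Dev. \<Sum>j\<in>Own. x i * (pay g c i j * y j)) \<le> (\<Sum>i\<in>Dev. \<Sum>j\<in>Own. x i * y j)"
      using * by (intro sum_mono) (auto dest: OwnD DevD)
    also have "\<dots> = (1 - own_mass x) * own_mass y"
      by (simp only: dev_mass[OF assms(1), symmetric] own_mass_def[of y] sum_product)
    also have "\<dots> \<le> own_mass y"
      using own_mass_nonneg[OF assms(1)] own_mass_nonneg[OF assms(2)]
      by (simp add: left_diff_distrib)
    finally show "(\<Sum>i\<in>Dev. \<Sum>j\<in>Own. x i * (pay g c i j * y j)) \<le> own_mass y" .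
  next
    show "(\<Sum>i\<in>Dev. \<Sum>j\<in>Dev. x i * (pay g c i j * y j)) \<le> dev_value g x y"
      unfolding dev_value_def by (intro sum_mono) (simp add: pay_def DevD)
  qed
  finally show ?thesis by simp
qed

lemma code_pay_uniform:
  assumes "T \<subseteq> {..<k}" "\<And>a. a < k \<Longrightarrow> i a < n \<and> blk (i a) = a \<and> lbl (i a) = g a"
  shows "(\<Sum>a<k. code_pay g (i a) T) = 0"
proof -
  have "(\<Sum>a<k. code_pay g (i a) T) = (\<Sum>a<k. of_bool (a \<in> T) - card T / k)"
    using assms by (intro sum.cong refl) (auto simp: code_pay_def)
  also have "\<dots> = 0" using assms(1) k_pos by (simp add: sum_subtractf Int_absorb1)
  finally show ?thesis .
qed

text \<open>Average over k replies, one at each point of the graph of g and all with test T. Their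
  own scores cancel by \<open>code_pay_uniform\<close>, whatever tests y uses, and what remains is
  minus the score of y under T. Against the first block of y these replies earn a nonnegative
  amount, so dropping that part only weakens the bound.\<close>

lemma code_pay_le_dev_value:
  assumes "mixed x" "mixed y" "best_reply g c x y \<epsilon>" "\<And>a b. \<bar>c a b\<bar> \<le> 1" "T \<subseteq> {..<k}"
    and g: "\<And>a. a < k \<Longrightarrow> g a \<subseteq> {..<K}"
  shows "- (\<Sum>j\<in>Dev. y j * code_pay g j T) / 4 \<le> dev_value g x y + own_mass x + own_mass y + \<epsilon>"
    (is "_ \<le> ?v")
proof -
  have "\<forall>a. \<exists>i. a < k \<longrightarrow> i < n \<and> \<not> own i \<and> blk i = a \<and> lbl i = g a \<and> tst i = T"
    using dev_surj[OF _ g assms(5)] by blast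
  from choice[OF this] obtain i where i: "\<And>a. a < k \<Longrightarrow>
      i a < n \<and> \<not> own (i a) \<and> blk (i a) = a \<and> lbl (i a) = g a \<and> tst (i a) = T" by blast
  have reply: "(\<Sum>j\<in>Dev. dev_pay g (i a) j * y j) \<le> ?v" if a: "a < k" for a
  proof -
    have "(\<Sum>j\<in>Own. pay g c (i a) j * y j) \<ge> 0"
      using i[OF a] assms(2) test_pay_bounds[of "i a"]
      by (intro sum_nonneg mult_nonneg_nonneg) (auto simp: pay_def OwnD intro: mixedD)
    moreover have "(\<Sum>j\<in>Dev. pay g c (i a) j * y j) = (\<Sum>j\<in>Dev. dev_pay g (i a) j * y j)"
      using i[OF a] by (intro sum.cong refl) (simp add: pay_def DevD)
    moreover have "(\<Sum>j<n. pay g c (i a) j * y j) - \<epsilon> \<le> (\<Sum>i<n. x i * (\<Sum>j<n. pay g c i j * y j))"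
      using assms(3) i[OF a] unfolding best_reply_def by blast
    ultimately show ?thesis
      using value_le_dev_value[where c = c and g = g, OF assms(1,2,4)] sum_split[of "\<lambda>j. pay g c (i a) j * y j"] by linarith
  qed
  have "(\<Sum>a<k. dev_pay g (i a) j * y j) = real k * (- (y j * code_pay g j T) / 4)" if "j \<in> Dev" for j
  proof -
    have "(\<Sum>a<k. dev_pay g (i a) j) = (\<Sum>a<k. code_pay g (i a) (tst j) / 4 - code_pay g j T / 4)"
      using i by (intro sum.cong refl) (simp add: dev_pay_def diff_divide_distrib)
    also have "\<dots> = - real k * code_pay g j T / 4"
      using code_pay_uniform[of "tst j" i g] i tst_sub DevD(1)[OF that]
      by (simp add: sum_subtractf flip: sum_divide_distrib)
    finally show ?thesis by (simp flip: sum_distrib_right)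
  qed
  then have "(\<Sum>j\<in>Dev. \<Sum>a<k. dev_pay g (i a) j * y j) = real k * (- (\<Sum>j\<in>Dev. y j * code_pay g j T) / 4)"
    by (simp flip: sum_distrib_left sum_divide_distrib add: sum_negf)
  moreover have "(\<Sum>a<k. \<Sum>j\<in>Dev. dev_pay g (i a) j * y j) \<le> (\<Sum>a<k. ?v)"
    using reply by (intro sum_mono) simp
  ultimately have "real k * (- (\<Sum>j\<in>Dev. y j * code_pay g j T) / 4) \<le> real k * ?v"
    by (subst (asm) sum.swap) simp
  then show ?thesis by (rule mult_left_le_imp_le) (use k_pos in simp)
qed

text \<open>For x, the empty test bounds the zero-sum value below by -(4 + 4 + 1) \<epsilon>. For y,
  the test T and antisymmetry then bound the score of x under T below by -4 * 18 \<epsilon> = -72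
  \<epsilon>. The other 4 \<epsilon> account for the mass of x outside the second block.\<close>

lemma code_mass:
  assumes "mixed x" "mixed y" "best_reply g c x y \<epsilon>" "best_reply g (\<lambda>a b. c b a) y x \<epsilon>"
    and c: "\<And>a b. \<bar>c a b\<bar> \<le> 1"
    and small: "own_mass x \<le> 4 * \<epsilon>" "own_mass y \<le> 4 * \<epsilon>"
    and g: "\<And>a. a < k \<Longrightarrow> g a \<subseteq> {..<K}"
    and T: "T \<subseteq> {..<k}"
  shows "(\<Sum>i\<in>Dev. x i * of_bool (blk i \<in> T \<and> lbl i = g (blk i))) \<ge> card T / k - 76 * \<epsilon>"
proof -
  have "0 \<le> dev_value g x y + own_mass x + own_mass y + \<epsilon>"
    using code_pay_le_dev_value[OF assms(1-3) c _ g, of "{}"] by (simp add: code_pay_def)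
  moreover have "- (\<Sum>i\<in>Dev. x i * code_pay g i T) / 4 \<le> dev_value g y x + own_mass y + own_mass x + \<epsilon>"
    using code_pay_le_dev_value[OF assms(2,1,4) c T g] by simp
  ultimately have "(\<Sum>i\<in>Dev. x i * code_pay g i T) \<ge> - 72 * \<epsilon>"
    using small dev_value_antisym[of g x y] by linarith
  moreover have "(\<Sum>i\<in>Dev. x i * code_pay g i T)
      = (\<Sum>i\<in>Dev. x i * of_bool (blk i \<in> T \<and> lbl i = g (blk i))) - (1 - own_mass x) * (card T / k)"
    unfolding code_pay_def right_diff_distrib sum_subtractf
    by (simp only: dev_mass[OF assms(1)] flip: sum_distrib_right)
  moreover have "own_mass x * (card T / k) \<le> own_mass x * 1"
    using own_mass_nonneg[OF assms(1)] card_test_frac(2)[OF T] by (intro mult_left_mono)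
  moreover have "(1 - own_mass x) * (card T / k) = card T / k - own_mass x * (card T / k)"
    by (simp only: left_diff_distrib mult_1)
  ultimately show ?thesis using small(1) by argo
qed

text \<open>No strategy whose question lies in the disagreement set is on both graphs. One mass
  bound on that set, of size at least k/2, and the other on all questions thus concern disjoint
  strategies, and 3/2 - 152 \<epsilon> exceeds the available mass 1.\<close>

lemma codes_incompatible:
  assumes x: "mixed x" and "\<epsilon> \<le> 1/1000"
    and far: "2 * card {a \<in> {..<k}. g a = g' a} \<le> k"
    and mass: "\<And>T. T \<subseteq> {..<k} \<Longrightarrow>
      (\<Sum>i\<in>Dev. x i * of_bool (blk i \<in> T \<and> lbl i = g (blk i))) \<ge> card T / k - 76 * \<epsilon>"
    and mass': "\<And>T. T \<subseteq> {..<k} \<Longrightarrow>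
      (\<Sum>i\<in>Dev. x i * of_bool (blk i \<in> T \<and> lbl i = g' (blk i))) \<ge> card T / k - 76 * \<epsilon>"
  shows False
proof -
  let ?T = "{..<k} - {a \<in> {..<k}. g a = g' a}"
  have "card ?T = k - card {a \<in> {..<k}. g a = g' a}" by (subst card_Diff_subset) auto
  then have "card ?T / k \<ge> 1/2" using far k_pos by (simp add: field_simps of_nat_diff)
  then have "1/2 - 76 * \<epsilon> \<le> card ?T / k - 76 * \<epsilon>" by simp
  also have "\<dots> \<le> (\<Sum>i\<in>Dev. x i * of_bool (blk i \<in> ?T \<and> lbl i = g (blk i)))"
    by (rule mass) blast
  finally have "1/2 - 76 * \<epsilon> \<le> (\<Sum>i\<in>Dev. x i * of_bool (blk i \<in> ?T \<and> lbl i = g (blk i)))" .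
  moreover have "1 - 76 * \<epsilon> \<le> (\<Sum>i\<in>Dev. x i * of_bool (blk i \<in> {..<k} \<and> lbl i = g' (blk i)))"
    using mass'[of "{..<k}"] k_pos by simp
  moreover have "(\<Sum>i\<in>Dev. x i * of_bool (blk i \<in> ?T \<and> lbl i = g (blk i)))
      + (\<Sum>i\<in>Dev. x i * of_bool (blk i \<in> {..<k} \<and> lbl i = g' (blk i))) \<le> (\<Sum>i\<in>Dev. x i)"
    unfolding sum.distrib[symmetric]
    using x by (intro sum_mono) (auto dest: mixedD DevD)
  moreover have "(\<Sum>i\<in>Dev. x i) \<le> 1" using dev_mass[OF x] own_mass_nonneg[OF x] by simp
  ultimately show False using assms(2) by linarith
qed

end

section \<open>Polynomials on pseudo-distributions\<close>

text \<open>Polynomiality along lines only, with no degree bound. This suffices for finding common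
  nonzeros and is closed under ring operations without any bookkeeping of monomials.\<close>

definition line_poly :: "nat \<Rightarrow> (real vec \<Rightarrow> real) \<Rightarrow> bool" where
  "line_poly m h \<longleftrightarrow> (\<forall>z\<in>carrier_vec m. \<forall>w\<in>carrier_vec m. \<exists>P. \<forall>t. h (z + t \<cdot>\<^sub>v w) = poly P t)"

lemma line_poly_const: "line_poly m (\<lambda>z. r)"
  unfolding line_poly_def by (intro ballI exI[of _ "[:r:]"]) simp

lemma line_poly_coordinate: "i < m \<Longrightarrow> line_poly m (\<lambda>z. z $ i)"
  unfolding line_poly_def
proof (intro ballI exI allI)
  fix z w :: "real vec" and t
  assume "i < m" "z \<in> carrier_vec m" "w \<in> carrier_vec m"
  then show "(z + t \<cdot>\<^sub>v w) $ i = poly [:z $ i, w $ i:] t" by simp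
qed

lemma line_poly_add: "line_poly m f \<Longrightarrow> line_poly m g \<Longrightarrow> line_poly m (\<lambda>z. f z + g z)"
  unfolding line_poly_def by (metis poly_add)

lemma line_poly_diff: "line_poly m f \<Longrightarrow> line_poly m g \<Longrightarrow> line_poly m (\<lambda>z. f z - g z)"
  unfolding line_poly_def by (metis poly_diff)

lemma line_poly_mult: "line_poly m f \<Longrightarrow> line_poly m g \<Longrightarrow> line_poly m (\<lambda>z. f z * g z)"
  unfolding line_poly_def by (metis poly_mult)

lemma line_poly_power: "line_poly m f \<Longrightarrow> line_poly m (\<lambda>z. f z ^ e)"
  by (induction e) (simp_all add: line_poly_const line_poly_mult)

lemma line_poly_sum: "(\<And>i. i \<in> I \<Longrightarrow> line_poly m (f i)) \<Longrightarrow> line_poly m (\<lambda>z. \<Sum>i\<in>I. f i z)"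
  by (induction I rule: infinite_finite_induct) (simp_all add: line_poly_const line_poly_add)

lemma line_poly_prod: "(\<And>i. i \<in> I \<Longrightarrow> line_poly m (f i)) \<Longrightarrow> line_poly m (\<lambda>z. \<Prod>i\<in>I. f i z)"
  by (induction I rule: infinite_finite_induct) (simp_all add: line_poly_const line_poly_mult)

text \<open>On the line through z and w both restrictions are nonzero polynomials in t, so their
  product has finitely many roots.\<close>

lemma common_nonzero:
  assumes "line_poly m f" "line_poly m g"
    and "z \<in> carrier_vec m" "f z \<noteq> 0" "w \<in> carrier_vec m" "g w \<noteq> 0"
  obtains v where "v \<in> carrier_vec m" "f v \<noteq> 0" "g v \<noteq> 0"
proof -
  have wz: "w - z \<in> carrier_vec m" using assms by simp
  obtain P where P: "\<And>t. f (z + t \<cdot>\<^sub>v (w - z)) = poly P t"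
    using assms(1,3) wz unfolding line_poly_def by blast
  obtain Q where Q: "\<And>t. g (z + t \<cdot>\<^sub>v (w - z)) = poly Q t"
    using assms(2,3) wz unfolding line_poly_def by blast
  have "z + 0 \<cdot>\<^sub>v (w - z) = z" "z + 1 \<cdot>\<^sub>v (w - z) = w"
    using assms(3,5) by auto
  then have "P \<noteq> 0" "Q \<noteq> 0" using P[of 0] Q[of 1] assms by auto
  then have "finite {t. poly (P * Q) t = 0}" by (intro poly_roots_finite) simp
  then obtain t where "poly (P * Q) t \<noteq> 0"
    using infinite_UNIV_char_0[where 'a = real] by (metis (mono_tags, lifting) finite_subset mem_Collect_eq subsetI)
  then show ?thesis using P[of t] Q[of t] assms(3) wz by (intro that[of "z + t \<cdot>\<^sub>v (w - z)"]) auto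
qed

text \<open>On the ray through z total degree becomes degree in t, and the coefficient of t^e is the
  value at z of the homogeneous part of degree e.\<close>

lemma poly_deg_le_line:
  fixes f :: "real vec \<Rightarrow> real"
  assumes "finite A" "\<forall>a\<in>A. (\<Sum>i<m. a i) \<le> k" "z \<in> carrier_vec m"
    and f: "\<forall>z\<in>carrier_vec m. f z = (\<Sum>a\<in>A. c a * (\<Prod>i<m. (z $ i) ^ a i))"
  defines "P \<equiv> (\<Sum>a\<in>A. monom (c a * (\<Prod>i<m. (z $ i) ^ a i)) (\<Sum>i<m. a i))"
  shows "degree P \<le> k" "f (t \<cdot>\<^sub>v z) = poly P t"
    "coeff P e = (\<Sum>a | a \<in> A \<and> (\<Sum>i<m. a i) = e. c a * (\<Prod>i<m. (z $ i) ^ a i))"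
proof -
  show "degree P \<le> k"
    unfolding P_def using assms(1,2) by (intro degree_sum_le) (auto intro: order_trans[OF degree_monom_le])
  have "f (t \<cdot>\<^sub>v z) = (\<Sum>a\<in>A. c a * (\<Prod>i<m. (t * z $ i) ^ a i))"
    using f assms(3) by simp
  also have "\<dots> = (\<Sum>a\<in>A. c a * (\<Prod>i<m. (z $ i) ^ a i) * t ^ (\<Sum>i<m. a i))"
    by (intro sum.cong refl) (simp add: power_mult_distrib prod.distrib power_sum mult_ac)
  also have "\<dots> = poly P t" by (simp only: P_def poly_sum poly_monom)
  finally show "f (t \<cdot>\<^sub>v z) = poly P t" .
  show "coeff P e = (\<Sum>a | a \<in> A \<and> (\<Sum>i<m. a i) = e. c a * (\<Prod>i<m. (z $ i) ^ a i))"
    unfolding P_def coeff_sum using assms(1) by (auto simp: sum.inter_filter intro!: sum.cong)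
qed

lemma poly_deg_le_lineE:
  assumes "poly_deg_le m k f" "z \<in> carrier_vec m"
  obtains P where "degree P \<le> k" "\<And>t. f (t \<cdot>\<^sub>v z) = poly P t"
proof -
  from assms(1) obtain A c where "finite A" "\<forall>a\<in>A. (\<Sum>i<m. a i) \<le> k"
    "\<forall>z\<in>carrier_vec m. f z = (\<Sum>a\<in>A. c a * (\<Prod>i<m. (z $ i) ^ a i))"
    unfolding poly_deg_le_def by blast
  from poly_deg_le_line(1,2)[OF this(1,2) assms(2) this(3)] that show ?thesis by blast
qed

(* If deg f > d/2, pick a point v where neither h nor the leading form of f vanishes; on the line
   through 0 and v the degree of f^2 h exceeds d. *)
lemma poly_deg_le_factor:
  assumes "poly_deg_le m k f" "poly_deg_le m d (\<lambda>z. (f z)\<^sup>2 * h z)"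
    and h: "line_poly m h" and w: "w \<in> carrier_vec m" "h w \<noteq> 0"
  shows "poly_deg_le m (d div 2) f"
proof -
  define k' where "k' = (LEAST k. poly_deg_le m k f)"
  have k': "poly_deg_le m k' f" unfolding k'_def using assms(1) by (rule LeastI)
  have least: "\<not> poly_deg_le m j f" if "j < k'" for j
    using that not_less_Least unfolding k'_def by blast
  have "2 * k' \<le> d"
  proof (rule ccontr)
    assume big: "\<not> 2 * k' \<le> d"
    obtain A c where A: "finite A" "\<forall>a\<in>A. (\<Sum>i<m. a i) \<le> k'"
      and f: "\<forall>z\<in>carrier_vec m. f z = (\<Sum>a\<in>A. c a * (\<Prod>i<m. (z $ i) ^ a i))"
      using k' unfolding poly_deg_le_def by blast
    define top where
      "top z = (\<Sum>a | a \<in> A \<and> (\<Sum>i<m. a i) = k'. c a * (\<Prod>i<m. (z $ i) ^ a i))" for z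
    have "\<exists>z\<in>carrier_vec m. top z \<noteq> 0"
    proof (rule ccontr)
      assume "\<not> ?thesis"
      then have top0: "top z = 0" if "z \<in> carrier_vec m" for z using that by blast
      \<comment> \<open>By \<open>big\<close>, k' is positive, so k' - 1 really is smaller and
        contradicts the minimality of k'.\<close>
      have "poly_deg_le m (k' - 1) f"
        unfolding poly_deg_le_def
      proof (intro exI[of _ "{a \<in> A. (\<Sum>i<m. a i) \<noteq> k'}"] exI[of _ c] conjI ballI)
        fix z :: "real vec" assume z: "z \<in> carrier_vec m"
        have "f z = (\<Sum>a\<in>A. c a * (\<Prod>i<m. (z $ i) ^ a i))" using f z by blast
        also have "\<dots> = (\<Sum>a | a \<in> A \<and> (\<Sum>i<m. a i) \<noteq> k'. c a * (\<Prod>i<m. (z $ i) ^ a i)) + top z"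
          unfolding top_def using A(1)
          by (subst sum.union_disjoint[symmetric]) (auto intro!: sum.cong)
        finally show "f z = (\<Sum>a | a \<in> A \<and> (\<Sum>i<m. a i) \<noteq> k'. c a * (\<Prod>i<m. (z $ i) ^ a i))"
          using top0[OF z] by simp
      next
        fix a assume "a \<in> {a \<in> A. (\<Sum>i<m. a i) \<noteq> k'}"
        then have "(\<Sum>i<m. a i) \<le> k'" "(\<Sum>i<m. a i) \<noteq> k'" using A(2) by auto
        then show "(\<Sum>i<m. a i) \<le> k' - 1" by linarith
      qed (use A in simp)
      then show False using least[of "k' - 1"] big by simp
    qed
    moreover have "line_poly m top"
      unfolding top_def
      by (intro line_poly_sum line_poly_mult line_poly_const line_poly_prod line_poly_power line_poly_coordinate)
        simp
    ultimately obtain v where v: "v \<in> carrier_vec m" "top v \<noteq> 0" "h v \<noteq> 0"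
      using common_nonzero h w by metis
    define P where "P = (\<Sum>a\<in>A. monom (c a * (\<Prod>i<m. (v $ i) ^ a i)) (\<Sum>i<m. a i))"
    note P = poly_deg_le_line[OF A v(1) f, folded P_def]
    have "coeff P k' \<noteq> 0" using v(2) unfolding P(3) top_def .
    then have deg_P: "degree P = k'" "P \<noteq> 0"
      using P(1) le_degree by (auto intro: antisym)
    obtain H where H: "\<And>t. h (0\<^sub>v m + t \<cdot>\<^sub>v v) = poly H t"
      using h v(1) zero_carrier_vec unfolding line_poly_def by blast
    have H': "h (t \<cdot>\<^sub>v v) = poly H t" for t using H[of t] v(1) by simp
    have "H \<noteq> 0" using H'[of 1] v by auto
    obtain Q where Q: "degree Q \<le> d" "\<And>t. (f (t \<cdot>\<^sub>v v))\<^sup>2 * h (t \<cdot>\<^sub>v v) = poly Q t"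
      using poly_deg_le_lineE[OF assms(2) v(1)] by blast
    have "poly (P * P * H) = poly Q"
      using Q(2) P(2) H' by (intro ext) (simp add: power2_eq_square)
    then have "P * P * H = Q" by (simp add: poly_eq_poly_eq_iff)
    then have "degree Q = 2 * k' + degree H"
      using deg_P \<open>H \<noteq> 0\<close> degree_mult_eq[of "P * P" H] degree_mult_eq[of P P] by simp
    then show False using Q(1) big by simp
  qed
  then have "k' \<le> d div 2" by simp
  then show ?thesis using k' unfolding poly_deg_le_def by (meson order_trans)
qed

section \<open>Images of signed measures and satisfied inequalities\<close>

definition push_forward :: "'a set \<Rightarrow> ('a \<Rightarrow> real) \<Rightarrow> ('a \<Rightarrow> real vec) \<Rightarrow> real vec \<Rightarrow> real" where
  "push_forward S u z v = (\<Sum>s | s \<in> S \<and> z s = v. u s)"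

lemma push_forward_support: "finite S \<Longrightarrow> {v. push_forward S u z v \<noteq> 0} \<subseteq> z ` S"
proof
  fix v assume "v \<in> {v. push_forward S u z v \<noteq> 0}"
  then have "{s \<in> S. z s = v} \<noteq> {}"
    unfolding push_forward_def by (intro notI) (simp only: sum.empty mem_Collect_eq)
  then show "v \<in> z ` S" by blast
qed

lemma pseudo_expectation_push_forward:
  assumes "finite S"
  shows "pseudo_expectation (push_forward S u z) f = (\<Sum>s\<in>S. u s * f (z s))"
proof -
  have "pseudo_expectation (push_forward S u z) f
      = (\<Sum>v\<in>z ` S. push_forward S u z v * f v)"
    unfolding pseudo_expectation_def
    using assms push_forward_support[OF assms, of u z] by (intro sum.mono_neutral_left) auto
  also have "\<dots> = (\<Sum>v\<in>z ` S. \<Sum>s | s \<in> S \<and> z s = v. u s * f (z s))"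
    unfolding push_forward_def sum_distrib_right by (intro sum.cong refl) auto
  also have "\<dots> = (\<Sum>s\<in>S. u s * f (z s))"
    using assms by (intro sum.group) auto
  finally show ?thesis .
qed

text \<open>The definition bounds the degree of the product with h, not that of q. If h is not
  identically zero, \<open>poly_deg_le_factor\<close> brings q down to degree d div 2; if h
  vanishes, q is unrestricted but the expectation is 0.\<close>

lemma satisfies_ge0I:
  assumes h: "line_poly m h"
    and supp: "{v. \<mu> v \<noteq> 0} \<subseteq> carrier_vec m"
    and nonneg: "\<And>q. poly_deg_le m (d div 2) q \<Longrightarrow> pseudo_expectation \<mu> (\<lambda>z. (q z)\<^sup>2 * h z) \<ge> 0"
  shows "satisfies_ge0 d m \<mu> h"
  unfolding satisfies_ge0_def
proof (intro allI impI, elim conjE)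
  fix q k assume q: "poly_deg_le m k q" "poly_deg_le m d (\<lambda>z. (q z)\<^sup>2 * h z)"
  show "pseudo_expectation \<mu> (\<lambda>z. (q z)\<^sup>2 * h z) \<ge> 0"
  proof (cases "\<exists>w\<in>carrier_vec m. h w \<noteq> 0")
    case True
    then show ?thesis using poly_deg_le_factor[OF q h] nonneg by blast
  next
    case False
    then have "pseudo_expectation \<mu> (\<lambda>z. (q z)\<^sup>2 * h z) = 0"
      using supp unfolding pseudo_expectation_def by (intro sum.neutral) auto
    then show ?thesis by simp
  qed
qed

section \<open>The pseudo-equilibrium\<close>

text \<open>Independence reaches up to 2 * D because symmetric differences of two derivations, each
  touching up to D questions, must not cancel either.\<close>

locale constraint_system =
  fixes k K D :: nat and p :: "nat \<Rightarrow> nat set" and c :: "nat \<Rightarrow> nat \<Rightarrow> real"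
  assumes p_sub: "\<And>b. b < k \<Longrightarrow> p b \<subseteq> {..<K}"
    and independent: "\<And>J. J \<subseteq> {..<k} \<Longrightarrow> J \<noteq> {} \<Longrightarrow> card J \<le> 2 * D \<Longrightarrow> xor_sum p J \<noteq> {}"
    and signs: "\<And>a b. c a b = 1 \<or> c a b = -1"
    and D_ge_2: "2 \<le> D"
begin

section \<open>Derivations from constraints and their moments\<close>

definition X :: "(nat \<times> nat) set" where
  "X = {..<2 * k} \<times> {..<K}"

definition edge :: "nat \<times> nat \<Rightarrow> (nat \<times> nat) set" where
  "edge x = {fst x} \<times> p (snd x) \<union> {k + snd x} \<times> p (fst x)"

definition touched :: "(nat \<times> nat) set \<Rightarrow> nat set" where
  "touched E = fst ` E \<union> (\<lambda>x. k + snd x) ` E"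

definition derivations :: "(nat \<times> nat) set set" where
  "derivations = {E. E \<subseteq> {..<k} \<times> {..<k} \<and> card (touched E) \<le> D}"

definition sign_of :: "(nat \<times> nat) set \<Rightarrow> real" where
  "sign_of E = (\<Prod>x\<in>E. c (fst x) (snd x))"

text \<open>At most one summand is nonzero, by \<open>xor_sum_edge_inj\<close>: the moment is the
  sign of the only derivation of A, or 0 if there is none.\<close>

definition \<sigma> :: "(nat \<times> nat) set \<Rightarrow> real" where
  "\<sigma> A = (\<Sum>E\<in>derivations. if xor_sum edge E = A then sign_of E else 0)"

lemma finite_X [simp]: "finite X"
  by (simp add: X_def)

lemma finite_edges: "E \<subseteq> {..<k} \<times> {..<k} \<Longrightarrow> finite E"
  by (rule finite_subset) auto

lemma finite_derivations [simp]: "finite derivations"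
  unfolding derivations_def by (rule finite_subset[of _ "Pow ({..<k} \<times> {..<k})"]) auto

lemma derivationsD: "E \<in> derivations \<Longrightarrow> E \<subseteq> {..<k} \<times> {..<k}" "E \<in> derivations \<Longrightarrow> card (touched E) \<le> D"
  by (auto simp: derivations_def)

lemma edge_sub: "a < k \<Longrightarrow> b < k \<Longrightarrow> edge (a, b) \<subseteq> X"
  using p_sub by (fastforce simp: edge_def X_def)

lemma slice_left:
  assumes "E \<subseteq> {..<k} \<times> {..<k}" "a < k"
  shows "{j. (a, j) \<in> xor_sum edge E} = xor_sum p {b. (a, b) \<in> E}"
proof -
  have "{x \<in> E. (a, j) \<in> edge x} = Pair a ` {b \<in> {b. (a, b) \<in> E}. j \<in> p b}" for j
    using assms by (auto simp: edge_def)
  then have "card {x \<in> E. (a, j) \<in> edge x} = card {b \<in> {b. (a, b) \<in> E}. j \<in> p b}" for j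
    by (simp add: card_image inj_on_def)
  then show ?thesis by (simp add: xor_sum_def)
qed

lemma slice_right:
  assumes "E \<subseteq> {..<k} \<times> {..<k}" "b < k"
  shows "{j. (k + b, j) \<in> xor_sum edge E} = xor_sum p {a. (a, b) \<in> E}"
proof -
  have "{x \<in> E. (k + b, j) \<in> edge x} = (\<lambda>a. (a, b)) ` {a \<in> {a. (a, b) \<in> E}. j \<in> p a}" for j
    using assms by (auto simp: edge_def)
  then have "card {x \<in> E. (k + b, j) \<in> edge x} = card {a \<in> {a. (a, b) \<in> E}. j \<in> p a}" for j
    by (simp add: card_image inj_on_def)
  then show ?thesis by (simp add: xor_sum_def)
qed

lemma finite_touched: "finite E \<Longrightarrow> finite (touched E)"
  by (simp add: touched_def)

text \<open>No question cancels. At a touched question a the slice of the sum is the sum of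
  \<open>p b\<close> over the partners b of a. Every partner contributes its own touched question k
  + b, so there are at most 2 * D partners and independence applies; the other side is
  symmetric.\<close>

lemma fst_xor_sum_edge:
  assumes E: "E \<subseteq> {..<k} \<times> {..<k}" and small: "card (touched E) \<le> 2 * D"
  shows "fst ` xor_sum edge E = touched E"
proof
  have fin: "finite (touched E)" using finite_touched finite_edges[OF E] by blast
  have "xor_sum edge E \<subseteq> touched E \<times> UNIV"
    by (rule xor_sum_subset) (auto simp: edge_def touched_def)
  then show "fst ` xor_sum edge E \<subseteq> touched E" by auto
  show "touched E \<subseteq> fst ` xor_sum edge E"
  proof
    fix i assume "i \<in> touched E"
    then consider a b where "(a, b) \<in> E" "i = a" | a b where "(a, b) \<in> E" "i = k + b"
      by (auto simp: touched_def)
    then have "{j. (i, j) \<in> xor_sum edge E} \<noteq> {}"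
    proof cases
      case 1
      have "(\<lambda>b. k + b) ` {b. (a, b) \<in> E} \<subseteq> touched E" by (force simp: touched_def)
      then have "card ((\<lambda>b. k + b) ` {b. (a, b) \<in> E}) \<le> card (touched E)"
        by (intro card_mono fin)
      then have "card {b. (a, b) \<in> E} \<le> 2 * D" using small by (simp add: card_image)
      moreover have "{b. (a, b) \<in> E} \<subseteq> {..<k}" "{b. (a, b) \<in> E} \<noteq> {}" "a < k" using 1 E by auto
      ultimately show ?thesis using slice_left[OF E, of a] independent 1 by metis
    next
      case 2
      have "{a. (a, b) \<in> E} \<subseteq> touched E" by (force simp: touched_def)
      then have "card {a. (a, b) \<in> E} \<le> card (touched E)"
        by (intro card_mono fin)
      then have "card {a. (a, b) \<in> E} \<le> 2 * D" using small by simp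
      moreover have "{a. (a, b) \<in> E} \<subseteq> {..<k}" "{a. (a, b) \<in> E} \<noteq> {}" "b < k" using 2 E by auto
      ultimately show ?thesis using slice_right[OF E, of b] independent 2 by metis
    qed
    then show "i \<in> fst ` xor_sum edge E" by force
  qed
qed

lemma card_touched_sym_diff:
  assumes "E \<in> derivations" "F \<in> derivations"
  shows "card (touched (sym_diff E F)) \<le> 2 * D"
proof -
  have fin: "finite E" "finite F" using assms derivationsD(1) finite_edges by blast+
  have "card (touched (sym_diff E F)) \<le> card (touched E \<union> touched F)"
    using fin by (intro card_mono) (auto simp: touched_def)
  also have "\<dots> \<le> card (touched E) + card (touched F)" by (rule card_Un_le)
  finally show ?thesis using derivationsD(2)[OF assms(1)] derivationsD(2)[OF assms(2)] by linarith
qed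

lemma xor_sum_edge_sym_diff:
  assumes "E \<in> derivations" "F \<in> derivations"
  shows "xor_sum edge (sym_diff E F) = sym_diff (xor_sum edge E) (xor_sum edge F)"
  using assms derivationsD(1) finite_edges by (intro xor_sum_sym_diff) blast+

lemma fst_sym_diff_xor_sum_edge:
  assumes "E \<in> derivations" "F \<in> derivations"
  shows "fst ` sym_diff (xor_sum edge E) (xor_sum edge F) = touched (sym_diff E F)"
  unfolding xor_sum_edge_sym_diff[OF assms, symmetric]
  using derivationsD(1)[OF assms(1)] derivationsD(1)[OF assms(2)] card_touched_sym_diff[OF assms]
  by (intro fst_xor_sum_edge) auto

lemma xor_sum_edge_inj:
  assumes "E \<in> derivations" "F \<in> derivations" "xor_sum edge E = xor_sum edge F"
  shows "E = F"
proof -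
  have "touched (sym_diff E F) = {}"
    using fst_sym_diff_xor_sum_edge[OF assms(1,2)] assms(3) by simp
  then show ?thesis by (auto simp: touched_def)
qed

lemma moment_derivation:
  assumes "E \<in> derivations"
  shows "\<sigma> (xor_sum edge E) = sign_of E"
proof -
  have "\<sigma> (xor_sum edge E) = (\<Sum>F\<in>derivations. if F = E then sign_of E else 0)"
    unfolding \<sigma>_def using xor_sum_edge_inj[OF _ assms] by (intro sum.cong refl) auto
  then show ?thesis using assms by simp
qed

lemma moment_nonzeroE:
  assumes "\<sigma> A \<noteq> 0"
  obtains E where "E \<in> derivations" "A = xor_sum edge E"
proof -
  have "\<exists>E\<in>derivations. xor_sum edge E = A"
  proof (rule ccontr)
    assume "\<not> ?thesis"
    then have "\<sigma> A = 0" unfolding \<sigma>_def by (intro sum.neutral) auto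
    then show False using assms by simp
  qed
  then show ?thesis using that by blast
qed

lemma sign_of_sym_diff:
  assumes "finite E" "finite F"
  shows "sign_of (sym_diff E F) = sign_of E * sign_of F"
proof -
  have E: "sign_of E = sign_of (E - F) * sign_of (E \<inter> F)"
    unfolding sign_of_def using assms by (subst prod.union_disjoint[symmetric]) (auto intro: prod.cong)
  have F: "sign_of F = sign_of (F - E) * sign_of (E \<inter> F)"
    unfolding sign_of_def using assms by (subst prod.union_disjoint[symmetric]) (auto intro: prod.cong)
  have "c a b * c a b = 1" for a b using signs[of a b] by auto
  then have "sign_of (E \<inter> F) * sign_of (E \<inter> F) = 1"
    unfolding sign_of_def by (simp flip: prod.distrib)
  moreover have "sign_of (sym_diff E F) = sign_of (E - F) * sign_of (F - E)"
    unfolding sign_of_def using assms by (intro prod.union_disjoint) auto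
  ultimately show ?thesis unfolding E F by (simp add: mult_ac)
qed

text \<open>Since \<open>sym_diff A B\<close> meets exactly the questions touched by
  \<open>sym_diff E F\<close>, a small conclusion certifies a small derivation:
  \<open>sym_diff E F\<close> is again a derivation, and signs multiply.\<close>

sublocale pseudo_moments X \<sigma> D
proof
  have "{} \<in> derivations" by (simp add: derivations_def touched_def)
  from moment_derivation[OF this] show "\<sigma> {} = 1" by (simp add: sign_of_def)
next
  fix A B assume nz: "\<sigma> A \<noteq> 0" "\<sigma> B \<noteq> 0" and small: "card (fst ` sym_diff A B) \<le> D"
  obtain E where E: "E \<in> derivations" "A = xor_sum edge E" using moment_nonzeroE[OF nz(1)] .
  obtain F where F: "F \<in> derivations" "B = xor_sum edge F" using moment_nonzeroE[OF nz(2)] .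
  have "sym_diff E F \<in> derivations"
    using small fst_sym_diff_xor_sum_edge[OF E(1) F(1)] derivationsD(1)[OF E(1)] derivationsD(1)[OF F(1)]
    unfolding derivations_def E(2) F(2) by auto
  then have "\<sigma> (sym_diff A B) = sign_of (sym_diff E F)"
    unfolding E(2) F(2) xor_sum_edge_sym_diff[OF E(1) F(1), symmetric] by (rule moment_derivation)
  also have "\<dots> = sign_of E * sign_of F"
    using E(1) F(1) derivationsD(1) finite_edges by (intro sign_of_sym_diff) blast+
  finally show "\<sigma> (sym_diff A B) = \<sigma> A * \<sigma> B"
    unfolding E(2) F(2) moment_derivation[OF E(1)] moment_derivation[OF F(1)] .
qed simp

lemma moment_edge:
  assumes "a < k" "b < k"
  shows "\<sigma> (edge (a, b)) = c a b" "card (fst ` edge (a, b)) \<le> 2"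
proof -
  have "card (touched {(a, b)}) \<le> 2"
    using card_Un_le[of "{a}" "{k + b}"] by (simp add: touched_def insert_commute)
  then have "{(a, b)} \<in> derivations" using assms D_ge_2 by (simp add: derivations_def)
  moreover have "xor_sum edge {(a, b)} = edge (a, b)"
    using xor_sum_insert[of "{}" "(a, b)" edge] by simp
  ultimately show "\<sigma> (edge (a, b)) = c a b"
    using moment_derivation[of "{(a, b)}"] by (simp add: sign_of_def)
  have "fst ` edge (a, b) \<subseteq> {a, k + b}" by (auto simp: edge_def)
  then have "card (fst ` edge (a, b)) \<le> card {a, k + b}" by (intro card_mono) auto
  also have "\<dots> \<le> 2" by (simp add: card_insert_if)
  finally show "card (fst ` edge (a, b)) \<le> 2" .
qed

abbreviation slice :: "(nat \<times> nat) set \<Rightarrow> nat \<Rightarrow> nat set" where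
  "slice W i \<equiv> {j. (i, j) \<in> W}"

lemma chi_edge:
  assumes "a < k" "b < k"
  shows "chi (edge (a, b)) W = chi (p b) (slice W a) * chi (p a) (slice W (k + b))"
proof -
  have fin: "finite (p b)" "finite (p a)" using p_sub assms finite_subset by blast+
  have "edge (a, b) = sym_diff ({a} \<times> p b) ({k + b} \<times> p a)"
    using assms by (auto simp: edge_def)
  then have "chi (edge (a, b)) W = chi ({a} \<times> p b) W * chi ({k + b} \<times> p a) W"
    using fin by (simp add: chi_sym_diff)
  then show ?thesis by (simp add: chi_section)
qed

text \<open>The degree budget is 2t for the square and 2 for the two questions of the
  constraint.\<close>

lemma expect_constraint:
  assumes "a < k" "b < k" "junta X t F" "2 * t + 2 \<le> D"
  shows "expect (\<lambda>W. (F W)\<^sup>2 * (c a b * chi (p b) (slice W a) * chi (p a) (slice W (k + b)))) = expect (\<lambda>W. (F W)\<^sup>2)"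
proof -
  have "junta X (t * 2) (\<lambda>W. (F W)\<^sup>2)" using assms(3) by (rule junta_power[OF finite_X])
  then have "expect (\<lambda>W. (F W)\<^sup>2 * (\<sigma> (edge (a, b)) * chi (edge (a, b)) W)) = expect (\<lambda>W. (F W)\<^sup>2)"
    using assms moment_edge[OF assms(1,2)] signs[of a b] edge_sub
    by (intro expect_mult_moment) auto
  then show ?thesis
    unfolding moment_edge(1)[OF assms(1,2)] chi_edge[OF assms(1,2)] by (simp only: mult.assoc)
qed

end

locale game_family = constraint_system k K D p c + labelled_strategies n k K own blk lbl tst p
  for n k K D own blk lbl tst p c
begin

text \<open>Each assignment W yields a genuine mixed strategy, uniform over the questions with the
  answers read off W; only the weights of the assignments are signed. The offset 0 selects the
  answers of the row player, k those of the column player.\<close>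

definition played :: "nat \<Rightarrow> (nat \<times> nat) set \<Rightarrow> nat \<Rightarrow> real" where
  "played off W i = (if own i \<and> slice W (off + blk i) = lbl i then 1 / k else 0)"

lemma slice_sub: "W \<subseteq> X \<Longrightarrow> slice W i \<subseteq> {..<K}"
  by (auto simp: X_def)

lemma junta_slice:
  assumes "i < 2 * k" "U \<subseteq> {..<K}"
  shows "junta X 1 (\<lambda>W. if slice W i = U then 1 else 0)"
  using assms slice_sub by (intro junta_coordinate[of "{..<K}"]) (auto simp: X_def)

lemma junta_played:
  assumes "i < n" "off \<le> k"
  shows "junta X 1 (\<lambda>W. played off W i)"
proof (cases "own i")
  case True
  have "junta X 1 (\<lambda>W. 1 / k * (if slice W (off + blk i) = lbl i then 1 else 0))"
    using assms blk_less[OF assms(1)] lbl_sub[OF assms(1)]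
    by (intro junta_scale junta_slice) auto
  then show ?thesis by (rule junta.cong) (simp add: played_def True)
next
  case False
  have "junta X 1 (\<lambda>W. 0)" by (rule junta.zero)
  then show ?thesis by (rule junta.cong) (simp add: played_def False)
qed

lemma sum_played:
  assumes "W \<subseteq> X" "\<And>j. j < n \<Longrightarrow> own j \<Longrightarrow> f j = h (blk j) (lbl j)"
  shows "(\<Sum>j<n. f j * played off W j) = (\<Sum>a<k. h a (slice W (off + a))) / k"
proof -
  let ?S = "{j. j < n \<and> own j \<and> slice W (off + blk j) = lbl j}"
  have "(\<Sum>j<n. f j * played off W j) = (\<Sum>j\<in>?S. f j * played off W j)"
    by (intro sum.mono_neutral_right) (auto simp: played_def)
  also have "\<dots> = (\<Sum>j\<in>?S. h (blk j) (slice W (off + blk j)) / k)"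
    using assms(2) by (intro sum.cong) (auto simp: played_def)
  also have "\<dots> = (\<Sum>a<k. h a (slice W (off + a)) / k)"
  proof (rule sum.reindex_bij_betw[where h = blk])
    show "bij_betw blk ?S {..<k}"
      unfolding bij_betw_def
    proof
      show "inj_on blk ?S"
      proof (rule inj_onI)
        fix i j assume ij: "i \<in> ?S" "j \<in> ?S" "blk i = blk j"
        then have "lbl i = lbl j" by auto
        then show "i = j" using ij own_inj[of i j] by blast
      qed
      show "blk ` ?S = {..<k}"
      proof
        show "blk ` ?S \<subseteq> {..<k}" using blk_less by auto
        show "{..<k} \<subseteq> blk ` ?S"
        proof
          fix a assume "a \<in> {..<k}"
          then obtain j where "j < n" "own j" "blk j = a" "lbl j = slice W (off + a)"
            using own_surj[OF _ slice_sub[OF assms(1)]] by blast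
          then show "a \<in> blk ` ?S" by force
        qed
      qed
    qed
  qed
  finally show ?thesis by (simp add: sum_divide_distrib)
qed

lemma sum_played_eq_1: "W \<subseteq> X \<Longrightarrow> (\<Sum>j<n. played off W j) = 1"
  using sum_played[of W "\<lambda>_. 1" "\<lambda>_ _. 1" off] k_pos by simp

text \<open>The only values are 0 and 1/k, so nonnegativity of a coordinate reduces to that of a
  square.\<close>

lemma played_square: "played off W i = k * (played off W i)\<^sup>2"
  using k_pos by (simp add: played_def power2_eq_square)

lemma expect_played_nonneg:
  assumes "junta X t F" "2 * t + 2 \<le> D" "i < n" "off \<le> k"
  shows "expect (\<lambda>W. (F W)\<^sup>2 * played off W i) \<ge> 0"
proof -
  have "expect (\<lambda>W. (F W)\<^sup>2 * played off W i) = expect (\<lambda>W. k * (F W * played off W i)\<^sup>2)"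
    by (intro expect_cong) (subst played_square, simp add: power_mult_distrib)
  also have "\<dots> \<ge> 0"
    unfolding expect_scale
    using expect_square_nonneg[OF junta_mult[OF finite_X assms(1) junta_played[OF assms(3,4)]]] assms(2)
    by simp
  finally show ?thesis .
qed

definition advantage ::
    "(nat \<Rightarrow> nat set) \<Rightarrow> (nat \<Rightarrow> nat \<Rightarrow> real) \<Rightarrow> nat \<Rightarrow> (nat \<Rightarrow> real) \<Rightarrow> (nat \<Rightarrow> real) \<Rightarrow> real" where
  "advantage g c' i x y =
     (\<Sum>i<n. x i * (\<Sum>j<n. pay g c' i j * y j)) - (\<Sum>j<n. pay g c' i j * y j)"

text \<open>For a sign G, (1 - G)^2 = 2 (1 - G), so the difference of the two sides is half the
  expectation of a square of a (t + 1)-junta.\<close>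

lemma expect_sign_le:
  assumes "junta X t F" "2 * t + 2 \<le> D" "junta X 1 G" "\<And>W. G W = 1 \<or> G W = -1"
  shows "expect (\<lambda>W. (F W)\<^sup>2 * G W) \<le> expect (\<lambda>W. (F W)\<^sup>2)"
proof -
  have "junta X (t + 1) (\<lambda>W. F W * (1 - G W))"
    by (intro junta_mult junta_diff junta_const assms finite_X)
  then have "0 \<le> expect (\<lambda>W. (F W * (1 - G W))\<^sup>2)"
    using assms(2) by (intro expect_square_nonneg) auto
  also have "\<dots> = expect (\<lambda>W. 2 * ((F W)\<^sup>2 - (F W)\<^sup>2 * G W))"
  proof (rule expect_cong)
    fix W
    show "(F W * (1 - G W))\<^sup>2 = 2 * ((F W)\<^sup>2 - (F W)\<^sup>2 * G W)"
      using assms(4)[of W] by (auto simp: power2_eq_square)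
  qed
  finally show ?thesis by (simp add: expect_scale expect_diff)
qed

text \<open>All constraints hold with certainty, so play is worth 1/2. A second-block reply earns
  exactly 1/2 for every assignment, because the questions are uniform and the test term averages to
  0; a first-block reply with a fixed answer earns half an average of signs. Stating the constraints
  for general \<open>c'\<close> and offsets covers the column player, for whom c is
  transposed.\<close>

lemma expect_advantage_nonneg:
  assumes F: "junta X t F" "2 * t + 2 \<le> D" and i: "i < n"
    and off: "off \<le> k" "off' \<le> k"
    and c': "\<And>a b. c' a b = 1 \<or> c' a b = -1"
    and constraint: "\<And>a b. a < k \<Longrightarrow> b < k \<Longrightarrow>
      expect (\<lambda>W. (F W)\<^sup>2 * (c' a b * chi (p b) (slice W (off + a)) * chi (p a) (slice W (off' + b))))
        = expect (\<lambda>W. (F W)\<^sup>2)"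
  shows "expect (\<lambda>W. (F W)\<^sup>2 * advantage g c' i (played off W) (played off' W)) \<ge> 0"
proof -
  let ?V = "\<lambda>W a b. c' a b * chi (p b) (slice W (off + a)) * chi (p a) (slice W (off' + b))"
  define reply where "reply i W = (\<Sum>j<n. pay g c' i j * played off' W j)" for i W
  have reply_own: "reply j W = (\<Sum>b<k. c' (blk j) b * chi (p b) (lbl j) * chi (p (blk j)) (slice W (off' + b)) / 2) / k"
    if "W \<subseteq> X" "own j" for j W
    unfolding reply_def
    by (rule sum_played[OF that(1), where h = "\<lambda>b U. c' (blk j) b * chi (p b) (lbl j) * chi (p (blk j)) U / 2"])
      (simp add: pay_def that)
  have reply_dev: "reply j W = 1/2" if "W \<subseteq> X" "\<not> own j" "j < n" for j W
  proof -
    have "reply j W = (\<Sum>b<k. 1/2 + (of_bool (b \<in> tst j) - card (tst j) / k) / 2) / k"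
      unfolding reply_def
      by (rule sum_played[OF that(1), where h = "\<lambda>b U. 1/2 + (of_bool (b \<in> tst j) - card (tst j) / k) / 2"])
        (simp add: pay_def that)
    also have "\<dots> = (k / 2 + ((\<Sum>b<k. of_bool (b \<in> tst j)) - k * (card (tst j) / k)) / 2) / k"
      by (simp add: sum.distrib sum_subtractf flip: sum_divide_distrib)
    also have "(\<Sum>b<k. of_bool (b \<in> tst j)) = real (card (tst j))"
      using tst_sub[OF that(3)] by (simp add: Int_absorb1)
    finally show ?thesis using k_pos by simp
  qed
  have "expect (\<lambda>W. (F W)\<^sup>2 * advantage g c' i (played off W) (played off' W))
      = expect (\<lambda>W. (\<Sum>a<k. \<Sum>b<k. 1 / (2 * k * k) * ((F W)\<^sup>2 * ?V W a b)) - (F W)\<^sup>2 * reply i W)"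
  proof (rule expect_cong)
    fix W assume W: "W \<subseteq> X"
    have "(\<Sum>j<n. played off W j * reply j W) = (\<Sum>j<n. reply j W * played off W j)"
      by (simp only: mult.commute)
    also have "\<dots> = (\<Sum>a<k. (\<Sum>b<k. ?V W a b / 2) / k) / k"
      by (rule sum_played[OF W, where
          h = "\<lambda>a U. (\<Sum>b<k. c' a b * chi (p b) U * chi (p a) (slice W (off' + b)) / 2) / k"])
        (rule reply_own[OF W])
    also have "\<dots> = (\<Sum>a<k. \<Sum>b<k. 1 / (2 * k * k) * ?V W a b)"
      by (simp add: sum_divide_distrib)
    finally show "(F W)\<^sup>2 * advantage g c' i (played off W) (played off' W)
      = (\<Sum>a<k. \<Sum>b<k. 1 / (2 * k * k) * ((F W)\<^sup>2 * ?V W a b)) - (F W)\<^sup>2 * reply i W"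
      unfolding advantage_def reply_def[symmetric]
      by (simp only: right_diff_distrib sum_distrib_left mult.left_commute[of "(F W)\<^sup>2" "1 / real (2 * k * k)"])
  qed
  also have "\<dots> = (\<Sum>a<k. \<Sum>b<k. 1 / (2 * k * k) * expect (\<lambda>W. (F W)\<^sup>2)) - expect (\<lambda>W. (F W)\<^sup>2 * reply i W)"
    unfolding expect_diff expect_sum expect_scale by (simp add: constraint)
  also have "\<dots> = expect (\<lambda>W. (F W)\<^sup>2) / 2 - expect (\<lambda>W. (F W)\<^sup>2 * reply i W)"
    using k_pos by simp
  finally have eq: "expect (\<lambda>W. (F W)\<^sup>2 * advantage g c' i (played off W) (played off' W))
    = expect (\<lambda>W. (F W)\<^sup>2) / 2 - expect (\<lambda>W. (F W)\<^sup>2 * reply i W)" .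
  have "expect (\<lambda>W. (F W)\<^sup>2 * reply i W) \<le> expect (\<lambda>W. (F W)\<^sup>2) / 2"
  proof (cases "own i")
    case False
    have "expect (\<lambda>W. (F W)\<^sup>2 * reply i W) = expect (\<lambda>W. 1/2 * (F W)\<^sup>2)"
      using reply_dev[OF _ False i] by (intro expect_cong) simp
    then show ?thesis unfolding expect_scale by simp
  next
    case True
    let ?G = "\<lambda>b W. c' (blk i) b * chi (p b) (lbl i) * chi (p (blk i)) (slice W (off' + b))"
    have "expect (\<lambda>W. (F W)\<^sup>2 * reply i W) = expect (\<lambda>W. \<Sum>b<k. 1 / (2 * k) * ((F W)\<^sup>2 * ?G b W))"
      by (intro expect_cong) (simp add: reply_own True sum_divide_distrib sum_distrib_left)
    also have "\<dots> = (\<Sum>b<k. 1 / (2 * k) * expect (\<lambda>W. (F W)\<^sup>2 * ?G b W))"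
      unfolding expect_sum expect_scale ..
    also have "\<dots> \<le> (\<Sum>b<k. 1 / (2 * k) * expect (\<lambda>W. (F W)\<^sup>2))"
    proof (intro sum_mono mult_left_mono expect_sign_le[OF F])
      fix b assume b: "b \<in> {..<k}"
      show "?G b W = 1 \<or> ?G b W = -1" for W
        using c'[of "blk i" b] chi_cases[of "p b" "lbl i"] chi_cases[of "p (blk i)" "slice W (off' + b)"]
        by auto
      have "{off' + b} \<times> p (blk i) \<subseteq> X"
        using p_sub[OF blk_less[OF i]] b off(2) by (auto simp: X_def)
      moreover have "card (fst ` ({off' + b} \<times> p (blk i))) \<le> 1"
        using card_mono[of "{off' + b}" "fst ` ({off' + b} \<times> p (blk i))"] by auto
      ultimately have "junta X 1 (\<lambda>W. c' (blk i) b * chi (p b) (lbl i) * chi ({off' + b} \<times> p (blk i)) W)"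
        by (intro junta_scale junta_chi)
      then show "junta X 1 (?G b)" by (simp only: chi_section)
    qed simp
    also have "\<dots> = expect (\<lambda>W. (F W)\<^sup>2) / 2" using k_pos by simp
    finally show ?thesis .
  qed
  then show ?thesis unfolding eq by simp
qed

section \<open>Assignments as points of R^(2n)\<close>

definition point :: "(nat \<times> nat) set \<Rightarrow> real vec" where
  "point W = vec (2 * n) (\<lambda>i. if i < n then played 0 W i else played k W (i - n))"

definition pseudo_dist :: "real vec \<Rightarrow> real" where
  "pseudo_dist = push_forward (Pow X) weight point"

text \<open>With c transposed and the indices exchanged, the column player faces the same payoff
  function as the row player, so one analysis covers both.\<close>

definition game_of :: "(nat \<Rightarrow> nat set) \<Rightarrow> game" where
  "game_of g = (mat n n (\<lambda>(i, j). pay g c i j), mat n n (\<lambda>(i, j). pay g (\<lambda>a b. c b a) j i))"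

lemma point_carrier: "point W \<in> carrier_vec (2 * n)"
  by (simp add: point_def)

lemma pseudo_expectation_pseudo_dist: "pseudo_expectation pseudo_dist f = expect (\<lambda>W. f (point W))"
  unfolding pseudo_dist_def expect_def by (rule pseudo_expectation_push_forward) simp

lemma pseudo_dist_support: "finite {v. pseudo_dist v \<noteq> 0}" "{v. pseudo_dist v \<noteq> 0} \<subseteq> carrier_vec (2 * n)"
proof -
  have "{v. pseudo_dist v \<noteq> 0} \<subseteq> point ` Pow X"
    unfolding pseudo_dist_def by (rule push_forward_support) simp
  then show "finite {v. pseudo_dist v \<noteq> 0}" "{v. pseudo_dist v \<noteq> 0} \<subseteq> carrier_vec (2 * n)"
    using point_carrier by (auto intro: finite_subset)
qed

lemma vec_first_index: "z \<in> carrier_vec (2 * n) \<Longrightarrow> i < n \<Longrightarrow> vec_first z n $ i = z $ i"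
  by (simp add: vec_first_def)

lemma vec_last_index: "z \<in> carrier_vec (2 * n) \<Longrightarrow> i < n \<Longrightarrow> vec_last z n $ i = z $ (n + i)"
  by (simp add: vec_last_def)

lemma point_first: "i < n \<Longrightarrow> vec_first (point W) n $ i = played 0 W i"
  using vec_first_index[OF point_carrier] by (simp add: point_def)

lemma point_last: "i < n \<Longrightarrow> vec_last (point W) n $ i = played k W i"
  using vec_last_index[OF point_carrier] by (simp add: point_def)

text \<open>A coordinate of \<open>point W\<close> reads the answer to one question, so polynomial
  degree bounds the number of questions.\<close>

lemma junta_point:
  assumes "poly_deg_le (2 * n) t q"
  shows "junta X t (\<lambda>W. q (point W))"
proof -
  obtain A r where A: "finite A" "\<And>a. a \<in> A \<Longrightarrow> (\<Sum>i<2 * n. a i) \<le> t"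
    and q: "\<And>z. z \<in> carrier_vec (2 * n) \<Longrightarrow> q z = (\<Sum>a\<in>A. r a * (\<Prod>i<2 * n. (z $ i) ^ a i))"
    using assms unfolding poly_deg_le_def by blast
  have coord: "junta X 1 (\<lambda>W. point W $ i)" if i: "i < 2 * n" for i
  proof (cases "i < n")
    case True
    from junta_played[OF this, of 0] show ?thesis using True by (simp add: point_def)
  next
    case False
    then have "junta X 1 (\<lambda>W. played k W (i - n))" using i by (intro junta_played) auto
    then show ?thesis using False i by (simp add: point_def)
  qed
  have "junta X t (\<lambda>W. \<Sum>a\<in>A. r a * (\<Prod>i<2 * n. (point W $ i) ^ a i))"
  proof (intro junta_sum junta_scale)
    fix a assume "a \<in> A"
    have "junta X (\<Sum>i<2 * n. 1 * a i) (\<lambda>W. \<Prod>i<2 * n. (point W $ i) ^ a i)"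
      using coord by (intro junta_prod junta_power) auto
    then show "junta X t (\<lambda>W. \<Prod>i<2 * n. (point W $ i) ^ a i)"
      using junta_mono A(2)[OF \<open>a \<in> A\<close>] by simp
  qed
  then show ?thesis using q[OF point_carrier] by simp
qed

lemma row_advantage_game_of:
  assumes "x \<in> carrier_vec n" "y \<in> carrier_vec n" "i < n"
  shows "row_advantage n (game_of g) i x y = advantage g c i (($) x) (($) y)"
  using assms
  by (simp add: row_advantage_def game_of_def advantage_def scalar_prod_def lessThan_atLeast0
      if_distrib[of "\<lambda>r. r * _"] sum.delta cong: if_cong)

lemma col_advantage_game_of:
  assumes "x \<in> carrier_vec n" "y \<in> carrier_vec n" "j < n"
  shows "col_advantage n (game_of g) j x y = advantage g (\<lambda>a b. c b a) j (($) y) (($) x)"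
proof -
  let ?P = "pay g (\<lambda>a b. c b a)"
  have "x \<bullet> (snd (game_of g) *\<^sub>v y) = (\<Sum>i<n. \<Sum>j<n. x $ i * (?P j i * y $ j))"
    using assms by (simp add: game_of_def scalar_prod_def lessThan_atLeast0 sum_distrib_left)
  also have "\<dots> = (\<Sum>j<n. \<Sum>i<n. x $ i * (?P j i * y $ j))" by (rule sum.swap)
  also have "\<dots> = (\<Sum>j<n. y $ j * (\<Sum>i<n. ?P j i * x $ i))"
    by (simp add: sum_distrib_left mult_ac)
  finally have "x \<bullet> (snd (game_of g) *\<^sub>v y) = (\<Sum>j<n. y $ j * (\<Sum>i<n. ?P j i * x $ i))" .
  moreover have "x \<bullet> (snd (game_of g) *\<^sub>v unit_vec n j) = (\<Sum>i<n. ?P j i * x $ i)"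
    using assms by (simp add: game_of_def scalar_prod_def lessThan_atLeast0 mult.commute
        if_distrib[of "\<lambda>r. _ * r"] if_distrib[of "\<lambda>r. r * _"] sum.delta cong: if_cong)
  ultimately show ?thesis by (simp add: col_advantage_def advantage_def)
qed

lemma line_poly_cong:
  "line_poly m f \<Longrightarrow> (\<And>z. z \<in> carrier_vec m \<Longrightarrow> f z = h z) \<Longrightarrow> line_poly m h"
  unfolding line_poly_def by (metis add_carrier_vec smult_carrier_vec)

lemma line_poly_first: "i < n \<Longrightarrow> line_poly (2 * n) (\<lambda>z. vec_first z n $ i)"
  by (rule line_poly_cong[OF line_poly_coordinate[of i]]) (simp_all add: vec_first_index)

lemma line_poly_last: "i < n \<Longrightarrow> line_poly (2 * n) (\<lambda>z. vec_last z n $ i)"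
  by (rule line_poly_cong[OF line_poly_coordinate[of "n + i"]]) (simp_all add: vec_last_index)

lemma line_poly_advantage:
  assumes "i < n" "\<And>j. j < n \<Longrightarrow> line_poly m (\<lambda>z. x z j)" "\<And>j. j < n \<Longrightarrow> line_poly m (\<lambda>z. y z j)"
  shows "line_poly m (\<lambda>z. advantage g c' i (x z) (y z))"
  unfolding advantage_def using assms
  by (intro line_poly_diff line_poly_sum line_poly_mult line_poly_const) auto

lemma advantage_cong:
  assumes "\<And>i. i < n \<Longrightarrow> x i = x' i" "\<And>i. i < n \<Longrightarrow> y i = y' i"
  shows "advantage g c' i x y = advantage g c' i x' y'"
  unfolding advantage_def using assms by simp

text \<open>The two spare degrees in \<open>d + 2 \<le> D\<close> pay for h, since 2 * (d div 2) + 2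
  \<le> D.\<close>

lemma satisfies_ge0_pseudo_dist:
  assumes h: "line_poly (2 * n) h" and d: "d + 2 \<le> D"
    and nonneg: "\<And>t F. junta X t F \<Longrightarrow> 2 * t + 2 \<le> D \<Longrightarrow> expect (\<lambda>W. (F W)\<^sup>2 * h (point W)) \<ge> 0"
  shows "satisfies_ge0 d (2 * n) pseudo_dist h"
  using h pseudo_dist_support(2)
proof (rule satisfies_ge0I)
  fix q assume "poly_deg_le (2 * n) (d div 2) q"
  then show "pseudo_expectation pseudo_dist (\<lambda>z. (q z)\<^sup>2 * h z) \<ge> 0"
    unfolding pseudo_expectation_pseudo_dist using d by (intro nonneg junta_point) auto
qed

lemma pseudo_distribution_pseudo_dist:
  assumes "d \<le> D"
  shows "pseudo_distribution d (2 * n) pseudo_dist"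
  unfolding pseudo_distribution_def
proof (intro conjI allI impI; (elim conjE)?)
  show "pseudo_expectation pseudo_dist (\<lambda>z. 1) = 1"
    unfolding pseudo_expectation_pseudo_dist by (rule expect_one)
  fix q t assume "poly_deg_le (2 * n) t q" "real t \<le> real d / 2"
  then show "0 \<le> pseudo_expectation pseudo_dist (\<lambda>z. (q z)\<^sup>2)"
    unfolding pseudo_expectation_pseudo_dist using assms
    by (intro expect_square_nonneg[of t] junta_point) auto
qed (use pseudo_dist_support in auto)

lemma satisfies_eq0_pseudo_dist:
  assumes "line_poly (2 * n) h" "d + 2 \<le> D" "\<And>W. W \<subseteq> X \<Longrightarrow> h (point W) = 0"
  shows "satisfies_eq0 d (2 * n) pseudo_dist h"
proof -
  have "expect (\<lambda>W. (F W)\<^sup>2 * h (point W)) = 0" "expect (\<lambda>W. (F W)\<^sup>2 * - h (point W)) = 0" for F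
    using assms(3) by (auto simp: expect_def intro!: sum.neutral)
  moreover have "line_poly (2 * n) (\<lambda>z. - h z)"
    using line_poly_diff[OF line_poly_const[of _ 0] assms(1)] by simp
  ultimately show ?thesis
    unfolding satisfies_eq0_def using assms(1,2) by (intro conjI satisfies_ge0_pseudo_dist) simp_all
qed

lemma pseudo_equilibrium_game_of:
  assumes d: "d + 2 \<le> D"
  shows "pseudo_equilibrium d n (game_of g) pseudo_dist"
  unfolding pseudo_equilibrium_def
proof (intro conjI allI impI)
  show "pseudo_distribution d (2 * n) pseudo_dist"
    using d by (intro pseudo_distribution_pseudo_dist) simp
next
  fix i assume i: "i < n"
  show "satisfies_ge0 d (2 * n) pseudo_dist (\<lambda>z. vec_first z n $ i)"
    using i expect_played_nonneg[of _ _ i 0]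
    by (intro satisfies_ge0_pseudo_dist line_poly_first d) (auto simp: point_first)
  show "satisfies_ge0 d (2 * n) pseudo_dist (\<lambda>z. vec_last z n $ i)"
    using i expect_played_nonneg[of _ _ i k]
    by (intro satisfies_ge0_pseudo_dist line_poly_last d) (auto simp: point_last)
next
  show "satisfies_eq0 d (2 * n) pseudo_dist (\<lambda>z. (\<Sum>i<n. vec_first z n $ i) - 1)"
    by (intro satisfies_eq0_pseudo_dist line_poly_diff line_poly_sum line_poly_const line_poly_first d)
      (simp_all add: point_first sum_played_eq_1)
  show "satisfies_eq0 d (2 * n) pseudo_dist (\<lambda>z. (\<Sum>i<n. vec_last z n $ i) - 1)"
    by (intro satisfies_eq0_pseudo_dist line_poly_diff line_poly_sum line_poly_const line_poly_last d)
      (simp_all add: point_last sum_played_eq_1)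
next
  fix i assume i: "i < n"
  have carrier: "vec_first z n \<in> carrier_vec n" "vec_last z n \<in> carrier_vec n" for z :: "real vec"
    by (simp_all add: vec_first_def vec_last_def)
  show "satisfies_ge0 d (2 * n) pseudo_dist
      (\<lambda>z. row_advantage n (game_of g) i (vec_first z n) (vec_last z n))"
    unfolding row_advantage_game_of[OF carrier i]
  proof (intro satisfies_ge0_pseudo_dist d line_poly_advantage i line_poly_first line_poly_last)
    fix t F assume F: "junta X t F" "2 * t + 2 \<le> D"
    have "0 \<le> expect (\<lambda>W. (F W)\<^sup>2 * advantage g c i (played 0 W) (played k W))"
      using expect_constraint[OF _ _ F] signs
      by (intro expect_advantage_nonneg[OF F i]) auto
    then show "0 \<le> expect (\<lambda>W. (F W)\<^sup>2 * advantage g c i (($) (vec_first (point W) n)) (($) (vec_last (point W) n)))"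
      using advantage_cong[OF point_first point_last] by simp
  qed
  show "satisfies_ge0 d (2 * n) pseudo_dist
      (\<lambda>z. col_advantage n (game_of g) i (vec_first z n) (vec_last z n))"
    unfolding col_advantage_game_of[OF carrier i]
  proof (intro satisfies_ge0_pseudo_dist d line_poly_advantage i line_poly_first line_poly_last)
    fix t F assume F: "junta X t F" "2 * t + 2 \<le> D"
    have "0 \<le> expect (\<lambda>W. (F W)\<^sup>2 * advantage g (\<lambda>a b. c b a) i (played k W) (played 0 W))"
    proof (rule expect_advantage_nonneg[OF F i])
      fix a b assume "a < k" "b < k"
      from expect_constraint[OF this(2,1) F]
      show "expect (\<lambda>W. (F W)\<^sup>2 * (c b a * chi (p b) (slice W (k + a)) * chi (p a) (slice W (0 + b))))
          = expect (\<lambda>W. (F W)\<^sup>2)" by (simp add: mult_ac)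
    qed (use signs in auto)
    then show "0 \<le> expect (\<lambda>W. (F W)\<^sup>2 * advantage g (\<lambda>a b. c b a) i (($) (vec_last (point W) n)) (($) (vec_first (point W) n)))"
      using advantage_cong[OF point_last point_first] by simp
  qed
qed

lemma game_of_payoffs:
  "is_game n (game_of g)"
  "elements_mat (fst (game_of g)) \<subseteq> {-1..1}" "elements_mat (snd (game_of g)) \<subseteq> {-1..1}"
proof -
  have "\<bar>c a b\<bar> \<le> 1" for a b using signs[of a b] by auto
  then have "\<bar>pay g c i j\<bar> \<le> 1" "\<bar>pay g (\<lambda>a b. c b a) i j\<bar> \<le> 1" if "i < n" "j < n" for i j
    using that by (intro pay_bounds; simp)+
  then show "elements_mat (fst (game_of g)) \<subseteq> {-1..1}" "elements_mat (snd (game_of g)) \<subseteq> {-1..1}"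
    by (auto simp: game_of_def elements_mat_def abs_le_iff) (fastforce+)?
  show "is_game n (game_of g)" by (simp add: is_game_def game_of_def)
qed

section \<open>Approximate equilibria of the constructed games\<close>

lemma approx_NE_game_of:
  assumes "approx_NE \<epsilon> n (game_of g) x y"
  shows "mixed (($) x)" "mixed (($) y)"
    "best_reply g c (($) x) (($) y) \<epsilon>" "best_reply g (\<lambda>a b. c b a) (($) y) (($) x) \<epsilon>"
proof -
  have carrier: "x \<in> carrier_vec n" "y \<in> carrier_vec n"
    using assms by (auto simp: approx_NE_def mixed_strategies_def)
  show "mixed (($) x)" "mixed (($) y)"
    using assms by (auto simp: approx_NE_def mixed_strategies_def mixed_def)
  show "best_reply g c (($) x) (($) y) \<epsilon>"
    unfolding best_reply_def
  proof (intro allI impI)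
    fix i assume "i < n"
    then have "advantage g c i (($) x) (($) y) \<ge> - \<epsilon>"
      using assms row_advantage_game_of[OF carrier] by (auto simp: approx_NE_def)
    then show "(\<Sum>j<n. pay g c i j * y $ j) - \<epsilon> \<le> (\<Sum>i<n. x $ i * (\<Sum>j<n. pay g c i j * y $ j))"
      unfolding advantage_def by linarith
  qed
  show "best_reply g (\<lambda>a b. c b a) (($) y) (($) x) \<epsilon>"
    unfolding best_reply_def
  proof (intro allI impI)
    fix i assume "i < n"
    then have "advantage g (\<lambda>a b. c b a) i (($) y) (($) x) \<ge> - \<epsilon>"
      using assms col_advantage_game_of[OF carrier] by (auto simp: approx_NE_def)
    then show "(\<Sum>j<n. pay g (\<lambda>a b. c b a) i j * x $ j) - \<epsilon>
        \<le> (\<Sum>i<n. y $ i * (\<Sum>j<n. pay g (\<lambda>a b. c b a) i j * x $ j))"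
      unfolding advantage_def by linarith
  qed
qed

lemma approx_NE_code_mass:
  assumes NE: "approx_NE \<epsilon> n (game_of g) x y"
    and \<epsilon>: "0 \<le> \<epsilon>" "\<epsilon> \<le> 1/1000"
    and gap: "\<And>U V. (\<And>a. U a \<subseteq> {..<K}) \<Longrightarrow> (\<And>b. V b \<subseteq> {..<K}) \<Longrightarrow>
      (\<Sum>a<k. \<Sum>b<k. c a b * chi (p b) (U a) * chi (p a) (V b)) \<le> 7/8 * (real k)\<^sup>2"
    and g: "\<And>a. a < k \<Longrightarrow> g a \<subseteq> {..<K}"
    and T: "T \<subseteq> {..<k}"
  shows "(\<Sum>i\<in>Dev. x $ i * of_bool (blk i \<in> T \<and> lbl i = g (blk i))) \<ge> card T / k - 76 * \<epsilon>"
    "(\<Sum>i\<in>Dev. y $ i * of_bool (blk i \<in> T \<and> lbl i = g (blk i))) \<ge> card T / k - 76 * \<epsilon>"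
proof -
  have c: "\<bar>c a b\<bar> \<le> 1" for a b using signs[of a b] by auto
  note NE' = approx_NE_game_of[OF NE]
  note small = own_mass_small[OF NE' \<epsilon> c gap]
  show "(\<Sum>i\<in>Dev. x $ i * of_bool (blk i \<in> T \<and> lbl i = g (blk i))) \<ge> card T / k - 76 * \<epsilon>"
    by (rule code_mass[OF NE' c small g T])
  show "(\<Sum>i\<in>Dev. y $ i * of_bool (blk i \<in> T \<and> lbl i = g (blk i))) \<ge> card T / k - 76 * \<epsilon>"
    by (rule code_mass[OF NE'(2,1,4,3) c small(2,1) g T])
qed

end

section \<open>Parameters\<close>

text \<open>First-block strategies receive a dummy empty test, so question and answer determine
  them. Surplus indices repeat a second-block strategy, where repetitions do not disturb
  \<open>own_inj\<close>.\<close>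

lemma labelled_strategies_exist:
  assumes "0 < k" "k * 2 ^ K * (1 + 2 ^ k) \<le> n"
  obtains own blk lbl tst where "labelled_strategies n k K own blk lbl tst"
proof -
  define S1 :: "(bool \<times> nat \<times> nat set \<times> nat set) set" where
    "S1 = {True} \<times> {..<k} \<times> Pow {..<K} \<times> {{}}"
  define S2 :: "(bool \<times> nat \<times> nat set \<times> nat set) set" where
    "S2 = {False} \<times> {..<k} \<times> Pow {..<K} \<times> Pow {..<k}"
  have fin: "finite S1" "finite S2" by (simp_all add: S1_def S2_def)
  have "card (S1 \<union> S2) = card S1 + card S2"
    using fin by (intro card_Un_disjoint) (auto simp: S1_def S2_def)
  also have "\<dots> = k * 2 ^ K * (1 + 2 ^ k)"
    by (simp add: S1_def S2_def card_cartesian_product card_Pow algebra_simps)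
  finally have card: "card (S1 \<union> S2) \<le> n" using assms(2) by simp
  obtain h where h: "bij_betw h {0..<card (S1 \<union> S2)} (S1 \<union> S2)"
    using ex_bij_betw_nat_finite[of "S1 \<union> S2"] fin by blast
  define h' where "h' i = (if i < card (S1 \<union> S2) then h i else (False, 0, {}, {}))" for i
  have mem: "h' i \<in> S1 \<union> S2" for i
  proof (cases "i < card (S1 \<union> S2)")
    case True
    then have "h i \<in> S1 \<union> S2" using h bij_betwE by fastforce
    then show ?thesis using True by (simp add: h'_def)
  next
    case False
    then show ?thesis using assms(1) by (simp add: h'_def S2_def)
  qed
  have surj: "\<exists>i<n. h' i = s" if "s \<in> S1 \<union> S2" for s
  proof -
    have "s \<in> h ` {0..<card (S1 \<union> S2)}" using h that by (simp add: bij_betw_def)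
    then obtain i where "i < card (S1 \<union> S2)" "h i = s" by auto
    then show ?thesis using card by (intro exI[of _ i]) (simp add: h'_def)
  qed
  define own blk lbl tst where "own i = fst (h' i)" and "blk i = fst (snd (h' i))"
    and "lbl i = fst (snd (snd (h' i)))" and "tst i = snd (snd (snd (h' i)))" for i
  note defs = own_def blk_def lbl_def tst_def
  have "labelled_strategies n k K own blk lbl tst"
  proof
    show "0 < k" by (rule assms(1))
    show "blk i < k" "lbl i \<subseteq> {..<K}" "tst i \<subseteq> {..<k}" for i
      using mem[of i] by (auto simp: defs S1_def S2_def)
  next
    fix i j assume ij: "own i" "own j" "blk i = blk j" "lbl i = lbl j"
    have "tst i = {}" "tst j = {}"
      using mem[of i] mem[of j] ij(1,2) by (auto simp: defs S1_def S2_def)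
    then have eq: "h' i = h' j" using ij by (simp add: defs prod_eq_iff)
    have "i < card (S1 \<union> S2)" "j < card (S1 \<union> S2)"
      using ij(1,2) by (auto simp: own_def h'_def split: if_splits)
    then show "i = j" using h eq by (auto simp: h'_def bij_betw_def inj_on_def)
  next
    fix a U assume "a < k" "U \<subseteq> {..<K}"
    then obtain i where "i < n" "h' i = (True, a, U, {})"
      using surj[of "(True, a, U, {})"] by (auto simp: S1_def)
    then show "\<exists>i<n. own i \<and> blk i = a \<and> lbl i = U" by (auto simp: defs intro!: exI[of _ i])
  next
    fix a U T assume "a < k" "U \<subseteq> {..<K}" "T \<subseteq> {..<k}"
    then obtain i where "i < n" "h' i = (False, a, U, T)"
      using surj[of "(False, a, U, T)"] by (auto simp: S2_def)
    then show "\<exists>i<n. \<not> own i \<and> blk i = a \<and> lbl i = U \<and> tst i = T"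
      by (auto simp: defs intro!: exI[of _ i])
  qed
  then show ?thesis using that by blast
qed

lemma unsatisfiable_signs_exist:
  assumes "0 < K" "k = 4 * K"
  obtains c :: "nat \<Rightarrow> nat \<Rightarrow> real" where "\<And>a b. c a b = 1 \<or> c a b = -1"
    "\<And>U V. (\<And>a. U a \<subseteq> {..<K}) \<Longrightarrow> (\<And>b. V b \<subseteq> {..<K}) \<Longrightarrow>
      (\<Sum>a<k. \<Sum>b<k. c a b * chi (p b) (U a) * chi (p a) (V b)) \<le> 7/8 * (real k)\<^sup>2"
proof -
  let ?I = "{..<k} \<times> {..<k}" and ?F = "{..<k} \<rightarrow>\<^sub>E Pow {..<K}"
  define s :: "(nat \<Rightarrow> nat set) \<times> (nat \<Rightarrow> nat set) \<Rightarrow> nat \<times> nat \<Rightarrow> real" where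
    "s UV x = chi (p (snd x)) (fst UV (fst x)) * chi (p (fst x)) (snd UV (snd x))" for UV x
  have fin: "finite (?F \<times> ?F)" by (intro finite_cartesian_product finite_PiE) auto
  have "card (s ` (?F \<times> ?F)) \<le> card (?F \<times> ?F)" by (intro card_image_le fin)
  also have "\<dots> = (2 ^ K) ^ k * (2 ^ K) ^ k"
    by (simp add: card_cartesian_product card_PiE card_Pow)
  also have "\<dots> = 2 ^ (8 * K * K)"
    unfolding assms(2) by (simp flip: power_mult power_add)
  finally have "real (card (s ` (?F \<times> ?F))) \<le> 2 ^ (8 * K * K)"
    by (metis of_nat_le_iff of_nat_numeral of_nat_power)
  also have "(2 :: real) ^ (8 * K * K) = (sqrt 2 ^ 2) ^ (8 * K * K)" by simp
  also have "\<dots> = sqrt 2 ^ card ?I"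
    unfolding power_mult[symmetric] by (simp add: assms(2) card_cartesian_product)
  finally have small: "real (card (s ` (?F \<times> ?F))) \<le> sqrt 2 ^ card ?I" .
  obtain c where c: "\<And>x. c x = 1 \<or> c x = -1"
    and gap: "\<And>r. r \<in> s ` (?F \<times> ?F) \<Longrightarrow> (\<Sum>x\<in>?I. c x * r x) \<le> 7/8 * card ?I"
  proof (rule far_sign_matrix_exists[of ?I "s ` (?F \<times> ?F)"])
    fix r x assume "r \<in> s ` (?F \<times> ?F)"
    then obtain UV where "r = s UV" by blast
    then show "r x = 1 \<or> r x = -1"
      using chi_cases[of "p (snd x)" "fst UV (fst x)"] chi_cases[of "p (fst x)" "snd UV (snd x)"]
      by (auto simp: s_def)
  next
    show "?I \<noteq> {}" using assms by (auto simp: lessThan_empty_iff)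
  qed (use fin small in auto)
  show ?thesis
  proof (rule that[of "\<lambda>a b. c (a, b)"])
    fix U V :: "nat \<Rightarrow> nat set" assume UV: "\<And>a. U a \<subseteq> {..<K}" "\<And>b. V b \<subseteq> {..<K}"
    \<comment> \<open>Only the answers to questions below k matter; restricting makes U and V
      members of the finite function space that was counted.\<close>
    let ?UV = "(restrict U {..<k}, restrict V {..<k})"
    have "?UV \<in> ?F \<times> ?F" using UV by auto
    then have "(\<Sum>x\<in>?I. c x * s ?UV x) \<le> 7/8 * card ?I" by (intro gap) blast
    moreover have "(\<Sum>x\<in>?I. c x * s ?UV x)
        = (\<Sum>a<k. \<Sum>b<k. c (a, b) * chi (p b) (U a) * chi (p a) (V b))"
      unfolding sum.cartesian_product by (intro sum.cong refl) (auto simp: s_def)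
    ultimately show "(\<Sum>a<k. \<Sum>b<k. c (a, b) * chi (p b) (U a) * chi (p a) (V b)) \<le> 7/8 * (real k)\<^sup>2"
      by (simp add: card_cartesian_product power2_eq_square)
  qed (rule c)
qed

text \<open>Squaring turns the power of 16 into at most 2^K; per unit of K there remains 2 *
  (17/16)^8 < 3.25 against 4.\<close>

lemma independence_budget:
  assumes "0 < K"
  shows "(17/16 :: real) ^ (4 * K) * 16 ^ (K div 8) < 2 ^ K"
proof (rule power2_less_imp_less)
  have "((17/16 :: real) ^ (4 * K) * 16 ^ (K div 8))\<^sup>2 = ((17/16) ^ 8) ^ K * 2 ^ (8 * (K div 8))"
  proof -
    have "((17/16 :: real) ^ (4 * K))\<^sup>2 = ((17/16) ^ 8) ^ K"
      by (simp only: power_mult[symmetric] mult.commute mult.left_commute) simp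
    moreover have "((16 :: real) ^ (K div 8))\<^sup>2 = 2 ^ (8 * (K div 8))"
    proof -
      have "((16 :: real) ^ (K div 8))\<^sup>2 = (16\<^sup>2) ^ (K div 8)" by (simp only: power_mult[symmetric] mult.commute)
      then show ?thesis by (simp add: power_mult)
    qed
    ultimately show ?thesis by (simp only: power_mult_distrib)
  qed
  also have "\<dots> \<le> ((17/16) ^ 8) ^ K * 2 ^ K"
    by (intro mult_left_mono power_increasing) auto
  also have "\<dots> = ((17/16) ^ 8 * 2) ^ K" by (simp only: power_mult_distrib)
  also have "\<dots> < 4 ^ K" using assms by (intro power_strict_mono) (auto simp: power_divide)
  also have "\<dots> = (2 ^ K)\<^sup>2" by (simp add: power2_eq_square flip: power_mult_distrib)
  finally show "((17/16 :: real) ^ (4 * K) * 16 ^ (K div 8))\<^sup>2 < (2 ^ K)\<^sup>2" .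
qed simp

lemma game_family_exists:
  assumes K: "32 \<le> K" and n: "2 ^ (16 * K) \<le> n"
  shows "\<exists>G :: nat \<Rightarrow> game.
    (\<forall>i\<in>{1..2 ^ (K * K)}. is_game n (G i) \<and>
       elements_mat (fst (G i)) \<subseteq> {-1..1} \<and> elements_mat (snd (G i)) \<subseteq> {-1..1}) \<and>
    (\<exists>\<mu>. pseudo_distribution (K div 16 - 2) (2 * n) \<mu> \<and>
       (\<forall>i\<in>{1..2 ^ (K * K)}. pseudo_equilibrium (K div 16 - 2) n (G i) \<mu>)) \<and>
    (\<forall>i\<in>{1..2 ^ (K * K)}. \<forall>j\<in>{1..2 ^ (K * K)}. i \<noteq> j \<longrightarrow>
       (\<forall>x y x' y'. approx_NE (1/1000) n (G i) x y \<and> approx_NE (1/1000) n (G j) x' y' \<longrightarrow>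
          x \<noteq> x' \<and> y \<noteq> y'))"
proof -
  define k where "k = 4 * K"
  have K_pos: "0 < K" and k_pos: "0 < k" using K by (simp_all add: k_def)
  have "k * 2 ^ K * (1 + 2 ^ k) \<le> n"
  proof -
    have "k \<le> 2 ^ 2 * 2 ^ K" using less_exp[of K] by (simp add: k_def)
    moreover have "(1 :: nat) + 2 ^ k \<le> 2 ^ (4 * K + 1)" by (simp add: k_def)
    ultimately have "k * 2 ^ K * (1 + 2 ^ k) \<le> (2 ^ 2 * 2 ^ K) * 2 ^ K * 2 ^ (4 * K + 1)"
      by (intro mult_mono) auto
    also have "\<dots> = 2 ^ (2 + K + K + (4 * K + 1))" by (simp only: power_add)
    also have "\<dots> \<le> 2 ^ (16 * K)" using K_pos by (intro power_increasing) auto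
    finally show ?thesis using n by simp
  qed
  then obtain own blk lbl tst where strategies: "labelled_strategies n k K own blk lbl tst"
    using labelled_strategies_exist k_pos by blast
  obtain p :: "nat \<Rightarrow> nat set" where p: "\<And>b. b < k \<Longrightarrow> p b \<subseteq> {..<K}"
    "\<And>J. J \<subseteq> {..<k} \<Longrightarrow> J \<noteq> {} \<Longrightarrow> card J \<le> K div 8 \<Longrightarrow> xor_sum p J \<noteq> {}"
    using independent_sets_exist[OF independence_budget[OF K_pos]] unfolding k_def by blast
  obtain c :: "nat \<Rightarrow> nat \<Rightarrow> real" where c: "\<And>a b. c a b = 1 \<or> c a b = -1"
    and gap: "\<And>U V. (\<And>a. U a \<subseteq> {..<K}) \<Longrightarrow> (\<And>b. V b \<subseteq> {..<K}) \<Longrightarrow>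
      (\<Sum>a<k. \<Sum>b<k. c a b * chi (p b) (U a) * chi (p a) (V b)) \<le> 7/8 * (real k)\<^sup>2"
    using unsatisfiable_signs_exist[OF K_pos k_def, of p] by blast
  \<comment> \<open>In exponents of 2: K^2 for the number of games, 4K from the factor 2 and 2K^2
    from the square root, against 4K^2 for all functions. This fits as soon as K > 4.\<close>
  have budget: "real (2 ^ (K * K)) * (2 * sqrt (card (Pow {..<K}))) ^ card {..<k}
      < real (card (Pow {..<K})) ^ card {..<k}"
  proof -
    have "sqrt (2 ^ K) ^ (4 * K) = ((sqrt (2 ^ K))\<^sup>2) ^ (2 * K)"
      by (simp only: power_mult[symmetric] mult.assoc[symmetric]) simp
    then have "sqrt (2 ^ K) ^ (4 * K) = 2 ^ (2 * (K * K))" by (simp flip: power_mult add: mult_ac)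
    then have "real (2 ^ (K * K)) * (2 * sqrt (card (Pow {..<K}))) ^ card {..<k}
        = 2 ^ (K * K + (4 * K + 2 * (K * K)))"
      by (simp add: card_Pow k_def power_mult_distrib flip: power_add)
    also have "\<dots> < 2 ^ (K * (4 * K))"
    proof (intro power_strict_increasing)
      have "4 * K < K * K" using K by simp
      then show "K * K + (4 * K + 2 * (K * K)) < K * (4 * K)" by simp
    qed simp
    finally show ?thesis by (simp add: card_Pow k_def power_mult)
  qed
  have "finite (Pow {..<K})" by simp
  from far_functions_exist[OF finite_lessThan this budget] obtain g :: "nat \<Rightarrow> nat \<Rightarrow> nat set"
    where g: "\<And>j. j \<le> 2 ^ (K * K) \<Longrightarrow> g j \<in> {..<k} \<rightarrow>\<^sub>E Pow {..<K}"
    "\<And>i j. i \<le> 2 ^ (K * K) \<Longrightarrow> j \<le> 2 ^ (K * K) \<Longrightarrow> i \<noteq> j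
      \<Longrightarrow> 2 * card {a \<in> {..<k}. g i a = g j a} \<le> card {..<k}"
    by blast
  interpret labelled_strategies n k K own blk lbl tst p by (rule strategies)
  \<comment> \<open>D = K div 16 keeps 2 * D within the independence K div 8, and K \<ge> 32 gives D
    \<ge> 2.\<close>
  interpret game_family n k K "K div 16" own blk lbl tst p c
  proof (unfold_locales)
    fix J :: "nat set" assume "J \<subseteq> {..<k}" "J \<noteq> {}" "card J \<le> 2 * (K div 16)"
    then show "xor_sum p J \<noteq> {}" by (intro p(2)) auto
  qed (use p(1) c K in auto)
  have d: "K div 16 - 2 + 2 \<le> K div 16" using K by simp
  have code: "g i a \<subseteq> {..<K}" if "i \<in> {1..2 ^ (K * K)}" "a < k" for i a
    using g(1)[of i] that by auto
  show ?thesis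
  proof (intro exI[of _ "\<lambda>i. game_of (g i)"] exI[of _ pseudo_dist] conjI ballI allI impI; (elim conjE)?)
    fix i j x y x' y'
    assume i: "i \<in> {1..2 ^ (K * K)}" and j: "j \<in> {1..2 ^ (K * K)}" and "i \<noteq> j"
      and NE: "approx_NE (1/1000) n (game_of (g i)) x y" "approx_NE (1/1000) n (game_of (g j)) x' y'"
    have far: "2 * card {a \<in> {..<k}. g i a = g j a} \<le> k"
      using g(2)[of i j] i j \<open>i \<noteq> j\<close> by simp
    note mass_i = approx_NE_code_mass[OF NE(1) _ _ gap code[OF i]]
    note mass_j = approx_NE_code_mass[OF NE(2) _ _ gap code[OF j]]
    show "x \<noteq> x'"
    proof
      assume "x = x'"
      then show False
        using codes_incompatible[OF approx_NE_game_of(1)[OF NE(1)] _ far, of "1/1000"] mass_i(1) mass_j(1)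
        by auto
    qed
    show "y \<noteq> y'"
    proof
      assume "y = y'"
      then show False
        using codes_incompatible[OF approx_NE_game_of(2)[OF NE(1)] _ far, of "1/1000"] mass_i(2) mass_j(2)
        by auto
    qed
  qed (use game_of_payoffs pseudo_equilibrium_game_of[OF d] pseudo_distribution_pseudo_dist in auto)
qed

theorem mainTheorem5:
  shows "\<exists>(c1::real) > 0. \<exists>(c2::real) > 0. \<exists>(\<epsilon>::real) > 0.
    \<forall>\<^sub>F n :: nat in sequentially.
      \<exists>(\<Gamma>::nat) (G :: nat \<Rightarrow> game).
        real \<Gamma> \<ge> real n powr (c1 * ln (real n)) \<and>
        (\<forall>i\<in>{1..\<Gamma>}. is_game n (G i) \<and>
           elements_mat (fst (G i)) \<subseteq> {-1..1} \<and> elements_mat (snd (G i)) \<subseteq> {-1..1}) \<and>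
        (\<exists>d \<mu>. real d \<ge> c2 * ln (real n) \<and> pseudo_distribution d (2 * n) \<mu> \<and>
           (\<forall>i\<in>{1..\<Gamma>}. pseudo_equilibrium d n (G i) \<mu>)) \<and>
        (\<forall>i\<in>{1..\<Gamma>}. \<forall>j\<in>{1..\<Gamma>}. i \<noteq> j \<longrightarrow>
           (\<forall>x y x' y'. approx_NE \<epsilon> n (G i) x y \<and> approx_NE \<epsilon> n (G j) x' y' \<longrightarrow>
              x \<noteq> x' \<and> y \<noteq> y'))"
proof (rule exI[of _ "1/2048"], rule conjI, simp, rule exI[of _ "1/1024"], rule conjI, simp,
    rule exI[of _ "1/1000"], rule conjI, simp)
  \<comment> \<open>For L = ln n, K will be at least L/16 - 1 \<ge> L/32, so K^2 ln 2 \<ge> L^2/2048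
    by ln 2 \<ge> 1/2; and K div 16 - 2 \<ge> L/256 - 3 \<ge> L/1024 once L \<ge> 1024. The
    threshold 5120 leaves ample room, also for K \<ge> 32.\<close>
  have "\<forall>\<^sub>F n :: nat in sequentially. exp 5120 \<le> real n"
    using filterlim_real_sequentially eventually_ge_at_top[of "exp 5120 :: real"]
    by (auto simp: filterlim_iff)
  then show "\<forall>\<^sub>F n :: nat in sequentially.
      \<exists>(\<Gamma>::nat) (G :: nat \<Rightarrow> game).
        real \<Gamma> \<ge> real n powr (1/2048 * ln (real n)) \<and>
        (\<forall>i\<in>{1..\<Gamma>}. is_game n (G i) \<and>
           elements_mat (fst (G i)) \<subseteq> {-1..1} \<and> elements_mat (snd (G i)) \<subseteq> {-1..1}) \<and>
        (\<exists>d \<mu>. real d \<ge> 1/1024 * ln (real n) \<and> pseudo_distribution d (2 * n) \<mu> \<and>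
           (\<forall>i\<in>{1..\<Gamma>}. pseudo_equilibrium d n (G i) \<mu>)) \<and>
        (\<forall>i\<in>{1..\<Gamma>}. \<forall>j\<in>{1..\<Gamma>}. i \<noteq> j \<longrightarrow>
           (\<forall>x y x' y'. approx_NE (1/1000) n (G i) x y \<and> approx_NE (1/1000) n (G j) x' y' \<longrightarrow>
              x \<noteq> x' \<and> y \<noteq> y'))"
  proof (rule eventually_mono)
    fix n :: nat assume large: "exp 5120 \<le> real n"
    define L where "L = ln (real n)"
    have n_pos: "0 < real n" using large exp_gt_zero[of "5120 :: real"] by linarith
    have L: "5120 \<le> L" using large n_pos unfolding L_def by (simp add: ln_ge_iff)
    have ln2: "1/2 \<le> ln (2 :: real)" "ln (2 :: real) \<le> 1"
      using ln_le_minus_one[of "1/2 :: real"] ln_le_minus_one[of "2 :: real"] by (simp_all add: ln_div)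
    \<comment> \<open>The largest K with 2^(16K) \<le> n.\<close>
    define K where "K = nat \<lfloor>L / (16 * ln 2)\<rfloor>"
    have nonneg: "0 \<le> L / (16 * ln 2)" using L ln2 by simp
    have K_le: "real K \<le> L / (16 * ln 2)" using nonneg by (simp add: K_def)
    have "L / 16 \<le> L / (16 * ln 2)" using L ln2 by (intro divide_left_mono) auto
    moreover have "L / (16 * ln 2) \<le> real K + 1" using nonneg by (simp add: K_def)
    ultimately have K_ge: "L / 16 - 1 \<le> real K" by linarith
    have K_large: "32 \<le> K" using K_ge L by linarith
    have "2 ^ (16 * K) = exp (real (16 * K) * ln 2)"
      by (simp only: exp_of_nat_mult) simp
    also have "\<dots> \<le> exp L" using K_le ln2 by (simp add: field_simps)
    also have "\<dots> = real n" using n_pos by (simp add: L_def)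
    finally have "real (2 ^ (16 * K)) \<le> real n" by simp
    then have n: "2 ^ (16 * K) \<le> n" by (simp only: of_nat_le_iff)
    have \<Gamma>: "real n powr (1/2048 * ln (real n)) \<le> real (2 ^ (K * K))"
    proof -
      have "L / 32 \<le> real K" using K_ge L by linarith
      then have "L / 32 * (L / 32) \<le> real K * real K" using L by (intro mult_mono) auto
      from mult_mono[OF this ln2(1)] have "L / 32 * (L / 32) * (1/2) \<le> real K * real K * ln 2"
        by simp
      then have "1/2048 * L * L \<le> real (K * K) * ln 2" by simp
      then have "exp (1/2048 * L * L) \<le> exp (real (K * K) * ln 2)" by simp
      also have "\<dots> = 2 ^ (K * K)" by (simp only: exp_of_nat_mult) simp
      finally show ?thesis using n_pos by (simp add: powr_def L_def)
    qed
    have d: "1/1024 * ln (real n) \<le> real (K div 16 - 2)"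
    proof -
      have "real K \<le> 16 * real (K div 16) + 15"
      proof -
        have "K \<le> 16 * (K div 16) + 15" by presburger
        then show ?thesis by linarith
      qed
      moreover have "real (K div 16) - 2 \<le> real (K div 16 - 2)" by linarith
      ultimately show ?thesis using K_ge L unfolding L_def[symmetric] by linarith
    qed
    from game_family_exists[OF K_large n] obtain G :: "nat \<Rightarrow> game" where G:
      "\<forall>i\<in>{1..2 ^ (K * K)}. is_game n (G i) \<and>
         elements_mat (fst (G i)) \<subseteq> {-1..1} \<and> elements_mat (snd (G i)) \<subseteq> {-1..1}"
      "\<exists>\<mu>. pseudo_distribution (K div 16 - 2) (2 * n) \<mu> \<and>
         (\<forall>i\<in>{1..2 ^ (K * K)}. pseudo_equilibrium (K div 16 - 2) n (G i) \<mu>)"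
      "\<forall>i\<in>{1..2 ^ (K * K)}. \<forall>j\<in>{1..2 ^ (K * K)}. i \<noteq> j \<longrightarrow>
         (\<forall>x y x' y'. approx_NE (1/1000) n (G i) x y \<and> approx_NE (1/1000) n (G j) x' y' \<longrightarrow>
            x \<noteq> x' \<and> y \<noteq> y')" by - (erule exE, elim conjE, rule that)
    show "\<exists>(\<Gamma>::nat) (G :: nat \<Rightarrow> game).
        real \<Gamma> \<ge> real n powr (1/2048 * ln (real n)) \<and>
        (\<forall>i\<in>{1..\<Gamma>}. is_game n (G i) \<and>
           elements_mat (fst (G i)) \<subseteq> {-1..1} \<and> elements_mat (snd (G i)) \<subseteq> {-1..1}) \<and>
        (\<exists>d \<mu>. real d \<ge> 1/1024 * ln (real n) \<and> pseudo_distribution d (2 * n) \<mu> \<and>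
           (\<forall>i\<in>{1..\<Gamma>}. pseudo_equilibrium d n (G i) \<mu>)) \<and>
        (\<forall>i\<in>{1..\<Gamma>}. \<forall>j\<in>{1..\<Gamma>}. i \<noteq> j \<longrightarrow>
           (\<forall>x y x' y'. approx_NE (1/1000) n (G i) x y \<and> approx_NE (1/1000) n (G j) x' y' \<longrightarrow>
              x \<noteq> x' \<and> y \<noteq> y'))"
    proof (rule exI[of _ "2 ^ (K * K)"], rule exI[of _ G], intro conjI)
      from G(2) obtain \<mu> where "pseudo_distribution (K div 16 - 2) (2 * n) \<mu>"
        "\<forall>i\<in>{1..2 ^ (K * K)}. pseudo_equilibrium (K div 16 - 2) n (G i) \<mu>" by (elim exE conjE)
      with d show "\<exists>d \<mu>. real d \<ge> 1/1024 * ln (real n) \<and> pseudo_distribution d (2 * n) \<mu> \<and>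
          (\<forall>i\<in>{1..2 ^ (K * K)}. pseudo_equilibrium d n (G i) \<mu>)"
        by (intro exI conjI)
    qed (rule \<Gamma> G(1) G(3))+
  qed
qed

end
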